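(* Let $\mathbb{H}$ be a finite-dimensional complex Hilbert space, let $T>0$, let $\tilde H\in\mathcal{B}(\mathbb{H})$ be self-adjoint, let $A\in\mathcal{B}(\mathbb{H}\otimes\mathbb{H})$ be self-adjoint and exchange-symmetric (that is, $\mathrm{S}A\mathrm{S}=A$ with $\mathrm{S}$ the flip operator), and let $L\in\mathcal{B}(\mathbb{H})$. Let $\varrho_0\in\mathcal{S}(\mathbb{H})$ and, for each $N\ge 1$, let $(\bar{\boldsymbol\rho}^N_t)_{t\in[0,T]}$ be the solution in $\mathcal{S}(\mathbb{H}^{\otimes N})$ of the $N$-body Lindblad equation $$\frac{\mathrm{d}\bar{\boldsymbol\rho}^N_t}{\mathrm{d}t}=-\mathrm{i}\Bigl[\sum_{l=1}^N\tilde{\mathbf{H}}_l+\frac1N\sum_{1\le l<l'\le N}\mathbf{A}_{ll'},\,\bar{\boldsymbol\rho}^N_t\Bigr]+\sum_{l=1}^N\Bigl(\mathbf{L}_l\bar{\boldsymbol\rho}^N_t\mathbf{L}_l^\dagger-\tfrac12\{\mathbf{L}_l^\dagger\mathbf{L}_l,\bar{\boldsymbol\rho}^N_t\}\Bigr),\qquad \bar{\boldsymbol\rho}^N_0=\varrho_0^{\otimes N}.$$ Let $m_0\in\mathcal{S}(\mathbb{H})$ be faithful ($m_0>0$) and let $(m_t)_{t\in[0,T]}$ be the solution in $\mathcal{S}(\mathbb{H})$, with initial datum $m_0$, of the mean-field Lindblad equation $$\frac{\mathrm{d}m_t}{\mathrm{d}t}=-\mathrm{i}[\tilde H+A^{m_t},m_t]+Lm_tL^\dagger-\tfrac12\{L^\dagger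 L,m_t\},\qquad A^{\sigma}:=\mathrm{tr}_2\bigl((\mathbf{1}\otimes\sigma)A\bigr).$$ Set $$\mathfrak{H}_N(t):=\frac1N\,\mathfrak{D}\bigl(\bar{\boldsymbol\rho}^N_t\,\big\|\,m_t^{\otimes N}\bigr),\qquad \mathrm{K}:=-\log\lambda_{\min}(m_0)+\|L\|^2T .$$ Then for every $0<\mathfrak{q}<\dfrac{e^{-2}}{8\|A\|\mathrm{K}}$, every $t\in[0,T]$ and every $N\ge1$, $$\mathfrak{H}_N(t)\le e^{t/\mathfrak{q}}\left(\mathfrak{H}_N(0)+\frac{\log C_{T,\mathfrak{q}}+2\mathfrak{q}\|A\|\mathrm{K}}{N}\right),$$ where $$C_{T,\mathfrak{q}}:=1+\frac{x_{T,\mathfrak{q}}}{(1-x_{T,\mathfrak{q}})^2}+\frac{y_{T,\mathfrak{q}}}{1-y_{T,\mathfrak{q}}},\qquad x_{T,\mathfrak{q}}:=8e^2\mathfrak{q}\|A\|\mathrm{K},\qquad y_{T,\mathfrak{q}}:=16e\,\mathfrak{q}\|A\|\mathrm{K}.$$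
   Context: $\mathcal{B}(\mathbb{H})$ is the space of linear operators on $\mathbb{H}$ with operator norm $\|\cdot\|$; $\mathcal{S}(\mathbb{H})=\{\rho\in\mathcal{B}(\mathbb{H}):\rho=\rho^\dagger,\ \rho\ge0,\ \mathrm{tr}(\rho)=1\}$ is the set of density operators; a state $\rho$ is faithful if $\rho>0$. $\lambda_{\min}(O)$ is the smallest eigenvalue of a self-adjoint $O$. $[X,Y]=XY-YX$ and $\{X,Y\}=XY+YX$. For $O\in\mathcal{B}(\mathbb{H})$, $\mathbf{O}_l\in\mathcal{B}(\mathbb{H}^{\otimes N})$ acts as $O$ on the $l$-th tensor factor and as the identity on the others; for $B\in\mathcal{B}(\mathbb{H}\otimes\mathbb{H})$ and $l\neq l'$, $\mathbf{B}_{ll'}\in\mathcal{B}(\mathbb{H}^{\otimes N})$ acts as $B$ on the $l$-th and $l'$-th factors and as the identity on the others. The flip operator $\mathrm{S}$ on $\mathbb{H}\otimes\mathbb{H}$ is $\mathrm{S}(\psi\otimes\varphi)=\varphi\otimes\psi$. The partial trace $\mathrm{tr}_2:\mathcal{B}(\mathbb{H}\otimes\mathbb{H})\to\mathcal{B}(\mathbb{H})$ is the linear map with $\mathrm{tr}_2(X\otimes Y)=\mathrm{tr}(Y)X$. The (Umegaki) quantum relative entropy of density operators is $\mathfrak{D}(\rho\|\sigma)=\mathrm{tr}(\rho(\log\rho-\log\sigma))$ if $\mathrm{supp}(\rho)\subseteq\mathrm{supp}(\sigma)$ (with the convention $0\log0=0$), and $+\infty$ otherwise, where $\mathrm{supp}$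 denotes the orthogonal projection onto the range. *)

theory Defs
  imports "HOL-Analysis.Analysis"
begin

(* Conventions.  A finite-dimensional complex Hilbert space H (which is nonzero, as it carries
   states) with a chosen orthonormal basis is complex ^ 'd, and operators on it are matrices, with
   the product ** and the action *v.  The N-fold tensor power of H is complex ^ ('n => 'd), where
   the particles are labelled by a finite linearly ordered type 'n with N = CARD('n) elements: the
   basis vector with index f is the tensor product over l of the basis vectors f l.  Likewise the
   tensor square of H is complex ^ ('d * 'd). *)

section \<open>Operators\<close>

definition adj :: "complex ^ 'm ^ 'n \<Rightarrow> complex ^ 'n ^ 'm" where
  "adj X = (\<chi> i j. cnj (X $ j $ i))"

definition self_adjoint :: "complex ^ 'n ^ 'n \<Rightarrow> bool" where
  "self_adjoint X \<longleftrightarrow> adj X = X"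

(* The inner product of HOL-Analysis on complex ^ 'n is the real part of the Hermitian one; for
   self-adjoint X the quadratic form of X is real, so that nothing is lost. *)
definition pos_semidef :: "complex ^ 'n ^ 'n \<Rightarrow> bool" where
  "pos_semidef X \<longleftrightarrow> self_adjoint X \<and> (\<forall>v. 0 \<le> v \<bullet> (X *v v))"

definition pos_def :: "complex ^ 'n ^ 'n \<Rightarrow> bool" where
  "pos_def X \<longleftrightarrow> self_adjoint X \<and> (\<forall>v. v \<noteq> 0 \<longrightarrow> 0 < v \<bullet> (X *v v))"

definition density_ops :: "(complex ^ 'n ^ 'n) set" where
  "density_ops = {\<rho>. self_adjoint \<rho> \<and> pos_semidef \<rho> \<and> trace \<rho> = 1}"

definition op_norm :: "complex ^ 'n ^ 'n \<Rightarrow> real" where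
  "op_norm X = onorm (\<lambda>v. X *v v)"

definition commutator :: "complex ^ 'n ^ 'n \<Rightarrow> complex ^ 'n ^ 'n \<Rightarrow> complex ^ 'n ^ 'n" where
  "commutator X Y = X ** Y - Y ** X"

definition anticommutator :: "complex ^ 'n ^ 'n \<Rightarrow> complex ^ 'n ^ 'n \<Rightarrow> complex ^ 'n ^ 'n" where
  "anticommutator X Y = X ** Y + Y ** X"

section \<open>Spectrum, logarithm and relative entropy\<close>

definition eigenspace :: "complex ^ 'n ^ 'n \<Rightarrow> real \<Rightarrow> (complex ^ 'n) set" where
  "eigenspace X r = {v. X *v v = complex_of_real r *s v}"

(* Only real eigenvalues are considered: these functions are meant for self-adjoint operators. *)
definition real_spectrum :: "complex ^ 'n ^ 'n \<Rightarrow> real set" where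
  "real_spectrum X = {r. \<exists>v. v \<noteq> 0 \<and> v \<in> eigenspace X r}"

definition lambda_min :: "complex ^ 'n ^ 'n \<Rightarrow> real" where
  "lambda_min X = Min (real_spectrum X)"

definition orth_proj :: "(complex ^ 'n) set \<Rightarrow> complex ^ 'n ^ 'n" where
  "orth_proj S = matrix (closest_point S)"

definition op_fun :: "(real \<Rightarrow> real) \<Rightarrow> complex ^ 'n ^ 'n \<Rightarrow> complex ^ 'n ^ 'n" where
  "op_fun f X = (\<Sum>r\<in>real_spectrum X. f r *\<^sub>R orth_proj (eigenspace X r))"

(* Setting the logarithm to 0 on the kernel gives the convention 0 log 0 = 0. *)
definition op_log :: "complex ^ 'n ^ 'n \<Rightarrow> complex ^ 'n ^ 'n" where
  "op_log X = op_fun (\<lambda>r. if r = 0 then 0 else ln r) X"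

definition supp :: "complex ^ 'n ^ 'n \<Rightarrow> complex ^ 'n ^ 'n" where
  "supp X = orth_proj (range (\<lambda>v. X *v v))"

(* Inclusion of projections is inclusion of their ranges.  The trace below is real for
   self-adjoint arguments. *)
definition rel_entropy :: "complex ^ 'n ^ 'n \<Rightarrow> complex ^ 'n ^ 'n \<Rightarrow> ereal" where
  "rel_entropy \<rho> \<sigma> =
     (if range (\<lambda>v. supp \<rho> *v v) \<subseteq> range (\<lambda>v. supp \<sigma> *v v)
      then ereal (Re (trace (\<rho> ** (op_log \<rho> - op_log \<sigma>)))) else \<infinity>)"

section \<open>Tensor products\<close>

definition kron ::
  "complex ^ 'd ^ 'd \<Rightarrow> complex ^ 'd ^ 'd \<Rightarrow> complex ^ ('d \<times> 'd) ^ ('d::finite \<times> 'd)" where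
  "kron X Y = (\<chi> p q. X $ fst p $ fst q * Y $ snd p $ snd q)"

definition kron_vec :: "complex ^ 'd \<Rightarrow> complex ^ 'd \<Rightarrow> complex ^ ('d::finite \<times> 'd)" where
  "kron_vec u v = (\<chi> p. u $ fst p * v $ snd p)"

definition flip_op :: "complex ^ ('d \<times> 'd) ^ ('d::finite \<times> 'd)" where
  "flip_op = (\<chi> p q. if p = prod.swap q then 1 else 0)"

definition ptrace2 :: "complex ^ ('d \<times> 'd) ^ ('d::finite \<times> 'd) \<Rightarrow> complex ^ 'd ^ 'd" where
  "ptrace2 X = (\<chi> a b. \<Sum>c\<in>UNIV. X $ (a, c) $ (b, c))"

definition tensor_vec :: "('n \<Rightarrow> complex ^ 'd) \<Rightarrow> complex ^ ('n::finite \<Rightarrow> 'd::finite)" where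
  "tensor_vec v = (\<chi> f. \<Prod>l\<in>UNIV. v l $ f l)"

definition tensor_op ::
  "('n \<Rightarrow> complex ^ 'd ^ 'd) \<Rightarrow> complex ^ ('n \<Rightarrow> 'd) ^ ('n::finite \<Rightarrow> 'd::finite)" where
  "tensor_op X = (\<chi> f g. \<Prod>l\<in>UNIV. X l $ f l $ g l)"

definition tensor_power ::
  "complex ^ 'd ^ 'd \<Rightarrow> complex ^ ('n \<Rightarrow> 'd) ^ ('n::finite \<Rightarrow> 'd::finite)" where
  "tensor_power X = tensor_op (\<lambda>_. X)"

definition site_op ::
  "complex ^ 'd ^ 'd \<Rightarrow> 'n \<Rightarrow> complex ^ ('n \<Rightarrow> 'd) ^ ('n::finite \<Rightarrow> 'd::finite)" where
  "site_op X l = tensor_op ((\<lambda>_. mat 1)(l := X))"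

(* Meant for distinct l and l'. *)
definition pair_op ::
  "complex ^ ('d \<times> 'd) ^ ('d \<times> 'd) \<Rightarrow> 'n \<Rightarrow> 'n
     \<Rightarrow> complex ^ ('n \<Rightarrow> 'd) ^ ('n::finite \<Rightarrow> 'd::finite)" where
  "pair_op B l l' =
     (\<chi> f g. if \<forall>k. k \<noteq> l \<and> k \<noteq> l' \<longrightarrow> f k = g k then B $ (f l, f l') $ (g l, g l') else 0)"

section \<open>Lindblad equations\<close>

definition dissipator :: "complex ^ 'n ^ 'n \<Rightarrow> complex ^ 'n ^ 'n \<Rightarrow> complex ^ 'n ^ 'n" where
  "dissipator L \<rho> = L ** \<rho> ** adj L - (1/2) *\<^sub>R anticommutator (adj L ** L) \<rho>"

definition nbody_hamiltonian ::
  "complex ^ 'd ^ 'd \<Rightarrow> complex ^ ('d \<times> 'd) ^ ('d \<times> 'd)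
     \<Rightarrow> complex ^ ('n::{finite,linorder} \<Rightarrow> 'd::finite) ^ ('n \<Rightarrow> 'd)" where
  "nbody_hamiltonian H A =
     (\<Sum>l\<in>UNIV. site_op H l)
     + (1 / real CARD('n)) *\<^sub>R (\<Sum>(l, l') \<in> {(l, l'). l < l'}. pair_op A l l')"

definition nbody_rhs ::
  "complex ^ 'd ^ 'd \<Rightarrow> complex ^ ('d \<times> 'd) ^ ('d \<times> 'd) \<Rightarrow> complex ^ 'd ^ 'd
     \<Rightarrow> complex ^ ('n::{finite,linorder} \<Rightarrow> 'd::finite) ^ ('n \<Rightarrow> 'd)
     \<Rightarrow> complex ^ ('n \<Rightarrow> 'd) ^ ('n \<Rightarrow> 'd)" where
  "nbody_rhs H A L \<rho> =
     mat (- \<i>) ** commutator (nbody_hamiltonian H A) \<rho>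
     + (\<Sum>l\<in>UNIV. dissipator (site_op L l) \<rho>)"

definition mean_field_potential ::
  "complex ^ ('d \<times> 'd) ^ ('d::finite \<times> 'd) \<Rightarrow> complex ^ 'd ^ 'd \<Rightarrow> complex ^ 'd ^ 'd" where
  "mean_field_potential A \<sigma> = ptrace2 (kron (mat 1) \<sigma> ** A)"

definition mean_field_rhs ::
  "complex ^ 'd ^ 'd \<Rightarrow> complex ^ ('d \<times> 'd) ^ ('d::finite \<times> 'd) \<Rightarrow> complex ^ 'd ^ 'd
     \<Rightarrow> complex ^ 'd ^ 'd \<Rightarrow> complex ^ 'd ^ 'd" where
  "mean_field_rhs H A L \<sigma> =
     mat (- \<i>) ** commutator (H + mean_field_potential A \<sigma>) \<sigma> + dissipator L \<sigma>"

definition solves_in_states ::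
  "real \<Rightarrow> (complex ^ 'n ^ 'n \<Rightarrow> complex ^ 'n ^ 'n) \<Rightarrow> complex ^ 'n ^ 'n
     \<Rightarrow> (real \<Rightarrow> complex ^ 'n ^ 'n) \<Rightarrow> bool" where
  "solves_in_states T F \<rho>0 \<rho> \<longleftrightarrow>
     \<rho> 0 = \<rho>0 \<and>
     (\<forall>t\<in>{0..T}. \<rho> t \<in> density_ops \<and> (\<rho> has_vector_derivative F (\<rho> t)) (at t within {0..T}))"

definition entropy_per_particle ::
  "complex ^ ('n::finite \<Rightarrow> 'd::finite) ^ ('n \<Rightarrow> 'd) \<Rightarrow> complex ^ 'd ^ 'd \<Rightarrow> ereal" where
  "entropy_per_particle \<rho> \<sigma> = ereal (1 / real CARD('n)) * rel_entropy \<rho> (tensor_power \<sigma>)"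

section \<open>Characteristic properties of the coordinate definitions\<close>

lemma kron_mult_kron_vec: "kron X Y *v kron_vec u v = kron_vec (X *v u) (Y *v v)"
  by (simp add: kron_def kron_vec_def matrix_vector_mult_def vec_eq_iff sum_product
      sum.cartesian_product UNIV_Times_UNIV [symmetric] case_prod_unfold mult_ac
      del: UNIV_Times_UNIV)

lemma flip_op_kron_vec: "flip_op *v kron_vec u v = kron_vec v u"
proof -
  have "(p = prod.swap q) = (q = prod.swap p)" for p q :: "'a \<times> 'a"
    by (cases p; cases q) auto
  thus ?thesis
    by (simp add: flip_op_def kron_vec_def matrix_vector_mult_def vec_eq_iff
        if_distrib [of "\<lambda>x. x * _"] mult.commute cong: if_cong)
qed

lemma ptrace2_kron: "ptrace2 (kron X Y) $ a $ b = trace Y * X $ a $ b"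
  by (simp add: ptrace2_def kron_def trace_def sum_distrib_left mult.commute)

lemma tensor_op_mult_tensor_vec:
  "tensor_op X *v tensor_vec v = tensor_vec (\<lambda>l. X l *v v l)"
  by (simp add: tensor_op_def tensor_vec_def matrix_vector_mult_def vec_eq_iff
      prod.distrib [symmetric] prod_sum_PiE)

lemma pair_op_kron:
  fixes l l' :: "'n::finite"
  assumes "l \<noteq> l'"
  shows "pair_op (kron X Y) l l' = tensor_op ((\<lambda>_. mat 1)(l := X, l' := Y))"
proof -
  have "(if \<forall>k. k \<noteq> l \<and> k \<noteq> l' \<longrightarrow> f k = g k then X $ f l $ g l * Y $ f l' $ g l' else 0) =
        (\<Prod>k\<in>UNIV. ((\<lambda>_. mat 1)(l := X, l' := Y)) k $ f k $ g k)" for f g :: "'n \<Rightarrow> 'a"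
  proof -
    let ?h = "\<lambda>k. ((\<lambda>_. mat 1)(l := X, l' := Y)) k $ f k $ g k"
    have "(\<Prod>k\<in>UNIV. ?h k) = ?h l * (?h l' * (\<Prod>k\<in>UNIV - {l} - {l'}. ?h k))"
      using assms by (subst prod.remove [of _ l]; simp add: prod.remove [of _ l'])
    also have "(\<Prod>k\<in>UNIV - {l} - {l'}. ?h k) =
        (\<Prod>k\<in>UNIV - {l} - {l'}. if f k = g k then 1 else 0)"
      by (intro prod.cong) (auto simp: mat_def)
    also have "\<dots> = (if \<forall>k. k \<noteq> l \<and> k \<noteq> l' \<longrightarrow> f k = g k then 1 else 0)"
      by auto
    finally have eq: "(\<Prod>k\<in>UNIV. ?h k) = ?h l * (?h l' *
        (if \<forall>k. k \<noteq> l \<and> k \<noteq> l' \<longrightarrow> f k = g k then 1 else 0))" .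
    show ?thesis unfolding eq using assms by auto
  qed
  thus ?thesis by (simp only: pair_op_def kron_def tensor_op_def vec_lambda_beta fst_conv snd_conv)
qed

lemma orth_proj_works:
  fixes S :: "(complex ^ 'n) set"
  assumes S: "vec.subspace S"
  shows "orth_proj S *v v \<in> S" and "w \<in> S \<Longrightarrow> (v - orth_proj S *v v) \<bullet> w = 0"
proof -
  let ?P = "closest_point S"
  have sR: "r *\<^sub>R v = complex_of_real r *s v" for r and v :: "complex ^ 'n"
    unfolding vec_eq_iff vector_scaleR_component vector_smult_component
    by (simp add: scaleR_conv_of_real)
  have sub: "subspace S"
    by (rule subspaceI)
       (simp_all only: sR vec.subspace_0 [OF S] vec.subspace_add [OF S] vec.subspace_scale [OF S])
  hence cl: "closed S" and co: "convex S" and ne: "S \<noteq> {}"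
    using closed_subspace subspace_imp_convex subspace_0 by blast+
  have mem: "?P v \<in> S" for v
    using closest_point_in_set [OF cl ne] .
  have orth: "(v - ?P v) \<bullet> w = 0" if "w \<in> S" for v w
  proof -
    have "(v - ?P v) \<bullet> (u - ?P v) \<le> 0" if "u \<in> S" for u
      using closest_point_dot [OF co cl that] .
    from this [of "?P v + w"] this [of "?P v - w"] show ?thesis
      using mem that sub by (simp add: subspace_add subspace_diff)
  qed
  have uniq: "?P v = p" if "p \<in> S" "\<And>w. w \<in> S \<Longrightarrow> (v - p) \<bullet> w = 0" for v p
  proof -
    have "?P v - p \<in> S" using mem that sub by (simp add: subspace_diff)
    hence "(v - p) \<bullet> (?P v - p) - (v - ?P v) \<bullet> (?P v - p) = 0"
      using that orth by simp
    hence "(?P v - p) \<bullet> (?P v - p) = 0" by (simp add: inner_diff_left inner_diff_right)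
    thus ?thesis by simp
  qed
  have sm: "(c *s u) \<bullet> w = u \<bullet> (cnj c *s w)" for c and u w :: "complex ^ 'n"
    unfolding inner_vec_def by (intro sum.cong) (simp_all add: inner_complex_def algebra_simps)
  have "?P (u + v) = ?P u + ?P v" for u v
  proof (rule uniq)
    show "(u + v - (?P u + ?P v)) \<bullet> w = 0" if "w \<in> S" for w
      using orth [OF that, of u] orth [OF that, of v] by (simp add: inner_diff_left inner_add_left)
  qed (use mem sub in \<open>simp add: subspace_add\<close>)
  moreover have "?P (c *s v) = c *s ?P v" for c v
  proof (rule uniq)
    show "(c *s v - c *s ?P v) \<bullet> w = 0" if "w \<in> S" for w
      using orth [of "cnj c *s w" v] S that
      by (simp only: vec.scale_right_diff_distrib [symmetric] sm vec.subspace_scale [OF S])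
  qed (use mem S in \<open>simp add: vec.subspace_scale\<close>)
  ultimately have "Vector_Spaces.linear (*s) (*s) ?P"
    by unfold_locales simp_all
  hence "orth_proj S *v v = ?P v" for v
    by (simp add: orth_proj_def matrix_works)
  thus "orth_proj S *v v \<in> S" and "w \<in> S \<Longrightarrow> (v - orth_proj S *v v) \<bullet> w = 0"
    using mem orth by simp_all
qed

end

(* For states rho and sigma the relative entropy is the integral over s of
   F(s) - 1/(1+s), where F(s) is the supremum over matrices W of
   J(s, W) = 2 Re tr(rho W) - s Re tr(rho W W^* ) - Re tr(sigma W^* W).
   The optimal W solves rho = s rho W + W sigma.  Since J is linear in (rho, sigma), a backward
   time difference of F is bounded by the functional that is optimal at the later time, and
   completing squares shows that a common Lindblad generator acting on both states contributes a
   nonpositive amount.  Truncating the integral at S changes the entropy by at most 1/S and makes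
   every estimate uniform for singular rho.

   The product state sigma = m^(tensor N) satisfies the N-body equation up to the commutator
   i[V, sigma] with V = (1/N) sum A_ll' - sum A^m_l, which contributes Re tr(rho i[log sigma, V]).
   Up to a one-body remainder of norm 2 K |A|, the observable i[log sigma, V] is
   X = (1/N) sum_{l<l'} G_ll', where |G| <= 8 K |A| because |log m_t| <= K (the least eigenvalue of
   m_t decays at most like exp(- |L|^2 t)), and where both partial expectations of G in the state m
   vanish.  The Gibbs variational inequality bounds q tr(rho X) by the entropy plus
   log tr(sigma exp(q X)).  In the expansion of the exponential only those products of k edges
   survive in which no site occurs exactly once; they involve at most k sites, so the k-th term is
   at most x^k and tr(sigma exp(q X)) <= 1/(1-x) <= C.  Gronwall's inequality concludes. *)

theory Submission
  imports Defs "HOL-Real_Asymp.Real_Asymp"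
begin

section \<open>Finite-dimensional spectral theory and functional calculus\<close>

section \<open>Matrix algebra\<close>

text \<open>The obstacle is that the entropy cannot simply be differentiated in time: one state may
  be singular, so that its logarithm need not vary smoothly, and eigenvectors may jump where
  eigenvalues cross. One-sided comparisons with a frozen test operator avoid every derivative of a
  logarithm or of an eigenvector. The integral formula has a scalar origin:
  \<open>p\<^sup>2 / (r * p + e) - p / (1 + r)\<close> integrates over r > 0 to p (ln p - ln e). The
  growth rate 1/q arises from dividing the Gibbs inequality by q. A larger q thus means slower
  growth, but q is limited by the geometric bound on the moment series. In its ratio, 8 K |A| bounds
  the two-body observable: 4 K |A| for the commutator with the logarithms and 4 K |A| for the
  centring. The factor e^2 comes from counting: edge lists of length k on k given sites number
  k^(2k), and k^k <= k! e^k is applied twice. One k! is absorbed by the choice of the sites, the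
  other by the exponential series.\<close>

type_synonym 'n cmat = "complex ^ 'n ^ 'n"

lemma adj_nth [simp]: "adj X $ i $ j = cnj (X $ j $ i)"
  by (simp add: adj_def)

lemma adj_adj [simp]: "adj (adj X) = X"
  by (simp add: adj_def vec_eq_iff)

lemma adj_add: "adj (X + Y) = adj X + adj Y"
  by (simp add: adj_def vec_eq_iff)

lemma adj_diff: "adj (X - Y) = adj X - adj Y"
  by (simp add: adj_def vec_eq_iff)

lemma adj_scaleR: "adj (r *\<^sub>R X) = r *\<^sub>R adj X"
  by (simp add: adj_def vec_eq_iff)

lemma adj_zero [simp]: "adj 0 = 0"
  by (simp add: adj_def vec_eq_iff)

lemma adj_sum: "adj (sum f S) = (\<Sum>i\<in>S. adj (f i))"
  by (simp add: vec_eq_iff sum_component)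

lemma adj_mult: "adj (X ** Y) = adj Y ** adj X"
  by (simp add: vec_eq_iff matrix_matrix_mult_def mult.commute)

lemma adj_mat [simp]: "adj (mat c) = mat (cnj c)"
  by (simp add: vec_eq_iff mat_def)

lemma mat_mult_nth [simp]: "(mat c ** (X :: complex ^ 'm ^ 'n)) $ i $ j = c * X $ i $ j"
  by (simp add: mat_def matrix_matrix_mult_def if_distrib [of "\<lambda>x. x * _"] cong: if_cong)

lemma mult_mat_nth [simp]: "((X :: complex ^ 'n ^ 'm) ** mat c) $ i $ j = X $ i $ j * c"
  by (simp add: mat_def matrix_matrix_mult_def if_distrib [of "\<lambda>x. _ * x"] cong: if_cong)

lemma mat_commute: "(X :: complex ^ 'n ^ 'm) ** mat c = mat c ** X"
  by (simp add: vec_eq_iff mult.commute)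

lemma matrix_diff_ldistrib: "(A :: complex ^ 'n ^ 'm) ** (B - C) = A ** B - A ** C"
  by (simp add: vec_eq_iff matrix_matrix_mult_def right_diff_distrib sum_subtractf)

lemma matrix_diff_rdistrib: "((A :: complex ^ 'n ^ 'm) - B) ** C = A ** C - B ** C"
  by (simp add: vec_eq_iff matrix_matrix_mult_def left_diff_distrib sum_subtractf)

lemma matrix_add_rdistrib: "((A :: complex ^ 'n ^ 'm) + B) ** C = A ** C + B ** C"
  by (simp add: vec_eq_iff matrix_matrix_mult_def distrib_right sum.distrib)

lemma matrix_scaleR_left: "(r *\<^sub>R (A :: complex ^ 'n ^ 'm)) ** B = r *\<^sub>R (A ** B)"
  by (simp add: vec_eq_iff matrix_matrix_mult_def scaleR_sum_right)

lemma matrix_scaleR_right: "(A :: complex ^ 'n ^ 'm) ** (r *\<^sub>R B) = r *\<^sub>R (A ** B)"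
  by (simp add: vec_eq_iff matrix_matrix_mult_def scaleR_sum_right)

lemma matrix_sum_left: "(\<Sum>i\<in>S. f i :: complex ^ 'n ^ 'm) ** B = (\<Sum>i\<in>S. f i ** B)"
  by (induction S rule: infinite_finite_induct) (simp_all add: matrix_add_rdistrib)

lemma matrix_sum_right: "(A :: complex ^ 'n ^ 'm) ** (\<Sum>i\<in>S. f i) = (\<Sum>i\<in>S. A ** f i)"
  by (induction S rule: infinite_finite_induct) (simp_all add: matrix_add_ldistrib)

lemmas matrix_distribs = matrix_add_ldistrib matrix_add_rdistrib matrix_diff_ldistrib
  matrix_diff_rdistrib matrix_scaleR_left matrix_scaleR_right

text \<open>Taking the real part makes the trace invariant under \<open>adj\<close>, so that a cross
  term and its adjoint can be merged whenever a square is completed below.\<close>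

definition rtr :: "'n::finite cmat \<Rightarrow> real" where
  "rtr X = Re (trace X)"

lemma rtr_add: "rtr (X + Y) = rtr X + rtr Y"
  by (simp add: rtr_def trace_add)

lemma rtr_diff: "rtr (X - Y) = rtr X - rtr Y"
  by (simp add: rtr_def trace_sub)

lemma rtr_scaleR: "rtr (r *\<^sub>R X) = r * rtr X"
  by (simp add: rtr_def trace_def sum_distrib_left)

lemma rtr_zero [simp]: "rtr 0 = 0"
  by (simp add: rtr_def trace_def)

lemma rtr_sum: "rtr (sum f S) = (\<Sum>i\<in>S. rtr (f i))"
  by (induction S rule: infinite_finite_induct) (simp_all add: rtr_add)

lemma rtr_adj [simp]: "rtr (adj X) = rtr X"
  by (simp add: rtr_def trace_def)

lemma rtr_commute: "rtr (X ** Y) = rtr (Y ** X)"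
  unfolding rtr_def by (subst trace_mul_sym) (rule refl)

lemma rtr_eq_sum: "rtr (X ** Y) = (\<Sum>i\<in>UNIV. \<Sum>j\<in>UNIV. Re (X $ i $ j * Y $ j $ i))"
  by (simp add: rtr_def trace_def matrix_matrix_mult_def)

lemma inner_vec_complex: "(v :: complex ^ 'n) \<bullet> w = Re (\<Sum>i\<in>UNIV. cnj (v $ i) * w $ i)"
  by (simp add: inner_vec_def inner_complex_def)

lemma inner_adj: "(v :: complex ^ 'n) \<bullet> (X *v w) = (adj X *v v) \<bullet> w"
proof -
  have "(\<Sum>i\<in>UNIV. cnj (v $ i) * (\<Sum>j\<in>UNIV. X $ i $ j * w $ j))
      = (\<Sum>j\<in>UNIV. cnj (\<Sum>i\<in>UNIV. cnj (X $ i $ j) * v $ i) * w $ j)"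
    by (simp add: sum_distrib_left sum_distrib_right mult_ac, subst sum.swap, simp)
  thus ?thesis by (simp add: inner_vec_complex matrix_vector_mult_def)
qed

lemma matrix_vector_scaleR_left: "(r *\<^sub>R (X :: complex ^ 'n ^ 'm)) *v v = r *\<^sub>R (X *v v)"
  by (simp add: vec_eq_iff matrix_vector_mult_def scaleR_sum_right)

lemma matrix_vector_scaleR_right: "(X :: complex ^ 'n ^ 'm) *v (r *\<^sub>R v) = r *\<^sub>R (X *v v)"
  by (simp add: vec_eq_iff matrix_vector_mult_def scaleR_sum_right)

lemma matrix_vector_smult_right: "(X :: complex ^ 'n ^ 'm) *v (c *s v) = c *s (X *v v)"
  by (simp add: vec_eq_iff matrix_vector_mult_def sum_distrib_left mult_ac)

lemma self_adjointD: "self_adjoint X \<Longrightarrow> adj X = X"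
  by (simp add: self_adjoint_def)

definition diagm :: "('n::finite \<Rightarrow> real) \<Rightarrow> 'n cmat" where
  "diagm p = (\<chi> i j. if i = j then complex_of_real (p i) else 0)"

definition unitary :: "'n::finite cmat \<Rightarrow> bool" where
  "unitary P \<longleftrightarrow> adj P ** P = mat 1 \<and> P ** adj P = mat 1"

lemma unitary_adj: "unitary P \<Longrightarrow> unitary (adj P)"
  by (simp add: unitary_def)

lemma unitary_mult: "unitary P \<Longrightarrow> unitary Q \<Longrightarrow> unitary (P ** Q)"
proof -
  assume P: "unitary P" and Q: "unitary Q"
  have "adj (P ** Q) ** (P ** Q) = adj Q ** (adj P ** P) ** Q"
    by (simp only: adj_mult matrix_mul_assoc)
  moreover have "(P ** Q) ** adj (P ** Q) = P ** (Q ** adj Q) ** adj P"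
    by (simp only: adj_mult matrix_mul_assoc)
  ultimately show "unitary (P ** Q)" using P Q by (simp add: unitary_def)
qed

lemma diagm_mult_nth: "(diagm p ** X) $ i $ j = complex_of_real (p i) * X $ i $ j"
  by (simp add: diagm_def matrix_matrix_mult_def if_distrib [of "\<lambda>x. x * _"] cong: if_cong)

lemma mult_diagm_nth: "(X ** diagm p) $ i $ j = complex_of_real (p j) * X $ i $ j"
  by (simp add: diagm_def matrix_matrix_mult_def if_distrib [of "\<lambda>x. _ * x"] mult.commute cong: if_cong)

lemma diagm_vec_nth: "(diagm p *v v) $ i = complex_of_real (p i) * v $ i"
  by (simp add: diagm_def matrix_vector_mult_def if_distrib [of "\<lambda>x. x * _"] cong: if_cong)

lemma adj_diagm [simp]: "adj (diagm p) = diagm p"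
  by (auto simp: diagm_def vec_eq_iff)

lemma diagm_mult_diagm: "diagm p ** diagm q = diagm (\<lambda>i. p i * q i)"
  by (simp add: vec_eq_iff diagm_mult_nth, simp add: diagm_def)

lemma vector_scaleR_smult: "r *\<^sub>R v = complex_of_real r *s (v :: complex ^ 'n)"
  unfolding vec_eq_iff vector_scaleR_component vector_smult_component
  by (simp add: scaleR_conv_of_real)

section \<open>The spectral theorem\<close>

text \<open>A maximiser \<open>v\<close> of the quadratic form on the unit sphere of
  \<open>S\<close> works: the residual \<open>y = X *v v - r *\<^sub>R v\<close> lies in
  \<open>S\<close>, and moving \<open>v\<close> along \<open>y\<close> would increase the Rayleigh
  quotient at first order unless \<open>y\<close> vanishes. \<open>S\<close> is only a real
  subspace.\<close>

lemma self_adjoint_eigenvector_in_subspace: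
  fixes X :: "'n::finite cmat"
  assumes X: "self_adjoint X" and S: "subspace S" "S \<noteq> {0}" "\<And>v. v \<in> S \<Longrightarrow> X *v v \<in> S"
  obtains v r where "v \<in> S" "norm v = 1" "X *v v = r *\<^sub>R v"
proof -
  obtain z where z: "z \<in> S" "z \<noteq> 0" using S subspace_0 by blast
  let ?K = "S \<inter> sphere 0 1"
  have "compact ?K" by (simp add: S closed_subspace closed_Int_compact)
  moreover have "(1 / norm z) *\<^sub>R z \<in> ?K" using z S by (simp add: subspace_scale)
  moreover have "continuous_on ?K (\<lambda>v. v \<bullet> (X *v v))"
    by (intro continuous_intros linear_continuous_on) (simp add: linear_linear)
  ultimately obtain v where v: "v \<in> ?K" "\<And>w. w \<in> ?K \<Longrightarrow> w \<bullet> (X *v w) \<le> v \<bullet> (X *v v)"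
    using continuous_attains_sup [of ?K "\<lambda>v. v \<bullet> (X *v v)"] by blast
  define r where "r = v \<bullet> (X *v v)"
  have vv: "v \<bullet> v = 1" using v by (simp add: norm_eq_1)
  have le: "w \<bullet> (X *v w) \<le> r * (w \<bullet> w)" if "w \<in> S" for w
  proof (cases "w = 0")
    case False
    let ?u = "(1 / norm w) *\<^sub>R w"
    have "?u \<in> ?K" using that False S by (simp add: subspace_scale)
    from v(2) [OF this] have "(w \<bullet> (X *v w)) / (norm w)\<^sup>2 \<le> r"
      by (simp add: matrix_vector_scaleR_right r_def power2_eq_square)
    thus ?thesis using False by (simp add: divide_le_eq dot_square_norm)
  qed simp
  define y where "y = X *v v - r *\<^sub>R v"
  have yS: "y \<in> S" using v S by (simp add: y_def subspace_diff subspace_scale)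
  define c where "c = r * (y \<bullet> y) - y \<bullet> (X *v y)"
  \<comment> \<open>This is \<open>le\<close> at \<open>v + e *\<^sub>R y\<close>: the terms of
    order zero and all multiples of \<open>v \<bullet> y\<close> cancel.\<close>
  have quad: "2 * e * (y \<bullet> y) \<le> e\<^sup>2 * c" for e
  proof -
    have "v + e *\<^sub>R y \<in> S" using v yS S(1) by (simp add: subspace_add subspace_scale)
    note le [OF this]
    moreover have "v \<bullet> (X *v y) = y \<bullet> (X *v v)"
      unfolding inner_adj [of v] self_adjointD [OF X] by (rule inner_commute)
    moreover have "y \<bullet> (X *v v) = y \<bullet> y + r * (v \<bullet> y)"
      by (simp add: y_def inner_diff_right inner_diff_left inner_commute algebra_simps)
    moreover have "(v + e *\<^sub>R y) \<bullet> (X *v (v + e *\<^sub>R y))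
        = r + e * (v \<bullet> (X *v y)) + e * (y \<bullet> (X *v v)) + e * (e * (y \<bullet> (X *v y)))"
      by (simp add: matrix_vector_right_distrib matrix_vector_scaleR_right inner_add_left
          inner_add_right r_def algebra_simps)
    moreover have "(v + e *\<^sub>R y) \<bullet> (v + e *\<^sub>R y) = 1 + 2 * e * (v \<bullet> y) + e * (e * (y \<bullet> y))"
      using vv by (simp add: inner_add_left inner_add_right inner_commute [of y v] algebra_simps)
    ultimately have "r + e * (y \<bullet> y + r * (v \<bullet> y)) + e * (y \<bullet> y + r * (v \<bullet> y)) + e * (e * (y \<bullet> (X *v y)))
        \<le> r * (1 + 2 * e * (v \<bullet> y) + e * (e * (y \<bullet> y)))"
      by simp
    thus ?thesis
      by (simp only: c_def power2_eq_square) (simp add: algebra_simps)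
  qed
  have "y \<bullet> y \<le> 0"
  proof (rule ccontr)
    assume "\<not> y \<bullet> y \<le> 0"
    hence pos: "y \<bullet> y > 0" by linarith
    \<comment> \<open>So small that the second-order term is at most
      \<open>e * (y \<bullet> y)\<close>, half of the first-order term in
      \<open>quad\<close>.\<close>
    define e where "e = (y \<bullet> y) / (\<bar>c\<bar> + 1)"
    have e: "e > 0" using pos by (simp add: e_def)
    have "e * c \<le> e * (\<bar>c\<bar> + 1)" using e by (intro mult_left_mono) auto
    also have "\<dots> = y \<bullet> y" by (simp add: e_def)
    finally have "e\<^sup>2 * c \<le> e * (y \<bullet> y)"
      using e by (simp add: power2_eq_square mult.assoc)
    with quad [of e] have "e * (y \<bullet> y) \<le> 0" by simp
    thus False using e pos by (simp add: mult_le_0_iff)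
  qed
  hence "y = 0" by (metis inner_gt_zero_iff not_less)
  thus thesis using that [of v r] v by (simp add: y_def)
qed

text \<open>The available inner product is the real part of the Hermitian one, so complex
  orthogonality is recorded as two real conditions. In the induction step the real orthogonal
  complement of B and its multiple by \<open>\<i>\<close> is invariant because eigenvalues are real,
  and it is nonzero as long as 2 k is below the real dimension \<open>2 * CARD('n)\<close>.\<close>

lemma orthonormal_eigenvectors:
  fixes X :: "'n::finite cmat"
  assumes X: "self_adjoint X" and "k \<le> CARD('n)"
  shows "\<exists>B. finite B \<and> card B = k \<and> (\<forall>b\<in>B. norm b = 1 \<and> (\<exists>r. X *v b = r *\<^sub>R b)) \<and>
    (\<forall>b\<in>B. \<forall>c\<in>B. b \<noteq> c \<longrightarrow> b \<bullet> c = 0 \<and> b \<bullet> (\<i> *s c) = 0)"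
  using assms(2)
proof (induction k)
  case 0
  thus ?case by (intro exI [of _ "{}"]) simp
next
  case (Suc k)
  then obtain B where B: "finite B" "card B = k"
    "\<And>b. b \<in> B \<Longrightarrow> norm b = 1 \<and> (\<exists>r. X *v b = r *\<^sub>R b)"
    "\<And>b c. b \<in> B \<Longrightarrow> c \<in> B \<Longrightarrow> b \<noteq> c \<Longrightarrow> b \<bullet> c = 0 \<and> b \<bullet> (\<i> *s c) = 0" by auto
  let ?B = "B \<union> (\<lambda>b. \<i> *s b) ` B"
  define S where "S = {v. \<forall>b\<in>?B. v \<bullet> b = 0}"
  have "card ?B \<le> k + k" using B(1,2) card_Un_le [of B "(\<lambda>b. \<i> *s b) ` B"] card_image_le [OF B(1), of "\<lambda>b. \<i> *s b"] by linarith
  hence "dim ?B < DIM(complex ^ 'n)"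
    using dim_le_card' [of ?B] B(1) Suc.prems by simp
  then obtain z where z: "z \<noteq> 0" "\<And>y. y \<in> span ?B \<Longrightarrow> orthogonal z y"
    using orthogonal_to_subspace_exists by blast
  have "z \<in> S" using z(2) by (auto simp: S_def orthogonal_def span_base)
  moreover have sub: "subspace S" by (auto simp: S_def subspace_def inner_add_left)
  moreover have inv: "X *v v \<in> S" if v: "v \<in> S" for v
    unfolding S_def
  proof (intro CollectI ballI)
    fix b assume b: "b \<in> ?B"
    have "(X *v v) \<bullet> b = v \<bullet> (X *v b)" using X by (simp add: inner_adj self_adjoint_def)
    moreover have "\<exists>r. X *v b = r *\<^sub>R b"
    proof -
      obtain c where c: "c \<in> B" "b = c \<or> b = \<i> *s c" using b by blast
      obtain r where "X *v c = r *\<^sub>R c" using B(3) [OF c(1)] by blast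
      thus ?thesis using c(2)
        by (intro exI [of _ r]) (auto simp: matrix_vector_smult_right vector_scaleR_smult mult.commute)
    qed
    ultimately show "(X *v v) \<bullet> b = 0" using b v by (auto simp: S_def)
  qed
  ultimately obtain v r where v: "v \<in> S" "norm v = 1" "X *v v = r *\<^sub>R v"
    using self_adjoint_eigenvector_in_subspace [OF X, of S] z(1) by blast
  have i: "(\<i> *s v) \<bullet> b = - (v \<bullet> (\<i> *s b))" for b
    unfolding inner_vec_def sum_negf [symmetric]
    by (intro sum.cong) (simp_all add: inner_complex_def)
  have ortho: "v \<bullet> b = 0" "v \<bullet> (\<i> *s b) = 0" "b \<bullet> v = 0" "b \<bullet> (\<i> *s v) = 0" if "b \<in> B" for b
    using v(1) that i [of b] by (auto simp: S_def inner_commute)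
  have "v \<notin> B" using ortho(1) [of v] v(2) by auto
  show ?case
  proof (intro exI [of _ "insert v B"] conjI ballI impI)
    show "card (insert v B) = Suc k" using B \<open>v \<notin> B\<close> by simp
    show "norm b = 1" if "b \<in> insert v B" for b using that B(3) v(2) by blast
    show "\<exists>r. X *v b = r *\<^sub>R b" if "b \<in> insert v B" for b using that B(3) v(3) by blast
    show "b \<bullet> c = 0" if "b \<in> insert v B" "c \<in> insert v B" "b \<noteq> c" for b c
      using that B(4) [of b c] ortho [of b] ortho [of c] by (elim insertE) simp_all
    show "b \<bullet> (\<i> *s c) = 0" if "b \<in> insert v B" "c \<in> insert v B" "b \<noteq> c" for b c
      using that B(4) [of b c] ortho [of b] ortho [of c] by (elim insertE) simp_all
  qed (use B in simp)
qed

theorem spectral: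
  fixes X :: "'n::finite cmat"
  assumes "self_adjoint X"
  obtains P p where "unitary P" "X = P ** diagm p ** adj P"
proof -
  obtain B where B: "finite B" "card B = CARD('n)"
    "\<And>b. b \<in> B \<Longrightarrow> norm b = 1 \<and> (\<exists>r. X *v b = r *\<^sub>R b)"
    "\<And>b c. b \<in> B \<Longrightarrow> c \<in> B \<Longrightarrow> b \<noteq> c \<Longrightarrow> b \<bullet> c = 0 \<and> b \<bullet> (\<i> *s c) = 0"
    using orthonormal_eigenvectors [OF assms, of "CARD('n)"] by auto
  then obtain h where h: "bij_betw h (UNIV :: 'n set) B"
    using finite_same_card_bij [of "UNIV :: 'n set" B] by auto
  have hB: "h i \<in> B" for i using h by (auto simp: bij_betw_def)
  have "\<forall>i. \<exists>r. X *v h i = r *\<^sub>R h i" using B(3) hB by blast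
  then obtain p where p: "\<And>i. X *v h i = p i *\<^sub>R h i" by (auto dest!: choice)
  define P :: "'n cmat" where "P = (\<chi> i j. h j $ i)"
  have sq: "(\<Sum>l\<in>UNIV. cnj (h j $ l) * h j $ l) = 1" for j
  proof -
    have "h j \<bullet> h j = 1" using B(3) [OF hB [of j]] by (simp add: norm_eq_1)
    hence "Re (\<Sum>l\<in>UNIV. cnj (h j $ l) * h j $ l) = 1"
      unfolding inner_vec_complex .
    moreover have "Im (\<Sum>l\<in>UNIV. cnj (h j $ l) * h j $ l) = 0" by (simp add: mult.commute)
    ultimately show ?thesis by (simp add: complex_eq_iff)
  qed
  have "(\<Sum>l\<in>UNIV. cnj (h i $ l) * h j $ l) = 0" if "i \<noteq> j" for i j
  proof -
    have "h i \<noteq> h j" using that h by (auto simp: bij_betw_def inj_on_def)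
    hence "h i \<bullet> h j = 0" "h i \<bullet> (\<i> *s h j) = 0" using B(4) hB by blast+
    moreover have "(\<Sum>l\<in>UNIV. cnj (h i $ l) * (\<i> * h j $ l)) = \<i> * (\<Sum>l\<in>UNIV. cnj (h i $ l) * h j $ l)"
      by (simp add: sum_distrib_left mult_ac)
    ultimately show ?thesis
      by (simp add: inner_vec_complex complex_eq_iff)
  qed
  hence PP: "adj P ** P = mat 1"
    using sq by (auto simp: vec_eq_iff P_def matrix_matrix_mult_def mat_def)
  hence PP': "P ** adj P = mat 1" by (simp add: matrix_left_right_inverse)
  have "X ** P = P ** diagm p"
  proof -
    have "(X ** P) $ i $ j = (X *v h j) $ i" for i j
      by (simp add: matrix_matrix_mult_def matrix_vector_mult_def P_def)
    thus ?thesis unfolding vec_eq_iff p mult_diagm_nth vector_scaleR_component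
      by (simp add: P_def scaleR_conv_of_real)
  qed
  hence "X ** P ** adj P = P ** diagm p ** adj P" by simp
  hence "X = P ** diagm p ** adj P"
    unfolding matrix_mul_assoc [symmetric, of X P "adj P"] PP' by simp
  moreover have "unitary P" using PP PP' unfolding unitary_def by blast
  ultimately show thesis using that by blast
qed

lemma cmod_square: "(cmod z)\<^sup>2 = Re z * Re z + Im z * Im z"
  unfolding cmod_power2 by (simp add: power2_eq_square)

text \<open>Diagonalisations are passed around explicitly. Eigenvalues are indexed by
  \<open>'n\<close>, hence repeated with multiplicity and in no particular order, and neither
  \<open>P\<close> nor \<open>p\<close> is unique.\<close>

definition spec :: "'n::finite cmat \<Rightarrow> 'n cmat \<Rightarrow> ('n \<Rightarrow> real) \<Rightarrow> bool" where
  "spec X P p \<longleftrightarrow> unitary P \<and> X = P ** diagm p ** adj P"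

lemma unitary_cancel:
  assumes "unitary P"
  shows "P ** (adj P ** X) = X" "adj P ** (P ** X) = X"
  using assms by (simp_all add: matrix_mul_assoc unitary_def)

lemma spec_exists:
  assumes "self_adjoint X"
  obtains P p where "spec X P p"
  using spectral [OF assms] unfolding spec_def by metis

lemma spec_self_adjoint: "spec X P p \<Longrightarrow> self_adjoint X"
  by (simp add: spec_def self_adjoint_def adj_mult matrix_mul_assoc)

lemma spec_mult_vec: "spec X P p \<Longrightarrow> X *v v = P *v (diagm p *v (adj P *v v))"
  by (simp add: spec_def matrix_vector_mul_assoc matrix_mul_assoc)

lemma spec_conj: "spec X P p \<Longrightarrow> adj P ** X ** P = diagm p"
  by (simp add: spec_def matrix_mul_assoc [symmetric] unitary_cancel)
     (simp add: unitary_def)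

lemma spec_quadratic_form:
  assumes "spec X P p"
  shows "v \<bullet> (X *v v) = (\<Sum>i\<in>UNIV. p i * (norm ((adj P *v v) $ i))\<^sup>2)"
  unfolding spec_mult_vec [OF assms] inner_adj [of v P]
  unfolding inner_vec_def diagm_vec_nth
  by (intro sum.cong) (simp_all add: inner_complex_def cmod_square algebra_simps)

lemma unitary_axis: "unitary P \<Longrightarrow> adj P *v (P *v v) = v"
  by (simp add: matrix_vector_mul_assoc unitary_def)

lemma unitary_axis': "unitary P \<Longrightarrow> P *v (adj P *v v) = v"
  by (simp add: matrix_vector_mul_assoc unitary_def)

lemma norm_unitary: "unitary P \<Longrightarrow> norm (P *v v) = norm v"
  by (simp add: norm_eq_sqrt_inner inner_adj unitary_axis)

lemma spec_eigenvalue_quadratic_form: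
  assumes "spec X P p"
  shows "(P *v axis i 1) \<bullet> (X *v (P *v axis i 1)) = p i"
  unfolding spec_quadratic_form [OF assms]
  using assms
  by (simp add: unitary_axis spec_def axis_def if_distrib [of norm] if_distrib [of "\<lambda>x. x\<^sup>2"]
        if_distrib [of "\<lambda>x. _ * x"] cong: if_cong)

lemma unitary_axis_nonzero: "unitary P \<Longrightarrow> P *v axis i 1 \<noteq> 0"
  using norm_unitary [of P "axis i 1"] by auto

lemma pos_semidef_spec: "pos_semidef X \<Longrightarrow> spec X P p \<Longrightarrow> 0 \<le> p i"
  by (metis pos_semidef_def spec_eigenvalue_quadratic_form)

lemma pos_def_spec: "pos_def X \<Longrightarrow> spec X P p \<Longrightarrow> 0 < p i"
  by (metis pos_def_def spec_def spec_eigenvalue_quadratic_form unitary_axis_nonzero)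

lemma spec_pos_def:
  assumes "spec X P p" "\<And>i. 0 < p i"
  shows "pos_def X"
  unfolding pos_def_def
proof (intro conjI allI impI)
  show "self_adjoint X" using assms(1) by (rule spec_self_adjoint)
  fix v :: "complex ^ 'a" assume "v \<noteq> 0"
  have "adj P *v v \<noteq> 0"
    using assms(1) \<open>v \<noteq> 0\<close> norm_unitary [OF unitary_adj, of P v] by (auto simp: spec_def)
  then obtain i where "(adj P *v v) $ i \<noteq> 0" by (auto simp: vec_eq_iff)
  hence "0 < p i * (norm ((adj P *v v) $ i))\<^sup>2" using assms(2) by simp
  thus "0 < v \<bullet> (X *v v)"
    unfolding spec_quadratic_form [OF assms(1)]
    using assms(2) by (intro sum_pos2 [of _ i]) (auto intro!: mult_nonneg_nonneg simp: less_imp_le)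
qed

lemma pos_def_imp_pos_semidef: "pos_def X \<Longrightarrow> pos_semidef X"
  by (metis inner_zero_left less_eq_real_def pos_def_def pos_semidef_def)

lemma rtr_diagm [simp]: "rtr (diagm p) = sum p UNIV"
  by (simp add: rtr_def trace_def diagm_def)

lemma spec_rtr: "spec X P p \<Longrightarrow> rtr X = sum p UNIV"
proof -
  assume X: "spec X P p"
  hence "rtr ((adj P ** X) ** P) = sum p UNIV" by (simp add: spec_conj)
  moreover have "rtr ((adj P ** X) ** P) = rtr (P ** (adj P ** X))" by (rule rtr_commute)
  ultimately show ?thesis using X by (simp add: spec_def unitary_cancel)
qed

lemma density_rtr: "\<rho> \<in> density_ops \<Longrightarrow> rtr \<rho> = 1"
  by (simp add: density_ops_def rtr_def)

lemma density_pos_semidef: "\<rho> \<in> density_ops \<Longrightarrow> pos_semidef \<rho>"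
  by (simp add: density_ops_def)

lemma density_self_adjoint: "\<rho> \<in> density_ops \<Longrightarrow> self_adjoint \<rho>"
  by (simp add: density_ops_def)

lemma density_spec:
  assumes "\<rho> \<in> density_ops"
  obtains P p where "spec \<rho> P p" "\<And>i. 0 \<le> p i" "sum p UNIV = 1"
  using spec_exists [OF density_self_adjoint [OF assms]]
    pos_semidef_spec [OF density_pos_semidef [OF assms]] spec_rtr density_rtr [OF assms] by metis

lemma rtr_diagm_conj:
  "rtr (diagm p ** U ** diagm s ** adj U)
     = (\<Sum>a\<in>UNIV. \<Sum>i\<in>UNIV. (norm (U $ a $ i))\<^sup>2 * p a * s i)"
proof -
  have "rtr ((diagm p ** U ** diagm s) ** adj U)
      = (\<Sum>a\<in>UNIV. \<Sum>i\<in>UNIV. Re ((diagm p ** U ** diagm s) $ a $ i * adj U $ i $ a))"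
    by (rule rtr_eq_sum)
  also have "\<dots> = (\<Sum>a\<in>UNIV. \<Sum>i\<in>UNIV. (norm (U $ a $ i))\<^sup>2 * p a * s i)"
    by (intro sum.cong refl)
       (simp add: mult_diagm_nth diagm_mult_nth cmod_square algebra_simps)
  finally show ?thesis .
qed

text \<open>The squared overlaps of the two eigenbases form a doubly stochastic matrix, which turns
  traces of non-commuting products into classical double sums.\<close>

lemma rtr_spec_mult_spec:
  assumes "spec X P p" "spec Y Q s"
  shows "rtr (X ** Y)
    = (\<Sum>a\<in>UNIV. \<Sum>i\<in>UNIV. (norm ((adj P ** Q) $ a $ i))\<^sup>2 * p a * s i)"
proof -
  have "X ** Y = P ** (diagm p ** (adj P ** Q) ** diagm s ** adj Q)"
    using assms by (simp add: spec_def matrix_mul_assoc)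
  hence "rtr (X ** Y) = rtr ((diagm p ** (adj P ** Q) ** diagm s ** adj Q) ** P)"
    by (metis rtr_commute)
  also have "\<dots> = rtr (diagm p ** (adj P ** Q) ** diagm s ** adj (adj P ** Q))"
    by (simp add: adj_mult matrix_mul_assoc)
  finally show ?thesis by (simp add: rtr_diagm_conj)
qed

lemma sum_norm_row_unitary: "unitary U \<Longrightarrow> (\<Sum>i\<in>UNIV. (norm (U $ a $ i))\<^sup>2) = 1"
proof -
  assume "unitary U"
  hence "Re ((U ** adj U) $ a $ a) = 1" by (simp add: unitary_def mat_def)
  thus ?thesis by (simp add: matrix_matrix_mult_def cmod_square)
qed

lemma sum_norm_col_unitary: "unitary U \<Longrightarrow> (\<Sum>a\<in>UNIV. (norm (U $ a $ i))\<^sup>2) = 1"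
  using sum_norm_row_unitary [OF unitary_adj, of U i] by simp

section \<open>Functional calculus\<close>

lemma orth_proj_eqI:
  fixes S :: "(complex ^ 'n) set"
  assumes S: "vec.subspace S" and "\<And>v. Q *v v \<in> S" "\<And>v w. w \<in> S \<Longrightarrow> (v - Q *v v) \<bullet> w = 0"
  shows "orth_proj S = Q"
proof -
  have "orth_proj S *v v = Q *v v" for v
  proof -
    have sub: "orth_proj S *v v - Q *v v \<in> S"
      using S assms(2) orth_proj_works(1) [OF S] by (intro vec.subspace_diff) auto
    have "(v - Q *v v) \<bullet> (orth_proj S *v v - Q *v v)
        - (v - orth_proj S *v v) \<bullet> (orth_proj S *v v - Q *v v) = 0"
      using sub assms(3) orth_proj_works(2) [OF S] by simp
    hence "(orth_proj S *v v - Q *v v) \<bullet> (orth_proj S *v v - Q *v v) = 0"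
      by (simp add: inner_diff_left)
    thus ?thesis by simp
  qed
  thus ?thesis by (simp add: matrix_eq)
qed

lemma eigenspace_subspace: "vec.subspace (eigenspace X r)"
  by (auto simp: eigenspace_def vec.subspace_def matrix_vector_right_distrib
      matrix_vector_smult_right vec.scale_right_distrib mult.commute)

lemma spec_eigenspace:
  assumes X: "spec X P p"
  shows "v \<in> eigenspace X r \<longleftrightarrow> (\<forall>i. (adj P *v v) $ i \<noteq> 0 \<longrightarrow> p i = r)"
proof -
  have U: "unitary P" using X by (simp add: spec_def)
  have "X *v v = complex_of_real r *s v \<longleftrightarrow>
      adj P *v (X *v v) = adj P *v (complex_of_real r *s v)"
    using unitary_axis' [OF U] by metis
  also have "\<dots> \<longleftrightarrow> (\<forall>i. complex_of_real (p i) * (adj P *v v) $ i = complex_of_real r * (adj P *v v) $ i)"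
    unfolding spec_mult_vec [OF X] unitary_axis [OF U] matrix_vector_smult_right
    by (simp add: vec_eq_iff diagm_vec_nth)
  finally show ?thesis by (auto simp: eigenspace_def)
qed

lemma spec_real_spectrum:
  assumes X: "spec X P p"
  shows "real_spectrum X = range p"
proof (intro equalityI subsetI)
  fix r assume "r \<in> real_spectrum X"
  then obtain v where v: "v \<noteq> 0" "v \<in> eigenspace X r" by (auto simp: real_spectrum_def)
  have "adj P *v v \<noteq> 0" using v(1) X norm_unitary [OF unitary_adj, of P v] by (auto simp: spec_def)
  then obtain i where "(adj P *v v) $ i \<noteq> 0" by (auto simp: vec_eq_iff)
  thus "r \<in> range p" using v(2) by (auto simp: spec_eigenspace [OF X])
next
  fix r assume "r \<in> range p"
  then obtain i where i: "r = p i" by auto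
  have U: "unitary P" using X by (simp add: spec_def)
  have "P *v axis i 1 \<in> eigenspace X r"
    unfolding spec_eigenspace [OF X] unitary_axis [OF U] using i by (auto simp: axis_def)
  thus "r \<in> real_spectrum X"
    using unitary_axis_nonzero [OF U] unfolding real_spectrum_def by blast
qed

lemma spec_orth_proj_eigenspace:
  assumes X: "spec X P p"
  shows "orth_proj (eigenspace X r) = P ** diagm (\<lambda>i. if p i = r then 1 else 0) ** adj P"
    (is "_ = ?Q")
proof (rule orth_proj_eqI [OF eigenspace_subspace])
  have U: "unitary P" using X by (simp add: spec_def)
  let ?d = "\<lambda>i. if p i = r then 1 else 0 :: real"
  have Q: "spec ?Q P ?d" using U by (simp add: spec_def)
  have PQ: "adj P *v (?Q *v v) = diagm ?d *v (adj P *v v)" for v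
    unfolding spec_mult_vec [OF Q] unitary_axis [OF U] ..
  show "?Q *v v \<in> eigenspace X r" for v
    by (simp add: spec_eigenspace [OF X] PQ diagm_vec_nth)
  fix v w assume w: "w \<in> eigenspace X r"
  have "(adj P *v w) $ i = (diagm ?d *v (adj P *v w)) $ i" for i
    using w by (auto simp: spec_eigenspace [OF X] diagm_vec_nth)
  hence "adj P *v w = adj P *v (?Q *v w)" by (simp add: PQ vec_eq_iff)
  hence wQ: "?Q *v w = w" using unitary_axis' [OF U] by metis
  have QQ: "adj ?Q = ?Q" using spec_self_adjoint [OF Q] by (simp add: self_adjoint_def)
  have "w \<bullet> (?Q *v v) = w \<bullet> v" unfolding inner_adj [of w] QQ wQ ..
  thus "(v - ?Q *v v) \<bullet> w = 0"
    using inner_diff_right [of w v "?Q *v v"] inner_commute [of w "v - ?Q *v v"] by linarith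
qed

lemma diagm_sum: "(\<Sum>r\<in>S. diagm (f r)) = diagm (\<lambda>i. \<Sum>r\<in>S. f r i)"
  by (induction S rule: infinite_finite_induct) (auto simp: diagm_def vec_eq_iff)

lemma diagm_scaleR: "r *\<^sub>R diagm p = diagm (\<lambda>i. r * p i)"
  unfolding vec_eq_iff vector_scaleR_component
  by (simp add: diagm_def scaleR_conv_of_real)

text \<open>The defining sum runs over distinct eigenvalues while \<open>p\<close> repeats them; at
  each index exactly one indicator survives and leaves \<open>f (p i)\<close>. Hence every
  diagonalisation of \<open>X\<close> computes \<open>op_fun f X\<close>.\<close>

lemma spec_op_fun:
  assumes X: "spec X P p"
  shows "spec (op_fun f X) P (\<lambda>i. f (p i))"
proof -
  have "op_fun f X = (\<Sum>r\<in>range p. P ** (f r *\<^sub>R diagm (\<lambda>i. if p i = r then 1 else 0)) ** adj P)"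
    unfolding op_fun_def spec_real_spectrum [OF X] spec_orth_proj_eigenspace [OF X]
    by (simp add: matrix_scaleR_left matrix_scaleR_right)
  also have "\<dots> = P ** (\<Sum>r\<in>range p. f r *\<^sub>R diagm (\<lambda>i. if p i = r then 1 else 0)) ** adj P"
    by (simp add: matrix_sum_left matrix_sum_right)
  also have "(\<Sum>r\<in>range p. f r *\<^sub>R diagm (\<lambda>i. if p i = r then 1 else 0)) = diagm (\<lambda>i. f (p i))"
    by (simp add: diagm_scaleR diagm_sum if_distrib [of "\<lambda>x. _ * x"] cong: if_cong)
  finally show ?thesis using X by (simp add: spec_def)
qed

lemma spec_op_log: "spec X P p \<Longrightarrow> spec (op_log X) P (\<lambda>i. ln (p i))"
proof -
  assume X: "spec X P p"
  \<comment> \<open>\<open>ln\<close> has the default value 0 at 0, which agrees with the convention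
    fixed in \<open>op_log\<close>.\<close>
  have "(\<lambda>r. if r = 0 then 0 else ln r) = (ln :: real \<Rightarrow> real)" by (auto simp: fun_eq_iff)
  thus ?thesis using spec_op_fun [OF X, of ln] by (simp add: op_log_def)
qed

text \<open>Full support of a faithful reference state excludes the infinite branch of
  \<open>rel_entropy\<close>.\<close>

lemma supp_pos_def:
  assumes "pos_def (X :: 'n::finite cmat)"
  shows "range (\<lambda>v. supp X *v v) = UNIV"
proof -
  obtain P p where X: "spec X P p" using assms spec_exists unfolding pos_def_def by metis
  have U: "unitary P" using X by (simp add: spec_def)
  have "X *v (P *v (diagm (\<lambda>i. 1 / p i) *v (adj P *v v))) = v" for v
  proof -
    have "diagm p *v (diagm (\<lambda>i. 1 / p i) *v (adj P *v v)) = adj P *v v"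
      using pos_def_spec [OF assms X] by (simp add: vec_eq_iff diagm_vec_nth less_imp_neq [symmetric])
    thus ?thesis unfolding spec_mult_vec [OF X] unitary_axis [OF U] by (simp add: unitary_axis' [OF U])
  qed
  hence "surj (\<lambda>v. X *v v)" by (metis surjI)
  hence "supp X = orth_proj UNIV" by (simp add: supp_def)
  also have "\<dots> = mat 1" by (rule orth_proj_eqI) auto
  finally show ?thesis by simp
qed

text \<open>Relative entropy as the classical one of the Nussbaum--Szkola distributions
  \<open>|U\<^bsub>ai\<^esub>|\<^sup>2 p\<^sub>a\<close> and \<open>|U\<^bsub>ai\<^esub>|\<^sup>2 s\<^sub>i\<close>.\<close>

definition ns_entropy :: "('n::finite \<Rightarrow> real) \<Rightarrow> ('n \<Rightarrow> real) \<Rightarrow> 'n cmat \<Rightarrow> real" where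
  "ns_entropy p s U = (\<Sum>a\<in>UNIV. \<Sum>i\<in>UNIV. (norm (U $ a $ i))\<^sup>2 * (p a * (ln (p a) - ln (s i))))"

lemma rel_entropy_spec:
  assumes \<sigma>: "pos_def \<sigma>" and P: "spec \<rho> P p" and Q: "spec \<sigma> Q s"
  shows "rel_entropy \<rho> \<sigma> = ereal (ns_entropy p s (adj P ** Q))"
proof -
  let ?U = "adj P ** Q"
  have "unitary ?U" using P Q by (simp add: spec_def unitary_mult unitary_adj)
  hence row: "(\<Sum>i\<in>UNIV. (norm (?U $ a $ i))\<^sup>2) = 1" for a by (rule sum_norm_row_unitary)
  have UU: "adj P ** P = mat 1" using P by (simp add: spec_def unitary_def)
  have "rtr (\<rho> ** op_log \<rho>) = (\<Sum>a\<in>UNIV. p a * ln (p a))"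
    unfolding rtr_spec_mult_spec [OF P spec_op_log [OF P]] UU
    by (simp add: mat_def if_distrib [of norm] if_distrib [of "\<lambda>x. x\<^sup>2"] if_distrib [of "\<lambda>x. x * _"]
          cong: if_cong)
  \<comment> \<open>Unit row sums spread the single sum over both indices, so that it can be
    combined with the mixed term.\<close>
  also have "\<dots> = (\<Sum>a\<in>UNIV. \<Sum>i\<in>UNIV. (norm (?U $ a $ i))\<^sup>2 * (p a * ln (p a)))"
    unfolding sum_distrib_right [symmetric] row by simp
  finally have "rtr (\<rho> ** (op_log \<rho> - op_log \<sigma>)) = ns_entropy p s ?U"
    unfolding ns_entropy_def matrix_diff_ldistrib rtr_diff rtr_spec_mult_spec [OF P spec_op_log [OF Q]]
    by (simp add: sum_subtractf [symmetric] right_diff_distrib mult.assoc)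
  thus ?thesis by (simp add: rel_entropy_def supp_pos_def [OF \<sigma>] rtr_def)
qed

section \<open>Variational representation of the relative entropy and its response to the
  dynamics\<close>

section \<open>The quadratic functional\<close>

text \<open>For states \<open>\<rho>\<close>, \<open>\<sigma>\<close> the supremum over \<open>W\<close> of \<open>J s W \<rho> \<sigma>\<close> is
  \<open>\<langle>\<rho>\<^sup>1\<^sup>/\<^sup>2, (s + \<Delta>)\<^sup>-\<^sup>1 \<rho>\<^sup>1\<^sup>/\<^sup>2\<rangle>\<close>
  for the relative modular operator \<open>\<Delta>\<close>; integrating over \<open>s\<close> gives the relative entropy.\<close>

definition J :: "real \<Rightarrow> 'n::finite cmat \<Rightarrow> 'n cmat \<Rightarrow> 'n cmat \<Rightarrow> real" where
  "J s W X Y = 2 * rtr (X ** W) - s * rtr (X ** W ** adj W) - rtr (Y ** adj W ** W)"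

lemma J_add: "J s W (X + X') (Y + Y') = J s W X Y + J s W X' Y'"
  by (simp add: J_def matrix_distribs rtr_add algebra_simps)

lemma J_diff: "J s W (X - X') (Y - Y') = J s W X Y - J s W X' Y'"
  by (simp add: J_def matrix_distribs rtr_diff algebra_simps)

lemma J_scaleR: "J s W (r *\<^sub>R X) (r *\<^sub>R Y) = r * J s W X Y"
  by (simp add: J_def matrix_distribs rtr_scaleR algebra_simps)

lemma J_sum: "J s W (\<Sum>l\<in>S. X l) (\<Sum>l\<in>S. Y l) = (\<Sum>l\<in>S. J s W (X l) (Y l))"
proof (induction S rule: infinite_finite_induct)
  case (insert x F)
  thus ?case by (simp add: J_add)
qed (simp_all add: J_def)

text \<open>The Euler equation of the concave quadratic functional
  \<open>J s W \<rho> \<sigma>\<close> in \<open>W\<close>, written after taking adjoints.\<close>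

definition optimal :: "real \<Rightarrow> 'n::finite cmat \<Rightarrow> 'n cmat \<Rightarrow> 'n cmat \<Rightarrow> bool" where
  "optimal s W \<rho> \<sigma> \<longleftrightarrow> \<rho> = s *\<^sub>R (\<rho> ** W) + W ** \<sigma>"

lemma rtr_pos_semidef_conj: "pos_semidef \<rho> \<Longrightarrow> 0 \<le> rtr (\<rho> ** C ** adj C)"
proof -
  assume \<rho>: "pos_semidef \<rho>"
  have "rtr (\<rho> ** C ** adj C) = rtr (adj C ** (\<rho> ** C))" by (rule rtr_commute)
  also have "\<dots> = (\<Sum>i\<in>UNIV. (\<chi> k. C $ k $ i) \<bullet> (\<rho> *v (\<chi> k. C $ k $ i)))"
    by (simp add: inner_vec_complex rtr_def trace_def matrix_matrix_mult_def matrix_vector_mult_def)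
  also have "\<dots> \<ge> 0" using \<rho> by (intro sum_nonneg) (simp add: pos_semidef_def)
  finally show ?thesis .
qed

text \<open>The adjoint of the Euler equation, tested against \<open>Z\<close>: the first variation
  of \<open>J\<close> at \<open>W\<close> vanishes in every direction.\<close>

lemma optimal_pairing:
  assumes "self_adjoint \<rho>" "self_adjoint \<sigma>" "optimal s W \<rho> \<sigma>"
  shows "rtr (\<rho> ** Z) = s * rtr (\<rho> ** Z ** adj W) + rtr (\<sigma> ** adj W ** Z)"
proof -
  have "\<rho> = adj (s *\<^sub>R (\<rho> ** W) + W ** \<sigma>)"
    using assms by (metis self_adjointD optimal_def)
  also have "\<dots> = s *\<^sub>R (adj W ** \<rho>) + \<sigma> ** adj W"
    by (simp add: adj_add adj_scaleR adj_mult assms self_adjointD)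
  finally have "rtr (\<rho> ** Z) = rtr ((s *\<^sub>R (adj W ** \<rho>) + \<sigma> ** adj W) ** Z)" by simp
  also have "\<dots> = s * rtr (adj W ** (\<rho> ** Z)) + rtr (\<sigma> ** adj W ** Z)"
    by (simp add: matrix_distribs rtr_add rtr_scaleR matrix_mul_assoc)
  finally show ?thesis by (simp add: rtr_commute [of "adj W"])
qed

lemma J_optimal_value:
  assumes "self_adjoint \<rho>" "self_adjoint \<sigma>" "optimal s W \<rho> \<sigma>"
  shows "J s W \<rho> \<sigma> = rtr (\<rho> ** W)"
  using optimal_pairing [OF assms, of W] by (simp add: J_def)

text \<open>Expand around \<open>W\<close> with \<open>V = W + Z\<close>: the linear terms cancel by
  \<open>optimal_pairing\<close>, and what remains is minus two traces that are nonnegative because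
  the states are.\<close>

lemma J_le_optimal:
  assumes \<rho>: "pos_semidef \<rho>" and \<sigma>: "pos_semidef \<sigma>" and W: "optimal s W \<rho> \<sigma>" and "0 \<le> s"
  shows "J s V \<rho> \<sigma> \<le> J s W \<rho> \<sigma>"
proof -
  have sa: "self_adjoint \<rho>" "self_adjoint \<sigma>" using \<rho> \<sigma> by (auto simp: pos_semidef_def)
  define Z where "Z = V - W"
  have V: "V = W + Z" by (simp add: Z_def)
  have 1: "rtr (\<rho> ** W ** adj Z) = rtr (\<rho> ** Z ** adj W)"
  proof -
    have "rtr (\<rho> ** W ** adj Z) = rtr (adj (\<rho> ** W ** adj Z))" by simp
    also have "\<dots> = rtr ((Z ** adj W) ** \<rho>)" by (simp add: adj_mult sa self_adjointD matrix_mul_assoc)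
    also have "\<dots> = rtr (\<rho> ** (Z ** adj W))" by (rule rtr_commute)
    finally show ?thesis by (simp add: matrix_mul_assoc)
  qed
  have 2: "rtr (\<sigma> ** adj Z ** W) = rtr (\<sigma> ** adj W ** Z)"
  proof -
    have "rtr (\<sigma> ** adj Z ** W) = rtr (adj (\<sigma> ** adj Z ** W))" by simp
    also have "\<dots> = rtr ((adj W ** Z) ** \<sigma>)" by (simp add: adj_mult sa self_adjointD matrix_mul_assoc)
    also have "\<dots> = rtr (\<sigma> ** (adj W ** Z))" by (rule rtr_commute)
    finally show ?thesis by (simp add: matrix_mul_assoc)
  qed
  have "J s V \<rho> \<sigma> = J s W \<rho> \<sigma> - s * rtr (\<rho> ** Z ** adj Z) - rtr (\<sigma> ** adj Z ** adj (adj Z))"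
    using optimal_pairing [OF sa W, of Z] 1 2
    by (simp add: J_def V adj_add matrix_distribs rtr_add algebra_simps)
  thus ?thesis
    using rtr_pos_semidef_conj [OF \<rho>, of Z] rtr_pos_semidef_conj [OF \<sigma>, of "adj Z"] \<open>0 \<le> s\<close>
    by (smt (verit) mult_nonneg_nonneg)
qed

section \<open>Data processing for Lindblad generators\<close>

lemma rtr_conj_swap:
  assumes "self_adjoint \<rho>"
  shows "rtr (\<rho> ** X ** adj Y) = rtr (\<rho> ** Y ** adj X)"
proof -
  have "rtr (\<rho> ** X ** adj Y) = rtr (adj (\<rho> ** X ** adj Y))" by simp
  also have "\<dots> = rtr ((Y ** adj X) ** \<rho>)"
    by (simp add: adj_mult self_adjointD [OF assms] matrix_mul_assoc)
  also have "\<dots> = rtr (\<rho> ** (Y ** adj X))" by (rule rtr_commute)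
  finally show ?thesis by (simp add: matrix_mul_assoc)
qed

text \<open>\<open>\<Phi>\<close> is the generator in the Heisenberg picture. The hypotheses
  \<open>c1\<close> and \<open>c2\<close> say that its failure to be a derivation at these products
  is a square, which is the only form of positivity used. Pairing the Euler equation with
  \<open>Z = \<Phi> W\<close> cancels all cross terms and leaves minus the two squares.\<close>

lemma J_generator_nonpos:
  fixes G \<Phi> :: "'n::finite cmat \<Rightarrow> 'n cmat"
  assumes dual: "\<And>X M. rtr (G X ** M) = rtr (X ** \<Phi> M)"
    and c1: "\<Phi> (W ** adj W) = \<Phi> W ** adj W + W ** adj (\<Phi> W) + C ** adj C"
    and c2: "\<Phi> (adj W ** W) = adj (\<Phi> W) ** W + adj W ** \<Phi> W + C' ** adj C'"
    and \<rho>: "pos_semidef \<rho>" and \<sigma>: "pos_semidef \<sigma>" and W: "optimal s W \<rho> \<sigma>" and s: "0 \<le> s"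
  shows "J s W (G \<rho>) (G \<sigma>) \<le> 0"
proof -
  have sa: "self_adjoint \<rho>" "self_adjoint \<sigma>" using \<rho> \<sigma> by (auto simp: pos_semidef_def)
  have "rtr (G \<rho> ** W ** adj W) = rtr (\<rho> ** \<Phi> (W ** adj W))"
    using dual [of \<rho> "W ** adj W"] by (simp add: matrix_mul_assoc)
  also have "\<dots> = 2 * rtr (\<rho> ** \<Phi> W ** adj W) + rtr (\<rho> ** C ** adj C)"
    using rtr_conj_swap [OF sa(1), of W "\<Phi> W"]
    by (simp add: c1 matrix_distribs rtr_add matrix_mul_assoc)
  finally have 1: "rtr (G \<rho> ** W ** adj W) = 2 * rtr (\<rho> ** \<Phi> W ** adj W) + rtr (\<rho> ** C ** adj C)" .
  have "rtr (G \<sigma> ** adj W ** W) = rtr (\<sigma> ** \<Phi> (adj W ** W))"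
    using dual [of \<sigma> "adj W ** W"] by (simp add: matrix_mul_assoc)
  also have "\<dots> = 2 * rtr (\<sigma> ** adj W ** \<Phi> W) + rtr (\<sigma> ** C' ** adj C')"
    using rtr_conj_swap [OF sa(2), of "adj W" "adj (\<Phi> W)"]
    by (simp add: c2 matrix_distribs rtr_add matrix_mul_assoc)
  finally have 2: "rtr (G \<sigma> ** adj W ** W) = 2 * rtr (\<sigma> ** adj W ** \<Phi> W) + rtr (\<sigma> ** C' ** adj C')" .
  have "J s W (G \<rho>) (G \<sigma>) = 2 * rtr (\<rho> ** \<Phi> W) - s * (2 * rtr (\<rho> ** \<Phi> W ** adj W) + rtr (\<rho> ** C ** adj C))
     - (2 * rtr (\<sigma> ** adj W ** \<Phi> W) + rtr (\<sigma> ** C' ** adj C'))"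
    unfolding J_def 1 2 dual ..
  also have "\<dots> = - s * rtr (\<rho> ** C ** adj C) - rtr (\<sigma> ** C' ** adj C')"
    using optimal_pairing [OF sa W, of "\<Phi> W"] by (simp add: algebra_simps)
  also have "\<dots> \<le> 0"
    using rtr_pos_semidef_conj [OF \<rho>, of C] rtr_pos_semidef_conj [OF \<sigma>, of C'] s
    by (smt (verit) mult_minus_left mult_nonneg_nonneg)
  finally show ?thesis .
qed

definition dissipator_dual :: "'n::finite cmat \<Rightarrow> 'n cmat \<Rightarrow> 'n cmat" where
  "dissipator_dual L M = adj L ** M ** L - (1/2) *\<^sub>R (adj L ** L ** M + M ** adj L ** L)"

lemma rtr_dissipator: "rtr (dissipator L X ** M) = rtr (X ** dissipator_dual L M)"
proof -
  have "rtr (L ** X ** adj L ** M) = rtr (X ** adj L ** M ** L)"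
    using rtr_commute [of L "X ** adj L ** M"] by (simp add: matrix_mul_assoc)
  moreover have "rtr (adj L ** L ** X ** M) = rtr (X ** M ** adj L ** L)"
    using rtr_commute [of "adj L ** L" "X ** M"] by (simp add: matrix_mul_assoc)
  ultimately show ?thesis
    by (simp add: dissipator_def dissipator_dual_def anticommutator_def matrix_distribs rtr_add
        rtr_diff rtr_scaleR matrix_mul_assoc)
qed

lemma adj_dissipator_dual: "adj (dissipator_dual L M) = dissipator_dual L (adj M)"
  by (simp add: dissipator_dual_def adj_diff adj_add adj_scaleR adj_mult matrix_mul_assoc add.commute)

text \<open>The defect of the Leibniz rule is the square of the commutator of \<open>adj L\<close>
  with \<open>W\<close>. The version for the opposite order of factors follows by replacing
  \<open>W\<close> with \<open>adj W\<close>.\<close>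

lemma dissipator_dual_mult:
  "dissipator_dual L (W ** adj W) = dissipator_dual L W ** adj W + W ** adj (dissipator_dual L W)
     + (adj L ** W - W ** adj L) ** adj (adj L ** W - W ** adj L)"
  unfolding adj_dissipator_dual
  by (simp add: dissipator_dual_def adj_diff adj_mult matrix_distribs matrix_mul_assoc
      scaleR_right_distrib scaleR_right_diff_distrib algebra_simps)

lemma J_dissipator_nonpos:
  assumes "pos_semidef \<rho>" "pos_semidef \<sigma>" "optimal s W \<rho> \<sigma>" "0 \<le> s"
  shows "J s W (dissipator L \<rho>) (dissipator L \<sigma>) \<le> 0"
proof (rule J_generator_nonpos [OF rtr_dissipator dissipator_dual_mult _ assms])
  show "dissipator_dual L (adj W ** W) = adj (dissipator_dual L W) ** W
      + adj W ** dissipator_dual L W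
      + (adj L ** adj W - adj W ** adj L) ** adj (adj L ** adj W - adj W ** adj L)"
    using dissipator_dual_mult [of L "adj W"] by (simp add: adj_dissipator_dual)
qed

lemma rtr_hamiltonian:
  "rtr (mat (- \<i>) ** commutator H X ** M) = rtr (X ** (mat \<i> ** commutator H M))"
proof -
  have "mat (- \<i>) ** commutator H X ** M = mat (- \<i>) ** (H ** (X ** M)) - mat (- \<i>) ** (X ** H ** M)"
    by (simp add: commutator_def matrix_distribs matrix_mul_assoc)
  moreover have "X ** (mat \<i> ** commutator H M) = mat \<i> ** (X ** H ** M) - mat \<i> ** (X ** M ** H)"
    unfolding matrix_mul_assoc [of X] mat_commute
    by (simp add: commutator_def matrix_distribs matrix_mul_assoc [symmetric])
  moreover have "rtr (mat (- \<i>) ** (H ** (X ** M))) = rtr (mat (- \<i>) ** (X ** M ** H))"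
    using rtr_commute [of "mat (- \<i>) ** H" "X ** M"]
    by (simp add: matrix_mul_assoc [symmetric]) (simp add: matrix_mul_assoc mat_commute)
  moreover have "mat (- \<i>) ** Y = - (mat \<i> ** Y)" for Y :: "'a cmat"
    by (simp add: vec_eq_iff)
  ultimately show ?thesis by (simp add: rtr_diff) (simp add: rtr_def trace_def sum_negf)
qed

text \<open>Commutation with \<open>H\<close> is a derivation compatible with \<open>adj\<close>, so
  the Leibniz defect is zero and both squares are 0.\<close>

lemma J_hamiltonian_nonpos:
  assumes H: "self_adjoint H"
    and "pos_semidef \<rho>" "pos_semidef \<sigma>" "optimal s W \<rho> \<sigma>" "0 \<le> s"
  shows "J s W (mat (- \<i>) ** commutator H \<rho>) (mat (- \<i>) ** commutator H \<sigma>) \<le> 0"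
proof (rule J_generator_nonpos [OF rtr_hamiltonian _ _ assms(2-)])
  have a: "adj (mat \<i> ** commutator H M) = mat \<i> ** commutator H (adj M)" for M
  proof -
    have "adj (mat \<i> ** commutator H M) = mat (- \<i>) ** (adj M ** H - H ** adj M)"
      by (simp add: adj_mult commutator_def adj_diff self_adjointD [OF H] mat_commute)
    also have "\<dots> = mat \<i> ** commutator H (adj M)" by (simp add: vec_eq_iff commutator_def algebra_simps)
    finally show ?thesis .
  qed
  have d: "mat \<i> ** commutator H (M ** M') = (mat \<i> ** commutator H M) ** M' + M ** (mat \<i> ** commutator H M')"
    for M M'
    unfolding matrix_mul_assoc [of M "mat \<i>"] mat_commute
    by (simp add: commutator_def matrix_distribs matrix_mul_assoc [symmetric])
  show "mat \<i> ** commutator H (W ** adj W) = (mat \<i> ** commutator H W) ** adj W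
      + W ** adj (mat \<i> ** commutator H W) + 0 ** adj 0"
    by (simp add: a d)
  show "mat \<i> ** commutator H (adj W ** W) = adj (mat \<i> ** commutator H W) ** W
      + adj W ** (mat \<i> ** commutator H W) + 0 ** adj 0"
    by (simp add: a d)
qed

section \<open>The truncated relative entropy\<close>

text \<open>In the eigenbases of the two states the Euler equation decouples into one scalar
  equation per entry, \<open>p a * U $ a $ i = (r * p a + e i) * c $ a $ i\<close>; this is its
  solution.\<close>

definition opt_core :: "real \<Rightarrow> ('n::finite \<Rightarrow> real) \<Rightarrow> ('n \<Rightarrow> real) \<Rightarrow> 'n cmat \<Rightarrow> 'n cmat" where
  "opt_core r p e U = (\<chi> a i. complex_of_real (p a / (r * p a + e i)) * U $ a $ i)"

definition opt_W ::
  "('n::finite \<Rightarrow> real) \<Rightarrow> ('n \<Rightarrow> real) \<Rightarrow> 'n cmat \<Rightarrow> 'n cmat \<Rightarrow> real \<Rightarrow> 'n cmat" where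
  "opt_W p e P Q r = P ** opt_core r p e (adj P ** Q) ** adj Q"

lemma optimal_opt_W:
  assumes P: "spec \<rho> P p" and Q: "spec \<sigma> Q e" and p: "\<And>i. 0 \<le> p i" and e: "\<And>i. 0 < e i" and r: "0 \<le> r"
  shows "optimal r (opt_W p e P Q r) \<rho> \<sigma>"
proof -
  let ?U = "adj P ** Q" and ?c = "opt_core r p e (adj P ** Q)"
  have U: "unitary P" "unitary Q" using P Q by (auto simp: spec_def)
  have "\<rho> = P ** (diagm p ** ?U) ** adj Q"
    using P U by (simp add: spec_def matrix_mul_assoc [symmetric] unitary_def)
  also have "diagm p ** ?U = r *\<^sub>R (diagm p ** ?c) + ?c ** diagm e"
  proof -
    have "p a * ?U $ a $ i = r *\<^sub>R (p a * ?c $ a $ i) + e i * ?c $ a $ i" for a i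
    proof -
      have "r * p a + e i > 0" using p e r by (simp add: add_nonneg_pos)
      hence "p a = (r * p a + e i) * (p a / (r * p a + e i))" by simp
      hence "p a = r * (p a * (p a / (r * p a + e i))) + e i * (p a / (r * p a + e i))"
        by (simp only: distrib_right mult.assoc)
      hence "complex_of_real (p a) = complex_of_real (r * (p a * (p a / (r * p a + e i))) + e i * (p a / (r * p a + e i)))"
        by (rule arg_cong)
      hence "complex_of_real (p a) * ?U $ a $ i
        = complex_of_real (r * (p a * (p a / (r * p a + e i))) + e i * (p a / (r * p a + e i))) * ?U $ a $ i"
        by (rule arg_cong [where f = "\<lambda>z. z * ?U $ a $ i"])
      thus ?thesis unfolding opt_core_def vec_lambda_beta scaleR_conv_of_real of_real_add of_real_mult
        by (simp only: distrib_right mult.assoc)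
    qed
    thus ?thesis unfolding vec_eq_iff vector_add_component vector_scaleR_component diagm_mult_nth mult_diagm_nth
      by blast
  qed
  also have "P ** (r *\<^sub>R (diagm p ** ?c) + ?c ** diagm e) ** adj Q
      = r *\<^sub>R (\<rho> ** opt_W p e P Q r) + opt_W p e P Q r ** \<sigma>"
  proof -
    have "\<rho> ** opt_W p e P Q r = P ** (diagm p ** ?c) ** adj Q"
      using P by (simp add: spec_def opt_W_def matrix_mul_assoc [symmetric] unitary_cancel)
    moreover have "opt_W p e P Q r ** \<sigma> = P ** (?c ** diagm e) ** adj Q"
      using Q by (simp add: spec_def opt_W_def matrix_mul_assoc [symmetric] unitary_cancel)
    ultimately show ?thesis by (simp add: matrix_distribs)
  qed
  finally show ?thesis unfolding optimal_def .
qed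

lemma rtr_opt_W:
  assumes P: "spec \<rho> P p"
  shows "rtr (\<rho> ** opt_W p e P Q r)
    = (\<Sum>a\<in>UNIV. \<Sum>i\<in>UNIV. (norm ((adj P ** Q) $ a $ i))\<^sup>2 * ((p a)\<^sup>2 / (r * p a + e i)))"
proof -
  let ?U = "adj P ** Q" and ?c = "opt_core r p e (adj P ** Q)"
  have "rtr (\<rho> ** opt_W p e P Q r) = rtr (P ** (diagm p ** ?c ** adj Q))"
    using P by (simp add: spec_def opt_W_def matrix_mul_assoc [symmetric] unitary_cancel)
  also have "\<dots> = rtr ((diagm p ** ?c ** adj Q) ** P)" by (rule rtr_commute)
  also have "\<dots> = rtr ((diagm p ** ?c) ** adj ?U)" by (simp add: adj_mult matrix_mul_assoc)
  also have "\<dots> = (\<Sum>a\<in>UNIV. \<Sum>i\<in>UNIV. Re ((diagm p ** ?c) $ a $ i * adj ?U $ i $ a))"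
    by (rule rtr_eq_sum)
  also have "\<dots> = (\<Sum>a\<in>UNIV. \<Sum>i\<in>UNIV. (norm (?U $ a $ i))\<^sup>2 * ((p a)\<^sup>2 / (r * p a + e i)))"
  proof (intro sum.cong refl)
    fix a i
    have "(diagm p ** ?c) $ a $ i * adj ?U $ i $ a
        = complex_of_real (p a * (p a / (r * p a + e i))) * (?U $ a $ i * cnj (?U $ a $ i))"
      unfolding diagm_mult_nth opt_core_def vec_lambda_beta adj_nth of_real_mult by (simp only: mult.assoc)
    also have "\<dots> = complex_of_real (p a * (p a / (r * p a + e i)) * (norm (?U $ a $ i))\<^sup>2)"
      unfolding complex_norm_square of_real_mult ..
    finally show "Re ((diagm p ** ?c) $ a $ i * adj ?U $ i $ a)
        = (norm (?U $ a $ i))\<^sup>2 * ((p a)\<^sup>2 / (r * p a + e i))"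
      by (simp add: power2_eq_square)
  qed
  finally show ?thesis .
qed

text \<open>The closed form of the integral over \<open>{0..S}\<close> of the optimal value of
  \<open>J\<close> minus 1/(1+r). For large \<open>S\<close> the difference
  \<open>ln (S * p a + e i) - ln (1 + S)\<close> tends to \<open>ln (p a)\<close>, which recovers
  \<open>ns_entropy\<close>; indices with \<open>p a = 0\<close> contribute nothing.\<close>

definition ns_trunc :: "real \<Rightarrow> ('n::finite \<Rightarrow> real) \<Rightarrow> ('n \<Rightarrow> real) \<Rightarrow> 'n cmat \<Rightarrow> real" where
  "ns_trunc S p e U =
     (\<Sum>a\<in>UNIV. \<Sum>i\<in>UNIV. (norm (U $ a $ i))\<^sup>2 * (p a * (ln (S * p a + e i) - ln (e i)))) - ln (1 + S)"

lemma has_integral_resolvent: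
  fixes p e S :: real
  assumes "0 \<le> p" "0 < e" "0 \<le> S"
  shows "((\<lambda>r. p\<^sup>2 / (r * p + e)) has_integral p * (ln (S * p + e) - ln e)) {0..S}"
proof -
  have "((\<lambda>r. p * ln (r * p + e)) has_vector_derivative p\<^sup>2 / (r * p + e)) (at r within {0..S})"
    if "r \<in> {0..S}" for r
  proof -
    have "r * p + e > 0" using assms that by (simp add: add_nonneg_pos)
    thus ?thesis unfolding has_real_derivative_iff_has_vector_derivative [symmetric]
      by (auto intro!: derivative_eq_intros simp: power2_eq_square divide_inverse mult_ac)
  qed
  from fundamental_theorem_of_calculus [OF assms(3) this]
  show ?thesis by (simp add: right_diff_distrib)
qed

text \<open>One side uses ln z <= z - 1 for z = (S p + e)/(p (1 + S)); after summation the
  normalisations give S/(1+S) + 1/(1+S) - 1 = 0. The other side uses ln (1 + 1/S) <= 1/S. Neither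
  bound involves the smallest eigenvalue of the first state.\<close>

lemma ns_trunc_bounds:
  fixes U :: "'n::finite cmat"
  assumes p: "\<And>i. 0 \<le> p i" and e: "\<And>i. 0 < e i" and sp: "sum p UNIV = 1" and se: "sum e UNIV = 1"
    and U: "unitary U" and S: "0 < S"
  shows "ns_trunc S p e U \<le> ns_entropy p e U" and "ns_entropy p e U \<le> ns_trunc S p e U + 1 / S"
proof -
  let ?u = "\<lambda>a i. (norm (U $ a $ i))\<^sup>2"
  let ?f = "\<lambda>a i. p a * (ln (S * p a + e i) - ln (p a) - ln (1 + S))"
  have row: "(\<Sum>i\<in>UNIV. ?u a i) = 1" for a using U by (rule sum_norm_row_unitary)
  have col: "(\<Sum>a\<in>UNIV. ?u a i) = 1" for i using U by (rule sum_norm_col_unitary)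
  have pa: "(\<Sum>a\<in>UNIV. \<Sum>i\<in>UNIV. ?u a i * (p a * c)) = c" for c
    unfolding sum_distrib_right [symmetric] row by (simp add: sum_distrib_right [symmetric] sp)
  have ei: "(\<Sum>a\<in>UNIV. \<Sum>i\<in>UNIV. ?u a i * (e i * c)) = c" for c
    by (subst sum.swap, unfold sum_distrib_right [symmetric] col) (simp add: sum_distrib_right [symmetric] se)
  have "ns_trunc S p e U - ns_entropy p e U
      = (\<Sum>a\<in>UNIV. \<Sum>i\<in>UNIV. ?u a i * (p a * (ln (S * p a + e i) - ln (e i))))
        - (\<Sum>a\<in>UNIV. \<Sum>i\<in>UNIV. ?u a i * (p a * ln (1 + S)))
        - (\<Sum>a\<in>UNIV. \<Sum>i\<in>UNIV. ?u a i * (p a * (ln (p a) - ln (e i))))"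
    unfolding pa by (simp add: ns_trunc_def ns_entropy_def)
  also have "\<dots> = (\<Sum>a\<in>UNIV. \<Sum>i\<in>UNIV. ?u a i * ?f a i)"
    unfolding sum_subtractf [symmetric] right_diff_distrib [symmetric]
    by (intro sum.cong refl) (simp add: algebra_simps)
  finally have eq: "ns_trunc S p e U - ns_entropy p e U = (\<Sum>a\<in>UNIV. \<Sum>i\<in>UNIV. ?u a i * ?f a i)" .
  have up: "?f a i \<le> p a * (S / (1 + S)) + e i * (1 / (1 + S)) - p a" for a i
  proof (cases "p a = 0")
    case True
    thus ?thesis using e [of i] S by simp
  next
    case False
    hence pa: "p a > 0" using p [of a] by simp
    have pos: "S * p a + e i > 0" using pa e S by (simp add: add_nonneg_pos)
    have "ln (S * p a + e i) - ln (p a) - ln (1 + S) = ln ((S * p a + e i) / (p a * (1 + S)))"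
      using pa pos S by (simp add: ln_div ln_mult)
    also have "\<dots> \<le> (S * p a + e i) / (p a * (1 + S)) - 1"
      using pa pos S by (intro ln_le_minus_one) simp
    finally have "?f a i \<le> p a * ((S * p a + e i) / (p a * (1 + S)) - 1)"
      using pa by (intro mult_left_mono) auto
    also have "\<dots> = (S * p a + e i) / (1 + S) - p a"
      using pa S by (simp add: right_diff_distrib)
    also have "\<dots> = p a * (S / (1 + S)) + e i * (1 / (1 + S)) - p a"
      by (simp add: add_divide_distrib mult.commute)
    finally show ?thesis .
  qed
  have "(\<Sum>a\<in>UNIV. \<Sum>i\<in>UNIV. ?u a i * ?f a i)
      \<le> (\<Sum>a\<in>UNIV. \<Sum>i\<in>UNIV. ?u a i * (p a * (S / (1 + S)) + e i * (1 / (1 + S)) - p a * 1))"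
    by (intro sum_mono mult_left_mono) (use up in auto)
  also have "\<dots> = S / (1 + S) + 1 / (1 + S) - 1"
    unfolding right_diff_distrib distrib_left sum_subtractf sum.distrib pa ei ..
  also have "\<dots> = 0" using S by (simp add: field_simps)
  finally show "ns_trunc S p e U \<le> ns_entropy p e U" using eq by simp
  have lo: "p a * (- (1 / S)) \<le> ?f a i" for a i
  proof (cases "p a = 0")
    case False
    hence pa: "p a > 0" using p [of a] by simp
    have "ln (1 + 1 / S) \<le> 1 / S" using S by (intro ln_add_one_self_le_self) simp
    moreover have "1 + 1 / S = (1 + S) / S" using S by (simp add: field_simps)
    hence "ln (1 + 1 / S) = ln (1 + S) - ln S" using S by (simp add: ln_div)
    moreover have "ln (S * p a) \<le> ln (S * p a + e i)"
      using S pa e [of i] by (intro ln_mono) (auto intro: add_pos_pos)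
    moreover have "ln (S * p a) = ln S + ln (p a)" using S pa by (simp add: ln_mult)
    ultimately have "- (1 / S) \<le> ln (S * p a + e i) - ln (p a) - ln (1 + S)" by linarith
    thus ?thesis using pa by (intro mult_left_mono) auto
  qed simp
  have "- (1 / S) = (\<Sum>a\<in>UNIV. \<Sum>i\<in>UNIV. ?u a i * (p a * (- (1 / S))))" unfolding pa ..
  also have "\<dots> \<le> (\<Sum>a\<in>UNIV. \<Sum>i\<in>UNIV. ?u a i * ?f a i)"
    by (intro sum_mono mult_left_mono [OF lo]) simp
  finally show "ns_entropy p e U \<le> ns_trunc S p e U + 1 / S" using eq by simp
qed

lemma has_integral_opt_W:
  assumes P: "spec \<rho> P p" and p: "\<And>i. 0 \<le> p i" and e: "\<And>i. 0 < e i" and S: "0 \<le> S"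
  shows "((\<lambda>r. rtr (\<rho> ** opt_W p e P Q r)) has_integral (ns_trunc S p e (adj P ** Q) + ln (1 + S))) {0..S}"
  unfolding rtr_opt_W [OF P] ns_trunc_def
  unfolding diff_add_cancel
  by (intro has_integral_sum has_integral_mult_right has_integral_resolvent p e S) simp_all

text \<open>Stated as a supremum, without any diagonalisation, so that the states of two different
  times can be compared through the same test operators.\<close>

definition trunc_entropy :: "real \<Rightarrow> 'n::finite cmat \<Rightarrow> 'n cmat \<Rightarrow> real" where
  "trunc_entropy S \<rho> \<sigma> = integral {0..S} (\<lambda>r. SUP W. J r W \<rho> \<sigma>) - ln (1 + S)"

text \<open>The supremum is attained, hence a genuine real number, although \<open>W\<close> ranges
  over an unbounded set.\<close>

lemma SUP_J_eq:
  assumes "pos_semidef \<rho>" "pos_def \<sigma>" "spec \<rho> P p" "spec \<sigma> Q e" "0 \<le> r"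
  shows "(SUP W. J r W \<rho> \<sigma>) = J r (opt_W p e P Q r) \<rho> \<sigma>"
    and "J r (opt_W p e P Q r) \<rho> \<sigma> = rtr (\<rho> ** opt_W p e P Q r)"
proof -
  have o: "optimal r (opt_W p e P Q r) \<rho> \<sigma>"
    using assms pos_semidef_spec pos_def_spec by (intro optimal_opt_W) auto
  show "(SUP W. J r W \<rho> \<sigma>) = J r (opt_W p e P Q r) \<rho> \<sigma>"
    using J_le_optimal [OF assms(1) pos_def_imp_pos_semidef [OF assms(2)] o assms(5)]
    by (intro cSup_eq_maximum) auto
  show "J r (opt_W p e P Q r) \<rho> \<sigma> = rtr (\<rho> ** opt_W p e P Q r)"
    using assms o by (intro J_optimal_value) (auto simp: pos_semidef_def pos_def_def)
qed

lemma trunc_entropy_eq: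
  assumes "pos_semidef \<rho>" "pos_def \<sigma>" "spec \<rho> P p" "spec \<sigma> Q e" "0 \<le> S"
  shows "((\<lambda>r. SUP W. J r W \<rho> \<sigma>) has_integral (ns_trunc S p e (adj P ** Q) + ln (1 + S))) {0..S}"
    and "trunc_entropy S \<rho> \<sigma> = ns_trunc S p e (adj P ** Q)"
proof -
  have "((\<lambda>r. rtr (\<rho> ** opt_W p e P Q r)) has_integral (ns_trunc S p e (adj P ** Q) + ln (1 + S))) {0..S}"
    using assms pos_semidef_spec pos_def_spec by (intro has_integral_opt_W) auto
  thus *: "((\<lambda>r. SUP W. J r W \<rho> \<sigma>) has_integral (ns_trunc S p e (adj P ** Q) + ln (1 + S))) {0..S}"
    by (rule has_integral_eq [rotated]) (use SUP_J_eq [OF assms(1-4)] in auto)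
  show "trunc_entropy S \<rho> \<sigma> = ns_trunc S p e (adj P ** Q)"
    using integral_unique [OF *] by (simp add: trunc_entropy_def)
qed

lemma rel_entropy_trunc:
  assumes \<rho>: "\<rho> \<in> density_ops" and \<sigma>: "\<sigma> \<in> density_ops" "pos_def \<sigma>" and S: "0 < S"
  obtains d where "rel_entropy \<rho> \<sigma> = ereal d"
    "trunc_entropy S \<rho> \<sigma> \<le> d" "d \<le> trunc_entropy S \<rho> \<sigma> + 1 / S"
proof -
  obtain P p Q e where P: "spec \<rho> P p" "sum p UNIV = 1" and Q: "spec \<sigma> Q e" "sum e UNIV = 1"
    using density_spec [OF \<rho>] density_spec [OF \<sigma>(1)] by metis
  have "unitary (adj P ** Q)" using P Q by (simp add: spec_def unitary_mult unitary_adj)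
  with P(2) Q(2) have "ns_trunc S p e (adj P ** Q) \<le> ns_entropy p e (adj P ** Q)"
    "ns_entropy p e (adj P ** Q) \<le> ns_trunc S p e (adj P ** Q) + 1 / S"
    using pos_semidef_spec [OF density_pos_semidef [OF \<rho>] P(1)] pos_def_spec [OF \<sigma>(2) Q(1)] S
    by (auto intro!: ns_trunc_bounds)
  thus thesis
    using that rel_entropy_spec [OF \<sigma>(2) P(1) Q(1)]
      trunc_entropy_eq(2) [OF density_pos_semidef [OF \<rho>] \<sigma>(2) P(1) Q(1), of S] S by simp
qed

lemma continuous_on_matrix_mult [continuous_intros]:
  fixes f :: "'a::topological_space \<Rightarrow> complex ^ 'n ^ 'm"
  assumes "continuous_on S f" "continuous_on S g"
  shows "continuous_on S (\<lambda>r. f r ** g r)"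
  unfolding matrix_matrix_mult_def
  by (intro continuous_intros continuous_on_component assms)

lemma continuous_on_adj [continuous_intros]:
  fixes f :: "'a::topological_space \<Rightarrow> complex ^ 'n ^ 'm"
  assumes "continuous_on S f"
  shows "continuous_on S (\<lambda>r. adj (f r))"
  unfolding adj_def
  by (intro continuous_intros continuous_on_component assms)

lemma continuous_on_rtr [continuous_intros]:
  fixes f :: "'a::topological_space \<Rightarrow> 'n::finite cmat"
  assumes "continuous_on S f"
  shows "continuous_on S (\<lambda>r. rtr (f r))"
  unfolding rtr_def trace_def
  by (intro continuous_intros continuous_on_component assms)

lemma continuous_on_J_opt_W:
  assumes "\<And>i. 0 \<le> p i" "\<And>i. 0 < e i"
  shows "continuous_on {0..S} (\<lambda>r. J r (opt_W p e P Q r) X Y)"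
proof -
  have "r * p a + e i \<noteq> 0" if "r \<in> {0..S}" for r a i
    using assms that by (metis add_nonneg_pos atLeastAtMost_iff less_irrefl mult_nonneg_nonneg)
  hence "continuous_on {0..S} (opt_W p e P Q)"
    unfolding opt_W_def opt_core_def
    by (intro continuous_intros) auto
  thus ?thesis unfolding J_def by (intro continuous_intros)
qed

text \<open>The envelope-principle derivative of the truncated entropy: \<open>J\<close> is
  differentiated with its maximiser frozen. The arguments \<open>p e P Q\<close> determine the
  maximiser, while \<open>X\<close> and \<open>Y\<close> are the variations of the two
  states.\<close>

definition trunc_deriv ::
  "real \<Rightarrow> ('n::finite \<Rightarrow> real) \<Rightarrow> ('n \<Rightarrow> real) \<Rightarrow> 'n cmat \<Rightarrow> 'n cmat \<Rightarrow> 'n cmat \<Rightarrow> 'n cmat \<Rightarrow> real" where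
  "trunc_deriv S p e P Q X Y = integral {0..S} (\<lambda>r. J r (opt_W p e P Q r) X Y)"

lemma integrable_J_opt_W:
  assumes "\<And>i. 0 \<le> p i" "\<And>i. 0 < e i"
  shows "(\<lambda>r. J r (opt_W p e P Q r) X Y) integrable_on {0..S}"
  by (rule integrable_continuous_real continuous_on_J_opt_W assms)+

lemma trunc_deriv_add:
  assumes "\<And>i. 0 \<le> p i" "\<And>i. 0 < e i"
  shows "trunc_deriv S p e P Q (X + X') (Y + Y') = trunc_deriv S p e P Q X Y + trunc_deriv S p e P Q X' Y'"
  unfolding trunc_deriv_def J_add by (intro integral_add integrable_J_opt_W assms)

lemma trunc_deriv_diff:
  assumes "\<And>i. 0 \<le> p i" "\<And>i. 0 < e i"
  shows "trunc_deriv S p e P Q (X - X') (Y - Y') = trunc_deriv S p e P Q X Y - trunc_deriv S p e P Q X' Y'"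
  unfolding trunc_deriv_def J_diff by (intro integral_diff integrable_J_opt_W assms)

lemma trunc_deriv_scaleR:
  "trunc_deriv S p e P Q (c *\<^sub>R X) (c *\<^sub>R Y) = c * trunc_deriv S p e P Q X Y"
  unfolding trunc_deriv_def J_scaleR by simp

text \<open>The truncated entropy is an integral of suprema of linear functionals, so a backward
  difference is controlled by the functional that is optimal at the later time.\<close>

lemma trunc_entropy_diff_le:
  assumes \<rho>: "pos_semidef \<rho>" "spec \<rho> P p" and \<sigma>: "pos_def \<sigma>" "spec \<sigma> Q e"
    and \<rho>': "pos_semidef \<rho>'" and \<sigma>': "pos_def \<sigma>'" and S: "0 \<le> S"
  shows "trunc_entropy S \<rho> \<sigma> - trunc_entropy S \<rho>' \<sigma>' \<le> trunc_deriv S p e P Q (\<rho> - \<rho>') (\<sigma> - \<sigma>')"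
proof -
  obtain P' p' where P': "spec \<rho>' P' p'" using spec_exists \<rho>' unfolding pos_semidef_def by metis
  obtain Q' e' where Q': "spec \<sigma>' Q' e'" using spec_exists \<sigma>' unfolding pos_def_def by metis
  note i = trunc_entropy_eq(1) [OF \<rho>(1) \<sigma>(1) \<rho>(2) \<sigma>(2) S, THEN has_integral_integrable]
    trunc_entropy_eq(1) [OF \<rho>' \<sigma>' P' Q' S, THEN has_integral_integrable]
  have "trunc_entropy S \<rho> \<sigma> - trunc_entropy S \<rho>' \<sigma>'
      = integral {0..S} (\<lambda>r. (SUP W. J r W \<rho> \<sigma>) - (SUP W. J r W \<rho>' \<sigma>'))"
    using integral_diff [OF i] by (simp add: trunc_entropy_def)
  also have "\<dots> \<le> trunc_deriv S p e P Q (\<rho> - \<rho>') (\<sigma> - \<sigma>')"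
    unfolding trunc_deriv_def
  proof (rule integral_le)
    show "(\<lambda>r. (SUP W. J r W \<rho> \<sigma>) - (SUP W. J r W \<rho>' \<sigma>')) integrable_on {0..S}"
      using i by (rule integrable_diff)
    show "(\<lambda>r. J r (opt_W p e P Q r) (\<rho> - \<rho>') (\<sigma> - \<sigma>')) integrable_on {0..S}"
      using pos_semidef_spec [OF \<rho>] pos_def_spec [OF \<sigma>] by (rule integrable_J_opt_W)
    fix r assume "r \<in> {0..S}"
    hence r: "0 \<le> r" by simp
    have "optimal r (opt_W p' e' P' Q' r) \<rho>' \<sigma>'"
      using pos_semidef_spec [OF \<rho>' P'] pos_def_spec [OF \<sigma>' Q'] r by (intro optimal_opt_W P' Q') auto
    hence "J r (opt_W p e P Q r) \<rho>' \<sigma>' \<le> J r (opt_W p' e' P' Q' r) \<rho>' \<sigma>'"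
      using r by (intro J_le_optimal \<rho>' pos_def_imp_pos_semidef \<sigma>')
    thus "(SUP W. J r W \<rho> \<sigma>) - (SUP W. J r W \<rho>' \<sigma>') \<le> J r (opt_W p e P Q r) (\<rho> - \<rho>') (\<sigma> - \<sigma>')"
      unfolding J_diff SUP_J_eq(1) [OF \<rho>(1) \<sigma>(1) \<rho>(2) \<sigma>(2) r] SUP_J_eq(1) [OF \<rho>' \<sigma>' P' Q' r] by simp
  qed
  finally show ?thesis .
qed

lemma norm_matrix_entry_le: "norm (X $ i $ j) \<le> norm (X :: complex ^ 'n ^ 'm)"
  using Finite_Cartesian_Product.norm_nth_le [of "X $ i" j] Finite_Cartesian_Product.norm_nth_le [of X i]
  by linarith

lemma norm_unitary_entry_le:
  assumes "unitary U"
  shows "norm (U $ i $ j) \<le> 1"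
proof -
  have "(norm (U $ i $ j))\<^sup>2 \<le> (\<Sum>k\<in>UNIV. (norm (U $ i $ k))\<^sup>2)"
    by (intro member_le_sum) auto
  thus ?thesis unfolding sum_norm_row_unitary [OF assms] by (simp add: abs_square_le_1)
qed

lemma norm_mult_entry_le:
  fixes X :: "complex ^ 'n ^ 'm" and Y :: "complex ^ 'l ^ 'n::finite"
  assumes "\<And>i j. norm (X $ i $ j) \<le> a" "\<And>i j. norm (Y $ i $ j) \<le> b"
  shows "norm ((X ** Y) $ i $ j) \<le> real CARD('n) * a * b"
proof -
  have a: "0 \<le> a" using assms(1) norm_ge_zero order_trans by blast
  have "norm ((X ** Y) $ i $ j) \<le> (\<Sum>k\<in>(UNIV :: 'n set). a * b)"
    unfolding matrix_matrix_mult_def vec_lambda_beta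
    by (intro sum_norm_le) (simp add: norm_mult, intro mult_mono assms a norm_ge_zero)
  thus ?thesis by simp
qed

lemma rtr_abs_le:
  fixes X :: "'n::finite cmat"
  assumes "\<And>i j. norm (X $ i $ j) \<le> a"
  shows "\<bar>rtr X\<bar> \<le> real CARD('n) * a"
proof -
  have "\<bar>rtr X\<bar> \<le> norm (trace X)" unfolding rtr_def by (rule abs_Re_le_cmod)
  also have "\<dots> \<le> (\<Sum>i\<in>(UNIV :: 'n set). a)" unfolding trace_def by (intro sum_norm_le assms)
  finally show ?thesis by simp
qed

lemma opt_W_entry_le:
  fixes P Q :: "'n::finite cmat"
  assumes U: "unitary P" "unitary Q" and p: "\<And>i. 0 \<le> p i" "\<And>i. p i \<le> 1"
    and e: "\<And>i. \<mu> \<le> e i" and \<mu>: "0 < \<mu>" and r: "0 \<le> r"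
  shows "norm (opt_W p e P Q r $ i $ j) \<le> (real CARD('n))\<^sup>2 / \<mu>"
proof -
  have c: "norm (opt_core r p e (adj P ** Q) $ a $ i) \<le> 1 / \<mu>" for a i
  proof -
    have "\<mu> \<le> r * p a + e i" using e [of i] p(1) [of a] r by (simp add: add_increasing)
    hence "p a / (r * p a + e i) \<le> 1 / \<mu>" using p [of a] \<mu> by (intro frac_le) auto
    moreover have "0 \<le> p a / (r * p a + e i)" using p(1) [of a] \<mu> e [of i] r by simp
    moreover have "norm ((adj P ** Q) $ a $ i) \<le> 1"
      using U by (intro norm_unitary_entry_le unitary_mult unitary_adj)
    ultimately have "p a / (r * p a + e i) * norm ((adj P ** Q) $ a $ i) \<le> 1 / \<mu> * 1"
      using \<mu> by (intro mult_mono) auto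
    thus ?thesis
      unfolding opt_core_def vec_lambda_beta norm_mult norm_of_real
        abs_of_nonneg [OF \<open>0 \<le> p a / (r * p a + e i)\<close>] by simp
  qed
  have "norm (opt_W p e P Q r $ i $ j) \<le> real CARD('n) * (real CARD('n) * 1 * (1 / \<mu>)) * 1"
    unfolding opt_W_def
    by (intro norm_mult_entry_le norm_unitary_entry_le c unitary_adj U)
  thus ?thesis by (simp add: power2_eq_square)
qed

lemma J_abs_le:
  fixes W :: "'n::finite cmat"
  assumes W: "\<And>i j. norm (W $ i $ j) \<le> B" and r: "0 \<le> r" "r \<le> S"
  shows "\<bar>J r W X Y\<bar> \<le> (2 * (real CARD('n))^2 * B + (S + 1) * (real CARD('n))^3 * B\<^sup>2) * (norm X + norm Y)"
proof -
  let ?n = "real CARD('n)"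
  have B: "0 \<le> B" using W norm_ge_zero order_trans by blast
  have W': "norm (adj W $ i $ j) \<le> B" for i j using W by simp
  have 1: "\<bar>rtr (X ** W)\<bar> \<le> ?n * (?n * norm X * B)"
    by (intro rtr_abs_le norm_mult_entry_le norm_matrix_entry_le W)
  have 2: "\<bar>rtr (X ** W ** adj W)\<bar> \<le> ?n * (?n * (?n * norm X * B) * B)"
    by (intro rtr_abs_le norm_mult_entry_le norm_matrix_entry_le W W')
  have 3: "\<bar>rtr (Y ** adj W ** W)\<bar> \<le> ?n * (?n * (?n * norm Y * B) * B)"
    by (intro rtr_abs_le norm_mult_entry_le norm_matrix_entry_le W W')
  have "\<bar>J r W X Y\<bar> \<le> 2 * \<bar>rtr (X ** W)\<bar> + r * \<bar>rtr (X ** W ** adj W)\<bar> + \<bar>rtr (Y ** adj W ** W)\<bar>"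
    using abs_triangle_ineq4 [of "2 * rtr (X ** W) - r * rtr (X ** W ** adj W)" "rtr (Y ** adj W ** W)"]
      abs_triangle_ineq4 [of "2 * rtr (X ** W)" "r * rtr (X ** W ** adj W)"] r
    unfolding J_def abs_mult by simp
  also have "\<dots> \<le> 2 * (?n * (?n * norm X * B)) + S * (?n * (?n * (?n * norm X * B) * B))
      + ?n * (?n * (?n * norm Y * B) * B)"
    using r 1 2 3 by (intro add_mono mult_mono) auto
  \<comment> \<open>The mixed terms added here are nonnegative; with them the bound factors through
    \<open>norm X + norm Y\<close>.\<close>
  also have "\<dots> \<le> 2 * (?n * (?n * norm X * B)) + S * (?n * (?n * (?n * norm X * B) * B))
      + ?n * (?n * (?n * norm Y * B) * B)
      + (2 * (?n * (?n * norm Y * B)) + S * (?n * (?n * (?n * norm Y * B) * B))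
      + ?n * (?n * (?n * norm X * B) * B))"
  proof -
    have "0 \<le> 2 * (?n * (?n * norm Y * B)) + S * (?n * (?n * (?n * norm Y * B) * B))
      + ?n * (?n * (?n * norm X * B) * B)"
      using B r by (intro add_nonneg_nonneg mult_nonneg_nonneg) auto
    thus ?thesis by linarith
  qed
  also have "\<dots> = (2 * ?n^2 * B + (S + 1) * ?n^3 * B\<^sup>2) * (norm X + norm Y)"
    by (simp add: algebra_simps power2_eq_square power3_eq_cube)
  finally show ?thesis .
qed

text \<open>Serves only to make the truncated entropy continuous in time, so crude entrywise
  estimates suffice. What matters is that the constant depends on the base states only through
  \<open>\<mu>\<close>.\<close>

lemma trunc_deriv_bound:
  fixes S \<mu> :: real
  assumes "0 \<le> S" "0 < \<mu>"
  obtains C where "\<And>P Q p e X Y. unitary P \<Longrightarrow> unitary (Q :: 'n::finite cmat) \<Longrightarrow>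
     (\<And>i. 0 \<le> p i \<and> p i \<le> 1) \<Longrightarrow> (\<And>i. \<mu> \<le> e i) \<Longrightarrow>
     \<bar>trunc_deriv S p e P Q X Y\<bar> \<le> C * (norm X + norm Y)"
proof -
  let ?B = "(real CARD('n))\<^sup>2 / \<mu>"
  let ?C = "2 * (real CARD('n))^2 * ?B + (S + 1) * (real CARD('n))^3 * ?B\<^sup>2"
  show thesis
  proof (rule that [of "S * ?C"])
    fix P Q :: "'n cmat" and p e :: "'n \<Rightarrow> real" and X Y
    assume U: "unitary P" "unitary Q" and p: "\<And>i. 0 \<le> p i \<and> p i \<le> 1" and e: "\<And>i. \<mu> \<le> e i"
    have int: "(\<lambda>r. J r (opt_W p e P Q r) X Y) integrable_on {0..S}"
      using p e assms by (intro integrable_J_opt_W) (auto intro: less_le_trans)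
    have "\<bar>J r (opt_W p e P Q r) X Y\<bar> \<le> ?C * (norm X + norm Y)" if "r \<in> {0..S}" for r
      using that p e assms by (intro J_abs_le opt_W_entry_le U) auto
    hence "norm (integral {0..S} (\<lambda>r. J r (opt_W p e P Q r) X Y)) \<le> integral {0..S} (\<lambda>r. ?C * (norm X + norm Y))"
      by (intro integral_norm_bound_integral int) auto
    moreover have "integral {0..S} (\<lambda>r. z) = S * z" for z :: real using assms by simp
    ultimately show "\<bar>trunc_deriv S p e P Q X Y\<bar> \<le> S * ?C * (norm X + norm Y)"
      by (simp only: trunc_deriv_def real_norm_def mult.assoc)
  qed
qed

section \<open>Perturbing the reference state by a commutator\<close>

text \<open>The logarithm of (S p + a)/(S p + b) is at most (a - b)/(S p + b), hence at most 1/(S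
  p); the prefactor \<open>p\<close> removes the singularity at 0. This is the truncation error when
  the reference state is perturbed.\<close>

lemma ln_shift_diff_le:
  fixes p S e e' :: real
  assumes "0 \<le> p" "0 < S" "0 < e" "e \<le> 1" "0 < e'" "e' \<le> 1"
  shows "p * \<bar>ln (S * p + e) - ln (S * p + e')\<bar> \<le> 1 / S"
proof (cases "p = 0")
  case False
  hence p: "0 < p" using assms by simp
  have *: "ln (S * p + a) - ln (S * p + b) \<le> 1 / (S * p)"
    if "0 < a" "a \<le> 1" "0 < b" "b \<le> 1" for a b :: real
  proof -
    have pos: "S * p + a > 0" "S * p + b > 0" using assms p that by (auto intro: add_pos_pos)
    have "ln (S * p + a) - ln (S * p + b) = ln ((S * p + a) / (S * p + b))"
      using pos by (simp add: ln_div)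
    also have "\<dots> \<le> (S * p + a) / (S * p + b) - 1" using pos by (intro ln_le_minus_one) simp
    also have "\<dots> = (a - b) / (S * p + b)" using pos by (simp add: field_simps)
    also have "\<dots> \<le> 1 / (S * p)" using assms p that pos by (intro frac_le) auto
    finally show ?thesis .
  qed
  have "\<bar>ln (S * p + e) - ln (S * p + e')\<bar> \<le> 1 / (S * p)"
    using * [of e e'] * [of e' e] assms by (intro abs_leI) auto
  hence "p * \<bar>ln (S * p + e) - ln (S * p + e')\<bar> \<le> p * (1 / (S * p))"
    using p by (intro mult_left_mono) auto
  also have "\<dots> = 1 / S" using p by simp
  finally show ?thesis .
qed (use assms in simp)

lemma Re_of_real_mult: "Re (complex_of_real r * z) = r * Re z"
  by simp

text \<open>The coefficient shared by \<open>J_commutator\<close> and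
  \<open>rtr_commutator_log\<close>, which allows these two sums to be compared term by
  term.\<close>

definition comm_coeff :: "'n::finite cmat \<Rightarrow> 'n cmat \<Rightarrow> 'n \<Rightarrow> 'n \<Rightarrow> 'n \<Rightarrow> real" where
  "comm_coeff U v a i j = Re (\<i> * v $ i $ j * (cnj (U $ a $ j) * U $ a $ i))"

lemma rtr_unitary_conj:
  assumes "unitary Q"
  shows "rtr (X ** Y) = rtr ((adj Q ** X ** Q) ** (adj Q ** Y ** Q))"
proof -
  have "rtr (X ** Y) = rtr (Q ** (adj Q ** X ** Y))"
    using assms by (simp add: matrix_mul_assoc [symmetric] unitary_cancel)
  also have "\<dots> = rtr ((adj Q ** X ** Y) ** Q)" by (rule rtr_commute)
  finally show ?thesis
    using assms by (simp add: matrix_mul_assoc [symmetric] unitary_cancel)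
qed

text \<open>The assumption on \<open>Y\<close> is shaped for two uses: \<open>Y = adj W ** W\<close>
  with \<open>W\<close> optimal, and \<open>Y\<close> the first state itself with
  \<open>op_log \<sigma>\<close> in the role of \<open>\<sigma>\<close>.\<close>

lemma rtr_commutator_spec:
  assumes Q: "spec \<sigma> Q e"
    and Y: "\<And>i j. (adj Q ** Y ** Q) $ j $ i = (\<Sum>a\<in>UNIV. complex_of_real (g a i j) * (cnj (U $ a $ j) * U $ a $ i))"
  shows "rtr (mat \<i> ** commutator V \<sigma> ** Y)
    = (\<Sum>i\<in>UNIV. \<Sum>j\<in>UNIV. \<Sum>a\<in>UNIV. comm_coeff U (adj Q ** V ** Q) a i j * (g a i j * (e j - e i)))"
proof -
  let ?v = "adj Q ** V ** Q"
  have U: "unitary Q" using Q by (simp add: spec_def)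
  have "adj Q ** (mat \<i> ** commutator V \<sigma>) ** Q = mat \<i> ** (adj Q ** commutator V \<sigma> ** Q)"
    by (simp only: matrix_mul_assoc mat_commute)
  moreover have "adj Q ** commutator V \<sigma> ** Q = ?v ** (adj Q ** \<sigma> ** Q) - (adj Q ** \<sigma> ** Q) ** ?v"
    using U by (simp add: commutator_def matrix_distribs matrix_mul_assoc [symmetric] unitary_cancel)
  ultimately have v: "adj Q ** (mat \<i> ** commutator V \<sigma>) ** Q = mat \<i> ** (?v ** diagm e - diagm e ** ?v)"
    by (simp only: spec_conj [OF Q])
  show ?thesis
    unfolding rtr_unitary_conj [OF U, of _ Y] v
    unfolding rtr_eq_sum mat_mult_nth vector_minus_component
      mult_diagm_nth diagm_mult_nth Y sum_distrib_left Re_sum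
  proof (intro sum.cong refl)
    fix i j a
    have "\<i> * (complex_of_real (e j) * ?v $ i $ j - complex_of_real (e i) * ?v $ i $ j)
          * (complex_of_real (g a i j) * (cnj (U $ a $ j) * U $ a $ i))
        = complex_of_real (g a i j * (e j - e i)) * (\<i> * ?v $ i $ j * (cnj (U $ a $ j) * U $ a $ i))"
      unfolding of_real_mult of_real_diff
      by (simp only: left_diff_distrib right_diff_distrib) (simp only: mult_ac)
    thus "Re (\<i> * (complex_of_real (e j) * ?v $ i $ j - complex_of_real (e i) * ?v $ i $ j)
          * (complex_of_real (g a i j) * (cnj (U $ a $ j) * U $ a $ i)))
        = comm_coeff U ?v a i j * (g a i j * (e j - e i))"
      by (simp only: Re_of_real_mult comm_coeff_def mult.commute)
  qed
qed

lemma J_commutator: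
  assumes Q: "spec \<sigma> Q e" and P: "unitary P" and p: "\<And>i. 0 \<le> p i" and e: "\<And>i. 0 < e i" and r: "0 \<le> r"
  shows "J r (opt_W p e P Q r) 0 (mat \<i> ** commutator V \<sigma>)
    = (\<Sum>i\<in>UNIV. \<Sum>j\<in>UNIV. \<Sum>a\<in>UNIV. comm_coeff (adj P ** Q) (adj Q ** V ** Q) a i j *
        ((p a)\<^sup>2 / (r * p a + e j) - (p a)\<^sup>2 / (r * p a + e i)))"
proof -
  let ?U = "adj P ** Q" and ?c = "opt_core r p e (adj P ** Q)" and ?W = "opt_W p e P Q r"
  let ?g = "\<lambda>a i j. p a / (r * p a + e j) * (p a / (r * p a + e i))"
  have "unitary Q" using Q by (simp add: spec_def)
  hence "adj Q ** (adj ?W ** ?W) ** Q = adj ?c ** ?c"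
    using P by (simp add: opt_W_def adj_mult matrix_mul_assoc [symmetric] unitary_cancel) (simp add: unitary_def)
  hence "(adj Q ** (adj ?W ** ?W) ** Q) $ j $ i
      = (\<Sum>a\<in>UNIV. complex_of_real (?g a i j) * (cnj (?U $ a $ j) * ?U $ a $ i))" for i j
    unfolding matrix_matrix_mult_def [of "adj ?c"] by (simp add: opt_core_def mult_ac)
  from rtr_commutator_spec [OF Q this, of V]
  have J: "J r ?W 0 (mat \<i> ** commutator V \<sigma>) = - (\<Sum>i\<in>UNIV. \<Sum>j\<in>UNIV. \<Sum>a\<in>UNIV.
      comm_coeff ?U (adj Q ** V ** Q) a i j * (?g a i j * (e j - e i)))"
    by (simp only: J_def matrix_mul_assoc) simp
  \<comment> \<open>Partial fractions: the product of two resolvents becomes a difference of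
    resolvents, whose integral is logarithmic.\<close>
  have g: "?g a i j * (e j - e i) = - ((p a)\<^sup>2 / (r * p a + e j) - (p a)\<^sup>2 / (r * p a + e i))" for a i j
  proof -
    have "r * p a + e j > 0" "r * p a + e i > 0" using p e r by (auto intro: add_nonneg_pos)
    thus ?thesis
      by (simp add: diff_frac_eq divide_simps power2_eq_square) (simp add: algebra_simps)
  qed
  show ?thesis unfolding J by (simp only: g mult_minus_right sum_negf minus_minus)
qed

lemma rtr_commutator_log:
  assumes P: "spec \<rho> P p" and Q: "spec \<sigma> Q e"
  shows "rtr (\<rho> ** (mat \<i> ** commutator (op_log \<sigma>) V))
    = (\<Sum>i\<in>UNIV. \<Sum>j\<in>UNIV. \<Sum>a\<in>UNIV. comm_coeff (adj P ** Q) (adj Q ** V ** Q) a i j *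
        (p a * (ln (e i) - ln (e j))))"
proof -
  let ?U = "adj P ** Q"
  have "adj Q ** \<rho> ** Q = adj ?U ** (diagm p ** ?U)"
    using P by (simp add: spec_def adj_mult matrix_mul_assoc)
  hence "(adj Q ** \<rho> ** Q) $ j $ i
      = (\<Sum>a\<in>UNIV. complex_of_real (p a) * (cnj (?U $ a $ j) * ?U $ a $ i))" for i j
    by (simp add: matrix_matrix_mult_def [of "adj ?U"] diagm_mult_nth mult_ac)
  from rtr_commutator_spec [OF spec_op_log [OF Q] this]
  have "rtr (mat \<i> ** commutator V (op_log \<sigma>) ** \<rho>)
    = (\<Sum>i\<in>UNIV. \<Sum>j\<in>UNIV. \<Sum>a\<in>UNIV. comm_coeff ?U (adj Q ** V ** Q) a i j * (p a * (ln (e j) - ln (e i))))" .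
  moreover have "mat \<i> ** commutator (op_log \<sigma>) V = 0 - mat \<i> ** commutator V (op_log \<sigma>)"
    by (simp add: vec_eq_iff commutator_def algebra_simps)
  hence "rtr (\<rho> ** (mat \<i> ** commutator (op_log \<sigma>) V)) = - rtr (mat \<i> ** commutator V (op_log \<sigma>) ** \<rho>)"
    by (simp only: rtr_commute [of \<rho>] matrix_diff_rdistrib rtr_diff times0_left rtr_zero)
  ultimately show ?thesis by (simp add: sum_negf [symmetric] algebra_simps)
qed

text \<open>Integration of \<open>J_commutator\<close> yields differences of p (ln (S p + e) - ln
  e). The parts with ln e reassemble to the expectation of the commutator with
  \<open>op_log \<sigma>\<close>; the parts with ln (S p + e) are the truncation error. In the fifth
  power, three factors come from the three index sums and two from conjugating \<open>V\<close> by a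
  unitary.\<close>

lemma trunc_deriv_commutator_le:
  fixes \<rho> :: "'n::finite cmat"
  assumes P: "spec \<rho> P p" and Q: "spec \<sigma> Q e" and p: "\<And>i. 0 \<le> p i"
    and e: "\<And>i. 0 < e i" "\<And>i. e i \<le> 1" and S: "0 < S"
  shows "trunc_deriv S p e P Q 0 (mat \<i> ** commutator V \<sigma>)
    \<le> rtr (\<rho> ** (mat \<i> ** commutator (op_log \<sigma>) V)) + (real CARD('n))^5 * norm V / S"
proof -
  let ?U = "adj P ** Q" and ?v = "adj Q ** V ** Q"
  have U: "unitary P" "unitary Q" using P Q by (auto simp: spec_def)
  let ?g = "\<lambda>a i. p a * (ln (S * p a + e i) - ln (e i))"
  have "((\<lambda>r. J r (opt_W p e P Q r) 0 (mat \<i> ** commutator V \<sigma>)) has_integral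
      (\<Sum>i\<in>UNIV. \<Sum>j\<in>UNIV. \<Sum>a\<in>UNIV. comm_coeff ?U ?v a i j * (?g a j - ?g a i))) {0..S}"
  proof (rule has_integral_eq)
    show "((\<lambda>r. \<Sum>i\<in>UNIV. \<Sum>j\<in>UNIV. \<Sum>a\<in>UNIV. comm_coeff ?U ?v a i j *
        ((p a)\<^sup>2 / (r * p a + e j) - (p a)\<^sup>2 / (r * p a + e i))) has_integral
      (\<Sum>i\<in>UNIV. \<Sum>j\<in>UNIV. \<Sum>a\<in>UNIV. comm_coeff ?U ?v a i j * (?g a j - ?g a i))) {0..S}"
      using S by (intro has_integral_sum has_integral_mult_right has_integral_diff has_integral_resolvent p e) simp_all
  qed (use J_commutator [OF Q U(1) p e(1)] in simp)
  hence "trunc_deriv S p e P Q 0 (mat \<i> ** commutator V \<sigma>)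
      = (\<Sum>i\<in>UNIV. \<Sum>j\<in>UNIV. \<Sum>a\<in>UNIV. comm_coeff ?U ?v a i j * (?g a j - ?g a i))"
    unfolding trunc_deriv_def by (rule integral_unique)
  also have "\<dots> = rtr (\<rho> ** (mat \<i> ** commutator (op_log \<sigma>) V)) +
      (\<Sum>i\<in>UNIV. \<Sum>j\<in>UNIV. \<Sum>a\<in>UNIV. comm_coeff ?U ?v a i j * (p a * (ln (S * p a + e j) - ln (S * p a + e i))))"
    unfolding rtr_commutator_log [OF P Q] sum.distrib [symmetric]
    by (intro sum.cong refl) (simp add: algebra_simps)
  also have "(\<Sum>i\<in>UNIV. \<Sum>j\<in>UNIV. \<Sum>a\<in>UNIV. comm_coeff ?U ?v a i j * (p a * (ln (S * p a + e j) - ln (S * p a + e i))))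
     \<le> (\<Sum>i\<in>(UNIV :: 'n set). \<Sum>j\<in>(UNIV :: 'n set). \<Sum>a\<in>(UNIV :: 'n set). (real CARD('n))^2 * norm V * (1 / S))"
  proof (intro sum_mono)
    fix i j a
    have "norm (?v $ i $ j) \<le> real CARD('n) * (real CARD('n) * 1 * norm V) * 1"
      by (intro norm_mult_entry_le norm_unitary_entry_le norm_matrix_entry_le unitary_adj U)
    moreover have "norm (?U $ a $ k) \<le> 1" for k
      by (intro norm_unitary_entry_le unitary_mult unitary_adj U)
    hence "norm (?v $ i $ j) * (norm (?U $ a $ j) * norm (?U $ a $ i)) \<le> norm (?v $ i $ j) * 1"
      by (intro mult_left_mono mult_le_one) auto
    moreover have "\<bar>comm_coeff ?U ?v a i j\<bar> \<le> norm (?v $ i $ j) * (norm (?U $ a $ j) * norm (?U $ a $ i))"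
      unfolding comm_coeff_def by (rule order_trans [OF abs_Re_le_cmod]) (simp add: norm_mult)
    ultimately have c: "\<bar>comm_coeff ?U ?v a i j\<bar> \<le> (real CARD('n))^2 * norm V"
      by (simp add: power2_eq_square)
    have "comm_coeff ?U ?v a i j * (p a * (ln (S * p a + e j) - ln (S * p a + e i)))
        \<le> \<bar>comm_coeff ?U ?v a i j\<bar> * (p a * \<bar>ln (S * p a + e j) - ln (S * p a + e i)\<bar>)"
      using p [of a] by (metis abs_ge_self abs_mult abs_of_nonneg)
    also have "\<dots> \<le> (real CARD('n))^2 * norm V * (1 / S)"
      using c p e S by (intro mult_mono ln_shift_diff_le) auto
    finally show "comm_coeff ?U ?v a i j * (p a * (ln (S * p a + e j) - ln (S * p a + e i)))
        \<le> (real CARD('n))^2 * norm V * (1 / S)" .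
  qed
  finally show ?thesis by (simp add: power_numeral_reduce mult_ac)
qed

section \<open>The Gibbs variational inequality\<close>

definition mpow :: "'n::finite cmat \<Rightarrow> nat \<Rightarrow> 'n cmat" where
  "mpow X k = ((**) X ^^ k) (mat 1)"

lemma mpow_0 [simp]: "mpow X 0 = mat 1" and mpow_Suc: "mpow X (Suc k) = X ** mpow X k"
  by (simp_all add: mpow_def)

lemma spec_mpow:
  assumes X: "spec X R x"
  shows "spec (mpow X k) R (\<lambda>j. x j ^ k)"
proof (induction k)
  case 0
  have "diagm (\<lambda>_. 1) = (mat 1 :: 'a cmat)" by (simp add: diagm_def mat_def vec_eq_iff)
  thus ?case using X by (simp add: spec_def unitary_def)
next
  case (Suc k)
  have "mpow X (Suc k) = R ** (diagm x ** diagm (\<lambda>j. x j ^ k)) ** adj R"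
    using X Suc by (simp add: mpow_Suc spec_def matrix_mul_assoc [symmetric] unitary_cancel)
  thus ?case using X by (simp add: spec_def diagm_mult_diagm)
qed

lemma rtr_mult_spec:
  assumes Y: "spec Y R y"
  shows "rtr (\<rho> ** Y) = (\<Sum>j\<in>UNIV. Re ((adj R ** \<rho> ** R) $ j $ j) * y j)"
proof -
  have "rtr (\<rho> ** Y) = rtr ((\<rho> ** R ** diagm y) ** adj R)"
    using Y by (simp add: spec_def matrix_mul_assoc)
  also have "\<dots> = rtr (adj R ** (\<rho> ** R ** diagm y))" by (rule rtr_commute)
  also have "\<dots> = rtr ((adj R ** \<rho> ** R) ** diagm y)" by (simp add: matrix_mul_assoc)
  also have "\<dots> = (\<Sum>j\<in>UNIV. Re ((adj R ** \<rho> ** R) $ j $ j) * y j)"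
    unfolding rtr_def trace_def Re_sum mult_diagm_nth by (simp add: mult.commute)
  finally show ?thesis .
qed

lemma conj_diagonal_entry:
  "Re ((adj R ** \<rho> ** R) $ j $ j) = (R *v axis j 1) \<bullet> (\<rho> *v (R *v axis j 1))"
proof -
  have "Re ((adj R ** \<rho> ** R) $ j $ j) = axis j 1 \<bullet> ((adj R ** \<rho> ** R) *v axis j 1)"
    unfolding matrix_vector_mul_component inner_axis' inner_complex_def
    by (simp add: matrix_vector_mult_def axis_def if_distrib [of "\<lambda>z. _ * z"] inner_axis' inner_complex_def cong: if_cong)
  also have "\<dots> = (R *v axis j 1) \<bullet> (\<rho> *v (R *v axis j 1))"
    by (simp add: matrix_vector_mul_assoc [symmetric] inner_adj [of _ "adj R"])
  finally show ?thesis .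
qed

text \<open>The two scalar integrands that \<open>J\<close> produces for the test operator y / (r y
  + 1): the first is weighted by the state, the second by the reference state.\<close>

lemma has_integral_gibbs:
  fixes y S :: real
  assumes "0 < y" "0 \<le> S"
  shows "((\<lambda>r. 2 * (y / (r * y + 1)) - r * (y / (r * y + 1))\<^sup>2) has_integral
          (ln (S * y + 1) + (1 - 1 / (S * y + 1)))) {0..S}"
    and "((\<lambda>r. (y / (r * y + 1))\<^sup>2) has_integral y * (1 - 1 / (S * y + 1))) {0..S}"
proof -
  have pos: "r * y + 1 > 0" if "r \<in> {0..S}" for r using assms that by (simp add: add_nonneg_pos)
  have 2: "((\<lambda>r. - y * (1 / (r * y + 1))) has_vector_derivative (y / (r * y + 1))\<^sup>2) (at r within {0..S})"
    if "r \<in> {0..S}" for r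
    unfolding has_real_derivative_iff_has_vector_derivative [symmetric]
    using pos [OF that]
    by (auto intro!: derivative_eq_intros simp: power2_eq_square divide_simps)
  from fundamental_theorem_of_calculus [OF assms(2) 2]
  show "((\<lambda>r. (y / (r * y + 1))\<^sup>2) has_integral y * (1 - 1 / (S * y + 1))) {0..S}"
    by (simp add: algebra_simps)
  have A: "((\<lambda>r. ln (r * y + 1) - 1 / (r * y + 1)) has_vector_derivative
      (y / (r * y + 1) + y / (r * y + 1)\<^sup>2)) (at r within {0..S})"
    if "r \<in> {0..S}" for r
    unfolding has_real_derivative_iff_has_vector_derivative [symmetric]
    using pos [OF that]
    by (auto intro!: derivative_eq_intros simp: power2_eq_square)
  have B: "y / (r * y + 1) + y / (r * y + 1)\<^sup>2 = 2 * (y / (r * y + 1)) - r * (y / (r * y + 1))\<^sup>2"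
    if "r \<in> {0..S}" for r
    using pos [OF that] by (simp add: power2_eq_square divide_simps) (simp add: algebra_simps)
  have "((\<lambda>r. ln (r * y + 1) - 1 / (r * y + 1)) has_vector_derivative
      (2 * (y / (r * y + 1)) - r * (y / (r * y + 1))\<^sup>2)) (at r within {0..S})"
    if "r \<in> {0..S}" for r using A [OF that] unfolding B [OF that] .
  from fundamental_theorem_of_calculus [OF assms(2) this]
  show "((\<lambda>r. 2 * (y / (r * y + 1)) - r * (y / (r * y + 1))\<^sup>2) has_integral
          (ln (S * y + 1) + (1 - 1 / (S * y + 1)))) {0..S}"
    by (simp add: algebra_simps)
qed

text \<open>Testing the supremum with \<open>W = y / (r y + 1)\<close>, \<open>y = exp (q X) / Z\<close>, replaces the
  Golden--Thompson inequality.\<close>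

lemma gibbs_variational:
  fixes \<rho> \<sigma> X :: "'n::finite cmat"
  assumes \<rho>: "\<rho> \<in> density_ops" and \<sigma>: "\<sigma> \<in> density_ops" "pos_def \<sigma>" and X: "self_adjoint X"
    and Z: "(\<lambda>k. q ^ k / fact k * rtr (\<sigma> ** mpow X k)) sums Z"
    and d: "rel_entropy \<rho> \<sigma> = ereal d"
  shows "0 < Z" and "q * rtr (\<rho> ** X) \<le> d + ln Z"
proof -
  obtain R x where R: "spec X R x" using spec_exists [OF X] by blast
  have U: "unitary R" using R by (simp add: spec_def)
  have one: "spec (mat 1) R (\<lambda>_. 1)" using spec_mpow [OF R, of 0] by simp
  define rr where "rr j = Re ((adj R ** \<rho> ** R) $ j $ j)" for j
  define ss where "ss j = Re ((adj R ** \<sigma> ** R) $ j $ j)" for j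
  have rr: "0 \<le> rr j" for j
    unfolding rr_def conj_diagonal_entry using density_pos_semidef [OF \<rho>] by (simp add: pos_semidef_def)
  have ss: "0 < ss j" for j
    unfolding ss_def conj_diagonal_entry
    using \<sigma>(2) unitary_axis_nonzero [OF U] by (simp add: pos_def_def)
  have srr: "sum rr UNIV = 1" and sss: "sum ss UNIV = 1"
    using rtr_mult_spec [OF one, of \<rho>] rtr_mult_spec [OF one, of \<sigma>] density_rtr [OF \<rho>] density_rtr [OF \<sigma>(1)]
    by (simp_all add: rr_def ss_def)
  have "(\<lambda>k. \<Sum>j\<in>UNIV. ss j * ((q * x j) ^ k /\<^sub>R fact k)) sums (\<Sum>j\<in>UNIV. ss j * exp (q * x j))"
    by (intro sums_sum sums_mult exp_converges)
  moreover have "(\<Sum>j\<in>UNIV. ss j * ((q * x j) ^ k /\<^sub>R fact k)) = q ^ k / fact k * rtr (\<sigma> ** mpow X k)" for k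
    unfolding rtr_mult_spec [OF spec_mpow [OF R]] ss_def [symmetric] sum_distrib_left
    by (intro sum.cong refl) (simp add: power_mult_distrib divide_inverse)
  \<comment> \<open>The moment series is thereby identified with the trace of the reference state
    against the exponential of \<open>q *\<^sub>R X\<close>, without introducing a matrix
    exponential.\<close>
  ultimately have Zeq: "Z = (\<Sum>j\<in>UNIV. ss j * exp (q * x j))"
    using Z by (simp add: sums_unique2)
  have Zpos: "0 < Z" unfolding Zeq using ss by (intro sum_pos) auto
  define y where "y j = exp (q * x j) / Z" for j
  have y: "0 < y j" for j using Zpos by (simp add: y_def)
  have sy: "(\<Sum>j\<in>UNIV. ss j * y j) = 1"
    using Zpos by (simp add: y_def sum_divide_distrib [symmetric] Zeq [symmetric])
  let ?I = "\<lambda>S. \<Sum>j\<in>UNIV. rr j * (ln (S * y j + 1) + (1 - 1 / (S * y j + 1))) - ss j * (y j * (1 - 1 / (S * y j + 1)))"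
  have bound: "?I S - ln (1 + S) \<le> d" if S: "0 < S" for S
  proof -
    obtain P p Q e where P: "spec \<rho> P p" and Q: "spec \<sigma> Q e"
      using density_spec [OF \<rho>] density_spec [OF \<sigma>(1)] by metis
    note te = trunc_entropy_eq [OF density_pos_semidef [OF \<rho>] \<sigma>(2) P Q less_imp_le [OF S]]
    let ?w = "\<lambda>r j. y j / (r * y j + 1)"
    let ?W = "\<lambda>r. R ** diagm (?w r) ** adj R"
    have J: "J r (?W r) \<rho> \<sigma> = (\<Sum>j\<in>UNIV. rr j * (2 * ?w r j - r * (?w r j)\<^sup>2) - ss j * (?w r j)\<^sup>2)" for r
    proof -
      have W: "spec (?W r) R (?w r)" using U by (simp add: spec_def)
      have WW: "spec (?W r ** ?W r) R (\<lambda>j. (?w r j)\<^sup>2)"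
        using U by (simp add: spec_def matrix_mul_assoc [symmetric] unitary_cancel)
           (simp add: matrix_mul_assoc diagm_mult_diagm power2_eq_square)
      have a: "adj (?W r) = ?W r" using spec_self_adjoint [OF W] by (simp add: self_adjoint_def)
      have "J r (?W r) \<rho> \<sigma> = 2 * rtr (\<rho> ** ?W r) - r * rtr (\<rho> ** (?W r ** ?W r)) - rtr (\<sigma> ** (?W r ** ?W r))"
        unfolding J_def a by (simp only: matrix_mul_assoc)
      also have "\<dots> = (\<Sum>j\<in>UNIV. rr j * (2 * ?w r j - r * (?w r j)\<^sup>2) - ss j * (?w r j)\<^sup>2)"
        unfolding rtr_mult_spec [OF W] rtr_mult_spec [OF WW] rr_def [symmetric] ss_def [symmetric]
          sum_distrib_left sum_subtractf [symmetric]
        by (intro sum.cong refl) (simp add: algebra_simps)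
      finally show ?thesis .
    qed
    have i: "((\<lambda>r. J r (?W r) \<rho> \<sigma>) has_integral ?I S) {0..S}"
      unfolding J using S by (intro has_integral_sum has_integral_diff has_integral_mult_right has_integral_gibbs y) auto
    have "?I S \<le> ns_trunc S p e (adj P ** Q) + ln (1 + S)"
    proof (rule has_integral_le [OF i te(1)])
      fix r assume "r \<in> {0..S}"
      hence r: "0 \<le> r" by simp
      have "optimal r (opt_W p e P Q r) \<rho> \<sigma>"
        using pos_semidef_spec [OF density_pos_semidef [OF \<rho>] P] pos_def_spec [OF \<sigma>(2) Q] r
        by (intro optimal_opt_W P Q) auto
      thus "J r (?W r) \<rho> \<sigma> \<le> (SUP W. J r W \<rho> \<sigma>)"
        unfolding SUP_J_eq(1) [OF density_pos_semidef [OF \<rho>] \<sigma>(2) P Q r]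
        using r by (intro J_le_optimal density_pos_semidef \<rho> pos_def_imp_pos_semidef \<sigma>)
    qed
    moreover obtain d' where "rel_entropy \<rho> \<sigma> = ereal d'" "trunc_entropy S \<rho> \<sigma> \<le> d'"
      using rel_entropy_trunc [OF \<rho> \<sigma> S] by blast
    ultimately show ?thesis using te(2) d by simp
  qed
  \<comment> \<open>In the limit the boundary terms leave + 1 from the state and - 1 from the
    reference state; they cancel because \<open>y\<close> is normalised by
    \<open>sy\<close>.\<close>
  have "((\<lambda>S. ?I S - ln (1 + S)) \<longlongrightarrow>
      (\<Sum>j\<in>UNIV. rr j * (ln (y j) + 1) - ss j * (y j * 1))) at_top"
  proof -
    have l: "((\<lambda>S. ln (S * y j + 1) - ln (1 + S)) \<longlongrightarrow> ln (y j)) at_top"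
      and z: "((\<lambda>S. 1 / (S * y j + 1)) \<longlongrightarrow> 0) at_top" for j
      using y [of j] by real_asymp+
    have "?I S - ln (1 + S) = (\<Sum>j\<in>UNIV. rr j * ((ln (S * y j + 1) - ln (1 + S)) + (1 - 1 / (S * y j + 1)))
        - ss j * (y j * (1 - 1 / (S * y j + 1))))" for S
    proof -
      have "ln (1 + S) = (\<Sum>j\<in>UNIV. rr j * ln (1 + S))" by (simp add: sum_distrib_right [symmetric] srr)
      hence "?I S - ln (1 + S) = (\<Sum>j\<in>UNIV. rr j * (ln (S * y j + 1) + (1 - 1 / (S * y j + 1)))
          - ss j * (y j * (1 - 1 / (S * y j + 1))) - rr j * ln (1 + S))"
        unfolding sum_subtractf [of _ "\<lambda>j. rr j * ln (1 + S)"] by simp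
      thus ?thesis by (simp only: left_diff_distrib right_diff_distrib distrib_left) (simp add: algebra_simps)
    qed
    moreover have "((\<lambda>S. \<Sum>j\<in>UNIV. rr j * ((ln (S * y j + 1) - ln (1 + S)) + (1 - 1 / (S * y j + 1)))
        - ss j * (y j * (1 - 1 / (S * y j + 1))))
      \<longlongrightarrow> (\<Sum>j\<in>UNIV. rr j * (ln (y j) + (1 - 0)) - ss j * (y j * (1 - 0)))) at_top"
      by (intro tendsto_intros l z)
    ultimately show ?thesis by simp
  qed
  hence "(\<Sum>j\<in>UNIV. rr j * (ln (y j) + 1) - ss j * (y j * 1)) \<le> d"
    by (rule tendsto_upperbound) (use bound in \<open>auto intro: eventually_at_top_linorderI [of 1]\<close>)
  moreover have "(\<Sum>j\<in>UNIV. rr j * (ln (y j) + 1) - ss j * (y j * 1)) = q * rtr (\<rho> ** X) - ln Z"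
  proof -
    have lny: "ln (y j) = q * x j - ln Z" for j using Zpos by (simp add: y_def ln_div)
    have "(\<Sum>j\<in>UNIV. rr j * (ln (y j) + 1) - ss j * (y j * 1))
       = (\<Sum>j\<in>UNIV. q * (rr j * x j) - rr j * ln Z + rr j - ss j * y j)"
      unfolding lny by (intro sum.cong refl) (simp add: algebra_simps)
    also have "\<dots> = q * (\<Sum>j\<in>UNIV. rr j * x j) - ln Z"
      by (simp add: sum_subtractf sum.distrib sum_distrib_left [symmetric] sum_distrib_right [symmetric] srr sy)
    finally show ?thesis by (simp add: rtr_mult_spec [OF R] rr_def)
  qed
  ultimately show "q * rtr (\<rho> ** X) \<le> d + ln Z" by simp
  show "0 < Z" by (rule Zpos)
qed

section \<open>Operator norm\<close>

lemma op_norm_nonneg: "0 \<le> op_norm X"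
  unfolding op_norm_def by (intro onorm_pos_le) (simp add: linear_linear linear_conv_bounded_linear [symmetric])

lemma norm_matrix_vector_le: "norm (X *v v) \<le> op_norm X * norm v"
  unfolding op_norm_def by (intro onorm) (simp add: linear_conv_bounded_linear [symmetric])

lemma op_norm_leI: "(\<And>v. norm (X *v v) \<le> c * norm v) \<Longrightarrow> op_norm X \<le> c"
  unfolding op_norm_def by (rule onorm_le)

lemma op_norm_mult: "op_norm (X ** Y) \<le> op_norm X * op_norm Y"
proof (rule op_norm_leI)
  fix v
  have "norm ((X ** Y) *v v) \<le> op_norm X * norm (Y *v v)"
    unfolding matrix_vector_mul_assoc [symmetric] by (rule norm_matrix_vector_le)
  also have "\<dots> \<le> op_norm X * (op_norm Y * norm v)"
    by (intro mult_left_mono norm_matrix_vector_le op_norm_nonneg)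
  finally show "norm ((X ** Y) *v v) \<le> op_norm X * op_norm Y * norm v" by (simp add: mult.assoc)
qed

lemma op_norm_add: "op_norm (X + Y) \<le> op_norm X + op_norm Y"
  by (rule op_norm_leI)
     (metis (no_types, lifting) add_mono distrib_right matrix_vector_mult_add_rdistrib norm_matrix_vector_le norm_triangle_le)

lemma op_norm_diff: "op_norm (X - Y) \<le> op_norm X + op_norm Y"
proof (rule op_norm_leI)
  fix v
  show "norm ((X - Y) *v v) \<le> (op_norm X + op_norm Y) * norm v"
    unfolding matrix_vector_mult_diff_rdistrib distrib_right
    by (rule order_trans [OF norm_triangle_ineq4 add_mono]) (rule norm_matrix_vector_le)+
qed

lemma op_norm_mat_ii: "op_norm (mat \<i> ** X) \<le> op_norm X"
proof (rule op_norm_leI)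
  fix v
  have "(mat \<i> ** X) *v v = \<i> *s (X *v v)"
    by (simp add: vec_eq_iff matrix_vector_mult_def sum_distrib_left mult.assoc)
  moreover have "norm (\<i> *s w) = norm w" for w :: "complex ^ 'a"
    by (simp add: norm_vec_def norm_mult)
  ultimately show "norm ((mat \<i> ** X) *v v) \<le> op_norm X * norm v"
    using norm_matrix_vector_le [of X v] by simp
qed

lemma op_norm_commutator: "op_norm (mat \<i> ** commutator X Y) \<le> 2 * op_norm X * op_norm Y"
proof -
  have "op_norm (mat \<i> ** commutator X Y) \<le> op_norm (X ** Y) + op_norm (Y ** X)"
    unfolding commutator_def by (rule order_trans [OF op_norm_mat_ii op_norm_diff])
  also have "\<dots> \<le> op_norm X * op_norm Y + op_norm Y * op_norm X"
    by (intro add_mono op_norm_mult)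
  finally show ?thesis by simp
qed

lemma op_norm_spec_le:
  assumes X: "spec X P p" and p: "\<And>i. \<bar>p i\<bar> \<le> c"
  shows "op_norm X \<le> c"
proof (rule op_norm_leI)
  fix v
  have U: "unitary P" using X by (simp add: spec_def)
  have c: "0 \<le> c" using p abs_ge_zero order_trans by blast
  have "norm (X *v v) = norm (diagm p *v (adj P *v v))"
    by (simp add: spec_mult_vec [OF X] norm_unitary [OF U])
  also have "\<dots> \<le> norm (c *\<^sub>R (adj P *v v))"
    unfolding norm_vec_def
    by (intro L2_set_mono) (use p c in \<open>auto simp: diagm_vec_nth norm_mult intro!: mult_right_mono\<close>)
  also have "\<dots> = c * norm v" using c by (simp add: norm_unitary [OF unitary_adj [OF U]])
  finally show "norm (X *v v) \<le> c * norm v" .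
qed

lemma rtr_state_le_op_norm:
  assumes "\<rho> \<in> density_ops"
  shows "\<bar>rtr (\<rho> ** X)\<bar> \<le> op_norm X"
proof -
  obtain P p where P: "spec \<rho> P p" and p: "\<And>i. 0 \<le> p i" and sp: "sum p UNIV = 1"
    using density_spec [OF assms] by blast
  have U: "unitary P" using P by (simp add: spec_def)
  have "rtr (\<rho> ** X) = rtr (X ** \<rho>)" by (rule rtr_commute)
  also have "\<dots> = (\<Sum>j\<in>UNIV. ((P *v axis j 1) \<bullet> (X *v (P *v axis j 1))) * p j)"
    unfolding rtr_mult_spec [OF P] conj_diagonal_entry ..
  finally have "\<bar>rtr (\<rho> ** X)\<bar> \<le> (\<Sum>j\<in>UNIV. \<bar>(P *v axis j 1) \<bullet> (X *v (P *v axis j 1))\<bar> * p j)"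
    using sum_abs [of "\<lambda>j. ((P *v axis j 1) \<bullet> (X *v (P *v axis j 1))) * p j" UNIV] p by (simp add: abs_mult)
  also have "\<dots> \<le> (\<Sum>j\<in>UNIV. op_norm X * p j)"
  proof (intro sum_mono mult_right_mono p)
    fix j
    have "\<bar>(P *v axis j 1) \<bullet> (X *v (P *v axis j 1))\<bar> \<le> norm (P *v axis j 1) * norm (X *v (P *v axis j 1))"
      by (rule Cauchy_Schwarz_ineq2)
    also have "\<dots> \<le> op_norm X"
      using norm_matrix_vector_le [of X "P *v axis j 1"] by (simp add: norm_unitary [OF U] norm_eq_sqrt_inner [of "axis j 1"] inner_axis_axis)
    finally show "\<bar>(P *v axis j 1) \<bullet> (X *v (P *v axis j 1))\<bar> \<le> op_norm X" .
  qed
  also have "\<dots> = op_norm X" by (simp add: sum_distrib_left [symmetric] sp)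
  finally show ?thesis .
qed

section \<open>One-sided calculus: a Gronwall lemma and the decay of the smallest eigenvalue\<close>

section \<open>A differential inequality for functions with differentiable lower supports\<close>

text \<open>\<open>f\<close> need not be differentiable: at each \<open>t\<close> it is supported
  from below, over past times only, by a differentiable function touching it at \<open>t\<close>.
  Maximise exp (- a s) f s - \<eta> s. At a positive maximiser the support has slope at most -
  \<eta>, so it would be larger just before, which contradicts maximality. Then \<eta> tends to 0.
  The sign of \<open>a\<close> is free, and both signs occur below.\<close>

lemma gronwall_lower_support:
  fixes f :: "real \<Rightarrow> real"
  assumes f: "continuous_on {0..T} f"
    and supp: "\<And>t. 0 < t \<Longrightarrow> t \<le> T \<Longrightarrow> \<exists>\<Psi> c. (\<Psi> has_real_derivative c) (at t within {0..T}) \<and>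
      c \<le> a * f t \<and> (\<forall>s\<in>{0..t}. f t - f s \<le> \<Psi> t - \<Psi> s)"
    and t: "t \<in> {0..T}"
  shows "f t \<le> exp (a * t) * f 0"
proof -
  have "exp (- a * t) * f t \<le> f 0 + \<eta> * t" if \<eta>: "0 < \<eta>" for \<eta>
  proof -
    let ?g = "\<lambda>s. exp (- a * s) * f s - \<eta> * s"
    have "continuous_on {0..t} ?g"
      using continuous_on_subset [OF f, of "{0..t}"] t by (intro continuous_intros) auto
    then obtain s where s: "s \<in> {0..t}" "\<And>r. r \<in> {0..t} \<Longrightarrow> ?g r \<le> ?g s"
      using continuous_attains_sup [of "{0..t}" ?g] t by auto
    have "s = 0"
    proof (rule ccontr)
      assume "s \<noteq> 0"
      hence s0: "0 < s" "s \<le> T" using s(1) t by auto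
      then obtain \<Psi> c where \<Psi>: "(\<Psi> has_real_derivative c) (at s within {0..T})" "c \<le> a * f s"
        "\<And>r. r \<in> {0..s} \<Longrightarrow> f s - f r \<le> \<Psi> s - \<Psi> r" using supp by meson
      \<comment> \<open>\<open>?G\<close> lies below \<open>?g\<close> on \<open>{0..s}\<close> and
        agrees with it at \<open>s\<close>.\<close>
      let ?G = "\<lambda>r. exp (- a * r) * (f s + \<Psi> r - \<Psi> s) - \<eta> * r"
      have "(?G has_real_derivative (exp (- a * s) * (c - a * f s) - \<eta>)) (at s within {0..T})"
        by (auto intro!: derivative_eq_intros \<Psi>(1) simp: algebra_simps)
      moreover have "exp (- a * s) * (c - a * f s) - \<eta> < 0"
        using mult_nonneg_nonpos [of "exp (- a * s)" "c - a * f s"] \<Psi>(2) \<eta> by simp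
      ultimately obtain d where d: "0 < d" "\<And>h. 0 < h \<Longrightarrow> s - h \<in> {0..T} \<Longrightarrow> h < d \<Longrightarrow> ?G s < ?G (s - h)"
        using has_real_derivative_neg_dec_left [of ?G] by meson
      define h where "h = min (d / 2) s"
      have h: "0 < h" "h < d" "s - h \<in> {0..s}" using d(1) s0 by (auto simp: h_def)
      have "?G s < ?G (s - h)" using h s0 by (intro d(2)) auto
      also have "\<dots> \<le> ?g (s - h)"
        using \<Psi>(3) [OF h(3)] by (simp add: mult_left_mono)
      also have "\<dots> \<le> ?g s" using h(3) s(1) by (intro s(2)) auto
      finally show False by simp
    qed
    thus ?thesis using s(2) [of t] t by simp
  qed
  hence "exp (- a * t) * f t \<le> f 0"
  proof -
    assume *: "\<And>\<eta>. 0 < \<eta> \<Longrightarrow> exp (- a * t) * f t \<le> f 0 + \<eta> * t"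
    have "((\<lambda>\<eta>. f 0 + \<eta> * t) \<longlongrightarrow> f 0 + 0 * t) (at_right 0)" by (intro tendsto_intros)
    moreover have "\<forall>\<^sub>F \<eta> in at_right 0. exp (- a * t) * f t \<le> f 0 + \<eta> * t"
      using * by (auto simp: eventually_at_right_less intro: eventually_mono [OF eventually_at_right_less])
    ultimately show ?thesis by (intro tendsto_lowerbound [of "\<lambda>\<eta>. f 0 + \<eta> * t" _ "at_right 0"]) auto
  qed
  hence "exp (a * t) * (exp (- a * t) * f t) \<le> exp (a * t) * f 0" by (intro mult_left_mono) auto
  thus ?thesis by (simp add: mult.assoc [symmetric] exp_add [symmetric])
qed

section \<open>Lower bound for the spectrum of the mean-field solution\<close>

lemma lambda_min_le:
  assumes "self_adjoint X"
  shows "lambda_min X * (norm v)\<^sup>2 \<le> v \<bullet> (X *v v)"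
proof -
  obtain P p where P: "spec X P p" using spec_exists [OF assms] by blast
  have U: "unitary P" using P by (simp add: spec_def)
  have "lambda_min X * (norm v)\<^sup>2 = lambda_min X * (norm (adj P *v v))\<^sup>2"
    by (simp add: norm_unitary [OF unitary_adj [OF U]])
  also have "\<dots> = (\<Sum>i\<in>UNIV. lambda_min X * (norm ((adj P *v v) $ i))\<^sup>2)"
    by (simp add: norm_vec_def L2_set_def sum_nonneg sum_distrib_left)
  also have "\<dots> \<le> v \<bullet> (X *v v)"
    unfolding spec_quadratic_form [OF P]
    by (intro sum_mono mult_right_mono) (auto simp: lambda_min_def spec_real_spectrum [OF P])
  finally show ?thesis .
qed

lemma lambda_min_eigenvector:
  assumes "self_adjoint (X :: 'n::finite cmat)"
  obtains v where "norm v = 1" "X *v v = lambda_min X *\<^sub>R v"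
proof -
  obtain P p where P: "spec X P p" using spec_exists [OF assms] by blast
  have U: "unitary P" using P by (simp add: spec_def)
  have "Min (range p) \<in> range p" by (intro Min_in) auto
  then obtain i where "Min (range p) = p i" by (meson imageE)
  hence i: "lambda_min X = p i" by (simp add: lambda_min_def spec_real_spectrum [OF P])
  have "diagm p *v axis i 1 = p i *\<^sub>R axis i 1"
    unfolding vec_eq_iff diagm_vec_nth vector_scaleR_component by (auto simp: axis_def scaleR_conv_of_real)
  hence "X *v (P *v axis i 1) = p i *\<^sub>R (P *v axis i 1)"
    unfolding spec_mult_vec [OF P] unitary_axis [OF U] by (simp add: matrix_vector_scaleR_right)
  moreover have "norm (P *v axis i 1) = 1" unfolding norm_unitary [OF U] by (simp add: norm_eq_1 inner_axis_axis)
  ultimately show thesis using that [of "P *v axis i 1"] i by metis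
qed

lemma lambda_min_spec_le: "spec X P p \<Longrightarrow> lambda_min X \<le> p i"
  by (simp add: lambda_min_def spec_real_spectrum)

lemma op_norm_le_norm: "op_norm X \<le> real CARD('n) * norm (X :: 'n::finite cmat)"
proof (rule op_norm_leI)
  fix v
  have "norm ((X *v v) $ i) \<le> norm X * norm v" for i
  proof -
    have "norm ((X *v v) $ i) \<le> (\<Sum>j\<in>UNIV. norm (X $ i $ j) * norm (v $ j))"
      unfolding matrix_vector_mult_def vec_lambda_beta by (rule sum_norm_le) (simp add: norm_mult)
    also have "\<dots> \<le> norm (X $ i) * norm v"
      using L2_set_mult_ineq [of "\<lambda>j. norm (X $ i $ j)" "\<lambda>j. norm (v $ j)" UNIV] by (simp add: norm_vec_def)
    also have "\<dots> \<le> norm X * norm v" by (intro mult_right_mono Finite_Cartesian_Product.norm_nth_le) simp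
    finally show ?thesis .
  qed
  hence "(\<Sum>i\<in>UNIV. norm ((X *v v) $ i)) \<le> (\<Sum>i\<in>(UNIV :: 'n set). norm X * norm v)" by (rule sum_mono)
  moreover have "norm (X *v v) \<le> (\<Sum>i\<in>UNIV. norm ((X *v v) $ i))"
    unfolding norm_vec_def by (rule L2_set_le_sum) simp
  ultimately show "norm (X *v v) \<le> real CARD('n) * norm X * norm v" by simp
qed

text \<open>Test \<open>Y\<close> with the minimising eigenvector of \<open>X\<close>. Only the
  resulting continuity is used, so the dimension factor is harmless.\<close>

lemma lambda_min_diff_le:
  assumes "self_adjoint X" "self_adjoint (Y :: 'n::finite cmat)"
  shows "lambda_min Y - lambda_min X \<le> real CARD('n) * norm (Y - X)"
proof -
  obtain v where v: "norm v = 1" "X *v v = lambda_min X *\<^sub>R v" using lambda_min_eigenvector [OF assms(1)] .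
  have "lambda_min Y - lambda_min X \<le> v \<bullet> (Y *v v) - v \<bullet> (X *v v)"
    using lambda_min_le [OF assms(2), of v] v by (simp add: norm_eq_1)
  also have "\<dots> = v \<bullet> ((Y - X) *v v)" by (simp add: matrix_vector_mult_diff_rdistrib inner_diff_right)
  also have "\<dots> \<le> norm v * norm ((Y - X) *v v)" by (rule norm_cauchy_schwarz)
  also have "\<dots> \<le> op_norm (Y - X)" using v(1) norm_matrix_vector_le [of "Y - X" v] by simp
  finally show ?thesis using op_norm_le_norm [of "Y - X"] by linarith
qed

lemma continuous_on_lambda_min:
  fixes m :: "real \<Rightarrow> 'n::finite cmat"
  assumes m: "continuous_on S m" "\<And>t. t \<in> S \<Longrightarrow> self_adjoint (m t)"
  shows "continuous_on S (\<lambda>t. lambda_min (m t))"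
  unfolding continuous_on_def
proof (intro ballI)
  fix t assume t: "t \<in> S"
  have "((\<lambda>s. real CARD('n) * norm (m s - m t)) \<longlongrightarrow> real CARD('n) * norm (m t - m t)) (at t within S)"
    using m(1) t by (intro tendsto_intros) (auto simp: continuous_on_def)
  hence "((\<lambda>s. real CARD('n) * norm (m s - m t)) \<longlongrightarrow> 0) (at t within S)" by simp
  moreover have "\<forall>\<^sub>F s in at t within S. norm (lambda_min (m s) - lambda_min (m t)) \<le> real CARD('n) * norm (m s - m t)"
    unfolding eventually_at
  proof (intro exI [of _ 1] conjI ballI impI)
    fix s assume s: "s \<in> S"
    show "norm (lambda_min (m s) - lambda_min (m t)) \<le> real CARD('n) * norm (m s - m t)"
      using lambda_min_diff_le [OF m(2) [OF t] m(2) [OF s]] lambda_min_diff_le [OF m(2) [OF s] m(2) [OF t]]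
      by (simp add: norm_minus_commute abs_le_iff)
  qed simp
  ultimately have "((\<lambda>s. lambda_min (m s) - lambda_min (m t)) \<longlongrightarrow> 0) (at t within S)"
    by (rule Lim_null_comparison [rotated])
  thus "((\<lambda>t. lambda_min (m t)) \<longlongrightarrow> lambda_min (m t)) (at t within S)" by (simp add: LIM_zero_iff)
qed

lemma bounded_linear_quadratic_form: "bounded_linear (\<lambda>X. v \<bullet> ((X :: complex ^ 'n ^ 'm) *v w))"
proof -
  have "linear (\<lambda>X. v \<bullet> ((X :: complex ^ 'n ^ 'm) *v w))"
    by (intro linearI) (simp_all add: matrix_vector_mult_add_rdistrib inner_add_right matrix_vector_scaleR_left)
  thus ?thesis by (simp add: linear_conv_bounded_linear)
qed

lemma quadratic_form_hamiltonian_eigenvector: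
  assumes \<sigma>: "self_adjoint \<sigma>" "\<sigma> *v v = r *\<^sub>R v"
  shows "v \<bullet> ((mat c ** commutator H \<sigma>) *v v) = 0"
proof -
  have e: "mat c ** commutator H \<sigma> = (mat c ** H) ** \<sigma> - \<sigma> ** (mat c ** H)"
    unfolding matrix_mul_assoc [of \<sigma>] mat_commute by (simp add: commutator_def matrix_distribs matrix_mul_assoc)
  have "v \<bullet> ((\<sigma> ** (mat c ** H)) *v v) = (\<sigma> *v v) \<bullet> ((mat c ** H) *v v)"
    unfolding matrix_vector_mul_assoc [symmetric] inner_adj [of v \<sigma>] self_adjointD [OF \<sigma>(1)] ..
  moreover have "v \<bullet> (((mat c ** H) ** \<sigma>) *v v) = v \<bullet> ((mat c ** H) *v (\<sigma> *v v))"
    by (simp only: matrix_vector_mul_assoc)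
  ultimately show ?thesis
    unfolding e matrix_vector_mult_diff_rdistrib inner_diff_right \<sigma>(2) by (simp add: matrix_vector_scaleR_right)
qed

text \<open>The gain term is nonnegative and is dropped; at an eigenvector the loss term equals
  \<open>r * (norm (L *v v))\<^sup>2\<close>.\<close>

lemma quadratic_form_dissipator_eigenvector:
  assumes \<sigma>: "pos_semidef \<sigma>" "\<sigma> *v v = r *\<^sub>R v" and v: "norm v = 1" and r: "0 \<le> r"
  shows "- ((op_norm L)\<^sup>2 * r) \<le> v \<bullet> (dissipator L \<sigma> *v v)"
proof -
  have "v \<bullet> ((L ** \<sigma> ** adj L) *v v) = (adj L *v v) \<bullet> (\<sigma> *v (adj L *v v))"
    by (simp add: matrix_vector_mul_assoc [symmetric] inner_adj [of v])
  hence 1: "0 \<le> v \<bullet> ((L ** \<sigma> ** adj L) *v v)" using \<sigma>(1) by (simp add: pos_semidef_def)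
  have LL: "v \<bullet> ((adj L ** L) *v v) = (norm (L *v v))\<^sup>2"
    by (simp add: matrix_vector_mul_assoc [symmetric] inner_adj [of v] dot_square_norm)
  have 2: "v \<bullet> ((adj L ** L ** \<sigma>) *v v) = r * (norm (L *v v))\<^sup>2"
    unfolding matrix_vector_mul_assoc [symmetric, of "adj L ** L"] \<sigma>(2) matrix_vector_scaleR_right
    by (simp add: LL)
  have "v \<bullet> ((\<sigma> ** (adj L ** L)) *v v) = (\<sigma> *v v) \<bullet> ((adj L ** L) *v v)"
    using \<sigma>(1) unfolding matrix_vector_mul_assoc [symmetric, of \<sigma>] inner_adj [of v \<sigma>]
    by (simp add: pos_semidef_def self_adjoint_def)
  hence 3: "v \<bullet> ((\<sigma> ** (adj L ** L)) *v v) = r * (norm (L *v v))\<^sup>2"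
    unfolding \<sigma>(2) by (simp add: LL)
  have "v \<bullet> (dissipator L \<sigma> *v v) = v \<bullet> ((L ** \<sigma> ** adj L) *v v) - r * (norm (L *v v))\<^sup>2"
    unfolding dissipator_def anticommutator_def matrix_vector_mult_diff_rdistrib matrix_vector_scaleR_left
      matrix_vector_mult_add_rdistrib inner_diff_right inner_scaleR_right inner_add_right 2 3 by simp
  moreover have "r * (norm (L *v v))\<^sup>2 \<le> r * (op_norm L)\<^sup>2"
    using norm_matrix_vector_le [of L v] v r by (intro mult_left_mono power_mono) auto
  ultimately show ?thesis using 1 by (simp add: mult.commute)
qed

text \<open>The smallest eigenvalue may fail to be differentiable at crossings. With
  \<open>v\<close> a minimising eigenvector at time s, the quadratic form of \<open>m r\<close> at
  \<open>v\<close> bounds it from above and touches at r = s, so its negative is a lower support for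
  \<open>- lambda_min\<close>. The state-dependent Hamiltonian drops out because a commutator with
  \<open>m s\<close> has zero expectation in an eigenvector of \<open>m s\<close>.\<close>

lemma mean_field_lambda_min:
  fixes m :: "real \<Rightarrow> 'd::finite cmat"
  assumes m: "solves_in_states T (mean_field_rhs H A L) m0 m" and t: "t \<in> {0..T}"
  shows "lambda_min m0 * exp (- ((op_norm L)\<^sup>2 * t)) \<le> lambda_min (m t)"
proof -
  have dens: "m s \<in> density_ops" and der: "(m has_vector_derivative mean_field_rhs H A L (m s)) (at s within {0..T})"
    if "s \<in> {0..T}" for s using m that by (auto simp: solves_in_states_def)
  note sa = density_self_adjoint [OF dens] and ps = density_pos_semidef [OF dens]
  have cont: "continuous_on {0..T} m"
    unfolding continuous_on_eq_continuous_within using der has_vector_derivative_continuous by blast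
  have "- lambda_min (m t) \<le> exp (- (op_norm L)\<^sup>2 * t) * - lambda_min (m 0)"
  proof (rule gronwall_lower_support [OF _ _ t])
    show "continuous_on {0..T} (\<lambda>t. - lambda_min (m t))"
      by (intro continuous_intros continuous_on_lambda_min cont sa)
    fix s assume s: "0 < s" "s \<le> T"
    hence sT: "s \<in> {0..T}" by simp
    obtain v where v: "norm v = 1" "m s *v v = lambda_min (m s) *\<^sub>R v"
      using lambda_min_eigenvector [OF sa [OF sT]] .
    let ?\<Psi> = "\<lambda>r. - (v \<bullet> (m r *v v))" and ?c = "- (v \<bullet> (mean_field_rhs H A L (m s) *v v))"
    show "\<exists>\<Psi> c. (\<Psi> has_real_derivative c) (at s within {0..T}) \<and>
      c \<le> - (op_norm L)\<^sup>2 * - lambda_min (m s) \<and>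
      (\<forall>r\<in>{0..s}. - lambda_min (m s) - - lambda_min (m r) \<le> \<Psi> s - \<Psi> r)"
    proof (intro exI [of _ ?\<Psi>] exI [of _ ?c] conjI ballI)
      show "(?\<Psi> has_real_derivative ?c) (at s within {0..T})"
        unfolding has_real_derivative_iff_has_vector_derivative
        by (intro has_vector_derivative_minus
            bounded_linear.has_vector_derivative [OF bounded_linear_quadratic_form] der sT)
      have "0 \<le> v \<bullet> (m s *v v)" using ps [OF sT] by (simp add: pos_semidef_def)
      hence "0 \<le> lambda_min (m s)" using v by (simp add: norm_eq_1)
      thus "?c \<le> - (op_norm L)\<^sup>2 * - lambda_min (m s)"
        using quadratic_form_dissipator_eigenvector [OF ps [OF sT] v(2,1), of L]
          quadratic_form_hamiltonian_eigenvector [OF sa [OF sT] v(2)]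
        by (simp add: mean_field_rhs_def matrix_vector_mult_add_rdistrib inner_add_right)
      fix r assume "r \<in> {0..s}"
      hence "r \<in> {0..T}" using s by simp
      thus "- lambda_min (m s) - - lambda_min (m r) \<le> ?\<Psi> s - ?\<Psi> r"
        using lambda_min_le [OF sa, of r v] v by (simp add: norm_eq_1)
    qed
  qed
  thus ?thesis using m by (simp add: solves_in_states_def mult.commute)
qed

section \<open>Local operators on the N-fold tensor power and the evolution of the product
  state\<close>

section \<open>Product operators\<close>

lemma tensor_op_mult: "tensor_op X ** tensor_op Y = tensor_op (\<lambda>l. X l ** Y l)"
  by (simp add: tensor_op_def matrix_matrix_mult_def vec_eq_iff prod.distrib [symmetric] prod_sum_PiE)

lemma adj_tensor_op: "adj (tensor_op X) = tensor_op (\<lambda>l. adj (X l))"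
  by (simp add: tensor_op_def vec_eq_iff)

lemma tensor_op_diagm:
  "tensor_op (\<lambda>l. diagm (d l)) = diagm (\<lambda>f :: 'n::finite \<Rightarrow> 'd::finite. \<Prod>l\<in>UNIV. d l (f l))"
proof -
  have "(\<Prod>l\<in>UNIV. diagm (d l) $ f l $ g l) = diagm (\<lambda>f. \<Prod>l\<in>UNIV. d l (f l)) $ f $ g"
    for f g :: "'n \<Rightarrow> 'd"
    by (auto simp: diagm_def fun_eq_iff)
  thus ?thesis by (simp add: tensor_op_def vec_eq_iff)
qed

lemma diagm_one: "diagm (\<lambda>_. 1) = mat 1"
  by (simp add: diagm_def mat_def vec_eq_iff)

lemma tensor_op_one: "tensor_op (\<lambda>_. mat 1) = mat 1"
  using tensor_op_diagm [of "\<lambda>_ _. 1"] by (simp add: diagm_one)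

lemma unitary_tensor_power: "unitary Q \<Longrightarrow> unitary (tensor_power Q)"
  by (simp add: unitary_def tensor_power_def adj_tensor_op tensor_op_mult tensor_op_one)

lemma spec_tensor_power:
  assumes "spec m Q e"
  shows "spec (tensor_power m :: ('n::finite \<Rightarrow> 'd::finite) cmat) (tensor_power Q) (\<lambda>f. \<Prod>l\<in>UNIV. e (f l))"
proof -
  have "tensor_power Q ** diagm (\<lambda>f :: 'n \<Rightarrow> 'd. \<Prod>l\<in>UNIV. e (f l)) ** adj (tensor_power Q)
      = tensor_power (Q ** diagm e ** adj Q)"
    unfolding tensor_op_diagm [of "\<lambda>_. e", symmetric] tensor_power_def adj_tensor_op tensor_op_mult ..
  thus ?thesis using assms by (simp add: spec_def unitary_tensor_power)
qed

lemma trace_tensor_power: "trace (tensor_power m :: ('n::finite \<Rightarrow> 'd::finite) cmat) = trace m ^ CARD('n)"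
proof -
  have "trace (tensor_power m :: ('n \<Rightarrow> 'd) cmat) = (\<Prod>l\<in>(UNIV :: 'n set). trace m)"
    unfolding trace_def tensor_power_def tensor_op_def vec_lambda_beta
    by (subst prod_sum_PiE) simp_all
  thus ?thesis by simp
qed

lemma tensor_power_density:
  assumes "m \<in> density_ops"
  shows "tensor_power m \<in> density_ops"
proof -
  obtain Q e where Q: "spec m Q e" using spec_exists density_self_adjoint [OF assms] by blast
  have e: "0 \<le> e i" for i using pos_semidef_spec [OF density_pos_semidef [OF assms] Q] .
  note T = spec_tensor_power [OF Q]
  have "pos_semidef (tensor_power m)"
    unfolding pos_semidef_def spec_quadratic_form [OF T]
    using spec_self_adjoint [OF T] e by (auto intro!: sum_nonneg mult_nonneg_nonneg prod_nonneg)
  thus ?thesis using assms by (simp add: density_ops_def trace_tensor_power pos_semidef_def)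
qed

lemma tensor_power_pos_def:
  assumes "pos_def m"
  shows "pos_def (tensor_power m)"
proof -
  obtain Q e where Q: "spec m Q e" using spec_exists assms unfolding pos_def_def by metis
  show ?thesis
    using pos_def_spec [OF assms Q] by (intro spec_pos_def [OF spec_tensor_power [OF Q]] prod_pos) auto
qed

lemma site_op_mult_tensor_power:
  "site_op X l ** tensor_power m = tensor_op ((\<lambda>_. m)(l := X ** m))"
  "tensor_power m ** site_op X l = tensor_op ((\<lambda>_. m)(l := m ** X))"
  unfolding site_op_def tensor_power_def tensor_op_mult
  by (rule arg_cong [of _ _ tensor_op], simp add: fun_eq_iff)+

lemma adj_site_op: "adj (site_op X l) = site_op (adj X) l"
proof -
  have "(\<lambda>k. adj (((\<lambda>_. mat 1)(l := X)) k)) = (\<lambda>_. mat 1)(l := adj X)" by (auto simp: fun_eq_iff)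
  thus ?thesis by (simp add: site_op_def adj_tensor_op)
qed

lemma site_op_mult: "site_op X l ** site_op Y l = site_op (X ** Y) l"
  unfolding site_op_def tensor_op_mult by (rule arg_cong [of _ _ tensor_op]) (simp add: fun_eq_iff)

lemma site_op_commute: "k \<noteq> l \<Longrightarrow> site_op X k ** site_op Y l = site_op Y l ** site_op X k"
  unfolding site_op_def tensor_op_mult by (rule arg_cong [of _ _ tensor_op]) (auto simp: fun_eq_iff)

lemma tensor_op_upd_nth:
  "tensor_op (X(l := Y)) $ f $ g = Y $ f l $ g l * (\<Prod>k\<in>UNIV - {l}. X k $ f k $ g k)"
  unfolding tensor_op_def vec_lambda_beta by (subst prod.remove [of _ l]) (auto intro!: prod.cong)

lemma tensor_op_upd_add: "tensor_op (X(l := Y + Z)) = tensor_op (X(l := Y)) + tensor_op (X(l := Z))"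
  by (simp add: vec_eq_iff tensor_op_upd_nth distrib_right)

lemma tensor_op_upd_diff: "tensor_op (X(l := Y - Z)) = tensor_op (X(l := Y)) - tensor_op (X(l := Z))"
  by (simp add: vec_eq_iff tensor_op_upd_nth left_diff_distrib)

lemma tensor_op_upd_scaleR: "tensor_op (X(l := r *\<^sub>R Y)) = r *\<^sub>R tensor_op (X(l := Y))"
  by (simp add: vec_eq_iff tensor_op_upd_nth)

lemma tensor_op_upd_mat: "tensor_op (X(l := mat c ** Y)) = mat c ** tensor_op (X(l := Y))"
  by (simp add: vec_eq_iff tensor_op_upd_nth mult.assoc)

lemma site_op_add: "site_op (X + Y) l = site_op X l + site_op Y l"
  unfolding site_op_def by (rule tensor_op_upd_add)

lemma site_op_diff: "site_op (X - Y) l = site_op X l - site_op Y l"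
  unfolding site_op_def by (rule tensor_op_upd_diff)

lemma site_op_mat: "site_op (mat c ** X) l = mat c ** site_op X l"
  unfolding site_op_def by (rule tensor_op_upd_mat)

lemma site_op_nth:
  "site_op X l $ f $ g = (if \<forall>k. k \<noteq> l \<longrightarrow> f k = g k then X $ f l $ g l else 0)"
proof -
  have "(\<Prod>k\<in>UNIV - {l}. (mat 1 :: complex ^ _ ^ _) $ f k $ g k) = (if \<forall>k. k \<noteq> l \<longrightarrow> f k = g k then 1 else 0)"
    by (auto simp: mat_def)
  thus ?thesis unfolding site_op_def tensor_op_upd_nth
    by (simp only: if_distrib [of "\<lambda>x. X $ f l $ g l * x"] mult_1_right mult_zero_right)
qed

text \<open>In the product eigenbasis the logarithm of a product of eigenvalues is a sum of
  logarithms, and each summand is the diagonal form of a one-site operator.\<close>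

lemma op_log_tensor_power:
  assumes m: "pos_def m"
  shows "op_log (tensor_power m) = (\<Sum>l\<in>UNIV. site_op (op_log m) (l :: 'n::finite))"
proof -
  obtain Q e where Q: "spec m Q e" using spec_exists m unfolding pos_def_def by metis
  have e: "0 < e i" for i using pos_def_spec [OF m Q] .
  have U: "unitary Q" using Q by (simp add: spec_def)
  let ?T = "tensor_power Q :: ('n \<Rightarrow> 'a) cmat"
  have site: "site_op (op_log m) l = ?T ** diagm (\<lambda>f. ln (e (f l))) ** adj ?T" for l :: 'n
  proof -
    have "diagm (\<lambda>f. ln (e (f l))) = site_op (diagm (\<lambda>i. ln (e i))) l"
    proof -
      have "site_op (diagm (\<lambda>i. ln (e i))) l
          = tensor_op (\<lambda>k. diagm (if k = l then (\<lambda>i. ln (e i)) else (\<lambda>_. 1)))"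
        unfolding site_op_def by (rule arg_cong [of _ _ tensor_op]) (simp add: fun_eq_iff diagm_one)
      also have "\<dots> = diagm (\<lambda>f. ln (e (f l)))"
        unfolding tensor_op_diagm
        by (rule arg_cong [of _ _ diagm]) (simp add: fun_eq_iff if_distrib [of "\<lambda>d. d _"] cong: if_cong)
      finally show ?thesis ..
    qed
    hence "?T ** diagm (\<lambda>f. ln (e (f l))) ** adj ?T
        = tensor_op (\<lambda>k. Q ** ((\<lambda>_. mat 1)(l := diagm (\<lambda>i. ln (e i)))) k ** adj Q)"
      by (simp add: site_op_def tensor_power_def adj_tensor_op tensor_op_mult)
    also have "(\<lambda>k. Q ** ((\<lambda>_. mat 1)(l := diagm (\<lambda>i. ln (e i)))) k ** adj Q) = (\<lambda>_. mat 1)(l := op_log m)"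
      using U spec_op_log [OF Q] by (auto simp: fun_eq_iff spec_def unitary_def)
    finally show ?thesis by (simp only: site_op_def)
  qed
  have "op_log (tensor_power m) = ?T ** diagm (\<lambda>f. ln (\<Prod>l\<in>UNIV. e (f l))) ** adj ?T"
    using spec_op_log [OF spec_tensor_power [OF Q, where 'n = 'n]] by (simp only: spec_def)
  also have "(\<lambda>f. ln (\<Prod>l\<in>(UNIV :: 'n set). e (f l))) = (\<lambda>f. \<Sum>l\<in>UNIV. ln (e (f l)))"
    using e by (intro ext) (subst ln_prod, auto simp: less_imp_neq [symmetric])
  finally show ?thesis
    by (simp add: site diagm_sum [symmetric] matrix_sum_left matrix_sum_right)
qed

lemma has_vector_derivative_vec:
  fixes f :: "real \<Rightarrow> 'a::real_normed_vector ^ 'n"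
  assumes "\<And>i. ((\<lambda>t. f t $ i) has_vector_derivative f' $ i) (at t within S)"
  shows "(f has_vector_derivative f') (at t within S)"
  unfolding has_vector_derivative_def has_derivative_def
proof (intro conjI bounded_linear_scaleR_left vec_tendstoI)
  fix i
  show "((\<lambda>y. ((f y - f (Lim (at t within S) (\<lambda>x. x)) - (y - Lim (at t within S) (\<lambda>x. x)) *\<^sub>R f') /\<^sub>R
      norm (y - Lim (at t within S) (\<lambda>x. x))) $ i) \<longlongrightarrow> 0 $ i) (at t within S)"
    using assms [of i] by (simp add: has_vector_derivative_def has_derivative_def)
qed

lemma tensor_power_has_vector_derivative:
  assumes "(m has_vector_derivative m') (at t within S)"
  shows "((\<lambda>s. tensor_power (m s) :: ('n::finite \<Rightarrow> 'd::finite) cmat) has_vector_derivative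
    (\<Sum>l\<in>UNIV. tensor_op ((\<lambda>_. m t)(l := m')))) (at t within S)"
proof (intro has_vector_derivative_vec)
  fix f g :: "'n \<Rightarrow> 'd"
  have entry: "((\<lambda>s. m s $ a $ b) has_derivative (\<lambda>y. y *\<^sub>R m' $ a $ b)) (at t within S)" for a b
    using bounded_linear.has_vector_derivative [OF bounded_linear_vec_nth
        bounded_linear.has_vector_derivative [OF bounded_linear_vec_nth assms]]
    by (simp add: has_vector_derivative_def)
  have "((\<lambda>s. \<Prod>l\<in>UNIV. m s $ f l $ g l) has_derivative
      (\<lambda>y. \<Sum>l\<in>UNIV. (y *\<^sub>R m' $ f l $ g l) * (\<Prod>k\<in>UNIV - {l}. m t $ f k $ g k))) (at t within S)"
    by (intro has_derivative_prod entry)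
  also have "(\<lambda>y. \<Sum>l\<in>UNIV. (y *\<^sub>R m' $ f l $ g l) * (\<Prod>k\<in>UNIV - {l}. m t $ f k $ g k))
      = (\<lambda>y. y *\<^sub>R ((\<Sum>l\<in>UNIV. tensor_op ((\<lambda>_. m t)(l := m'))) $ f $ g))"
    by (simp add: tensor_op_upd_nth scaleR_sum_right)
  finally show "((\<lambda>s. tensor_power (m s) $ f $ g) has_vector_derivative
      (\<Sum>l\<in>UNIV. tensor_op ((\<lambda>_. m t)(l := m'))) $ f $ g) (at t within S)"
    by (simp add: has_vector_derivative_def tensor_power_def tensor_op_def)
qed

lemma commutator_add_left: "commutator (X + Y) Z = commutator X Z + commutator Y Z"
  by (simp add: commutator_def matrix_distribs)

lemma commutator_diff_left: "commutator (X - Y) Z = commutator X Z - commutator Y Z"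
  by (simp add: commutator_def matrix_distribs)

lemma commutator_diff_right: "commutator Z (X - Y) = commutator Z X - commutator Z Y"
  by (simp add: commutator_def matrix_distribs)

lemma commutator_scaleR_right: "commutator Z (r *\<^sub>R X) = r *\<^sub>R commutator Z X"
  by (simp add: commutator_def matrix_distribs scaleR_right_diff_distrib)

lemma commutator_sum_left: "commutator (\<Sum>i\<in>S. X i) Z = (\<Sum>i\<in>S. commutator (X i) Z)"
  by (simp add: commutator_def matrix_sum_left matrix_sum_right sum_subtractf)

lemma commutator_sum_right: "commutator Z (\<Sum>i\<in>S. X i) = (\<Sum>i\<in>S. commutator Z (X i))"
  by (simp add: commutator_def matrix_sum_left matrix_sum_right sum_subtractf)

definition fluctuation :: "complex ^ ('d \<times> 'd) ^ ('d \<times> 'd) \<Rightarrow> 'd cmat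
    \<Rightarrow> ('n::{finite,linorder} \<Rightarrow> 'd::finite) cmat" where
  "fluctuation A m = (1 / real CARD('n)) *\<^sub>R (\<Sum>(l, l') \<in> {(l, l'). l < l'}. pair_op A l l')
     - (\<Sum>l\<in>UNIV. site_op (mean_field_potential A m) l)"

text \<open>By the product rule each factor evolves separately, and the one-body Hamiltonian and
  dissipator have the same effect in the N-body equation. Only the interaction differs: the
  mean-field potentials are present in place of the pair terms, which accounts for the sign of the
  commutator with \<open>fluctuation A m\<close>.\<close>

lemma tensor_power_mean_field_rhs:
  fixes m :: "'d::finite cmat"
  shows "(\<Sum>l\<in>UNIV. tensor_op ((\<lambda>_. m)(l := mean_field_rhs H A L m)))
    = nbody_rhs H A L (tensor_power m :: ('n::{finite,linorder} \<Rightarrow> 'd) cmat)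
      + mat \<i> ** commutator (fluctuation A m) (tensor_power m)"
proof -
  let ?\<sigma> = "tensor_power m :: ('n \<Rightarrow> 'd) cmat" and ?M = "mean_field_potential A m"
  let ?A = "(1 / real CARD('n)) *\<^sub>R (\<Sum>(l, l') \<in> {(l :: 'n, l'). l < l'}. pair_op A l l')"
  have comm: "tensor_op ((\<lambda>_. m)(l := commutator X m)) = commutator (site_op X l) ?\<sigma>" for l :: 'n and X
    by (simp add: commutator_def site_op_mult_tensor_power tensor_op_upd_diff)
  have LmL: "tensor_op ((\<lambda>_. m)(l := L ** m ** adj L)) = site_op L l ** ?\<sigma> ** adj (site_op L l)" for l :: 'n
    unfolding adj_site_op site_op_mult_tensor_power(1) unfolding site_op_def tensor_op_mult
    by (rule arg_cong [of _ _ tensor_op]) (simp add: fun_eq_iff)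
  have anti: "tensor_op ((\<lambda>_. m)(l := anticommutator (adj L ** L) m))
      = anticommutator (adj (site_op L l) ** site_op L l) ?\<sigma>" for l :: 'n
    by (simp add: anticommutator_def adj_site_op site_op_mult site_op_mult_tensor_power tensor_op_upd_add)
  have diss: "tensor_op ((\<lambda>_. m)(l := dissipator L m)) = dissipator (site_op L l) ?\<sigma>" for l :: 'n
    unfolding dissipator_def tensor_op_upd_diff tensor_op_upd_scaleR LmL anti ..
  have "(\<Sum>l\<in>UNIV. tensor_op ((\<lambda>_. m)(l := mean_field_rhs H A L m)))
    = (\<Sum>l\<in>UNIV. mat (- \<i>) ** commutator (site_op H l + site_op ?M l) ?\<sigma> + dissipator (site_op L (l :: 'n)) ?\<sigma>)"
    unfolding mean_field_rhs_def tensor_op_upd_add tensor_op_upd_mat comm diss site_op_add ..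
  also have "\<dots> = mat (- \<i>) ** commutator (\<Sum>l\<in>UNIV. site_op H l) ?\<sigma>
      + mat (- \<i>) ** commutator (\<Sum>l\<in>UNIV. site_op ?M l) ?\<sigma> + (\<Sum>l\<in>UNIV. dissipator (site_op L l) ?\<sigma>)"
    by (simp add: commutator_add_left commutator_sum_left sum.distrib matrix_sum_right matrix_add_ldistrib)
  also have "\<dots> = nbody_rhs H A L ?\<sigma> + mat \<i> ** commutator (fluctuation A m) ?\<sigma>"
  proof -
    have "mat (- \<i>) ** Y = - (mat \<i> ** Y)" for Y :: "('n \<Rightarrow> 'd) cmat"
      by (simp add: vec_eq_iff)
    thus ?thesis
      by (simp add: nbody_rhs_def nbody_hamiltonian_def fluctuation_def commutator_add_left
          commutator_diff_left matrix_distribs)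
  qed
  finally show ?thesis .
qed

section \<open>Pair operators\<close>

lemma sum_agree_off_one:
  fixes F :: "('n::finite \<Rightarrow> 'd::finite) \<Rightarrow> 'b::comm_monoid_add"
  shows "(\<Sum>h\<in>UNIV. if \<forall>k. k \<noteq> j \<longrightarrow> f k = h k then F h else 0) = (\<Sum>c\<in>UNIV. F (f(j := c)))"
proof -
  have "(\<Sum>h\<in>UNIV. if \<forall>k. k \<noteq> j \<longrightarrow> f k = h k then F h else 0) = (\<Sum>h | \<forall>k. k \<noteq> j \<longrightarrow> f k = h k. F h)"
    by (simp add: sum.If_cases)
  also have "\<dots> = (\<Sum>c\<in>UNIV. F (f(j := c)))"
    by (rule sum.reindex_bij_witness [of _ "\<lambda>c. f(j := c)" "\<lambda>h. h j"])
       (auto simp: fun_eq_iff intro!: arg_cong [of _ _ F])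
  finally show ?thesis .
qed

lemma sum_agree_off_two:
  fixes F :: "('n::finite \<Rightarrow> 'd::finite) \<Rightarrow> 'b::comm_monoid_add"
  assumes "l \<noteq> l'"
  shows "(\<Sum>h\<in>UNIV. if \<forall>k. k \<noteq> l \<and> k \<noteq> l' \<longrightarrow> f k = h k then F h else 0)
    = (\<Sum>p\<in>UNIV. F (f(l := fst p, l' := snd p)))"
proof -
  have "(\<Sum>h\<in>UNIV. if \<forall>k. k \<noteq> l \<and> k \<noteq> l' \<longrightarrow> f k = h k then F h else 0)
      = (\<Sum>h | \<forall>k. k \<noteq> l \<and> k \<noteq> l' \<longrightarrow> f k = h k. F h)"
    by (simp add: sum.If_cases)
  also have "\<dots> = (\<Sum>p\<in>UNIV. F (f(l := fst p, l' := snd p)))"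
    by (rule sum.reindex_bij_witness [of _ "\<lambda>p. f(l := fst p, l' := snd p)" "\<lambda>h. (h l, h l')"])
       (use assms in \<open>auto simp: fun_eq_iff intro!: arg_cong [of _ _ F]\<close>)
  finally show ?thesis .
qed

text \<open>The map taking (f, c) to (f(j := c), f j) is an involution. A single coordinate can thus
  be summed separately without choosing representatives of the others, at the price of a factor
  \<open>CARD('d)\<close>.\<close>

lemma sum_update_average:
  fixes F :: "('n::finite \<Rightarrow> 'd::finite) \<Rightarrow> 'b::semiring_1"
  shows "(\<Sum>f\<in>UNIV. \<Sum>c\<in>UNIV. F (f(j := c))) = of_nat CARD('d) * (\<Sum>f\<in>UNIV. F f)"
proof -
  have "(\<Sum>f\<in>UNIV. \<Sum>c\<in>UNIV. F (f(j := c))) = (\<Sum>(f, c)\<in>UNIV \<times> UNIV. F (f(j := c)))"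
    by (rule sum.cartesian_product)
  also have "\<dots> = (\<Sum>(f, c)\<in>UNIV \<times> (UNIV :: 'd set). F f)"
    by (rule sum.reindex_bij_witness [of _ "\<lambda>(f, c). (f(j := c), f j)" "\<lambda>(f, c). (f(j := c), f j)"]) auto
  also have "\<dots> = (\<Sum>f\<in>UNIV. \<Sum>c\<in>(UNIV :: 'd set). F f)" by (rule sum.cartesian_product [symmetric])
  finally show ?thesis by (simp add: sum_distrib_left)
qed

lemma sum_update_average_two:
  fixes F :: "('n::finite \<Rightarrow> 'd::finite) \<Rightarrow> 'b::semiring_1"
  shows "(\<Sum>f\<in>UNIV. \<Sum>p\<in>UNIV. F (f(l := fst p, l' := snd p))) = of_nat (CARD('d)\<^sup>2) * (\<Sum>f\<in>UNIV. F f)"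
proof -
  have "(\<Sum>f\<in>UNIV. \<Sum>p\<in>UNIV. F (f(l := fst p, l' := snd p)))
      = (\<Sum>f\<in>UNIV. \<Sum>c\<in>UNIV. (\<lambda>g. \<Sum>c'\<in>UNIV. F (g(l' := c'))) (f(l := c)))"
    by (simp add: sum.cartesian_product UNIV_Times_UNIV [symmetric] case_prod_unfold del: UNIV_Times_UNIV)
  also have "\<dots> = of_nat CARD('d) * (\<Sum>f\<in>UNIV. \<Sum>c'\<in>UNIV. F (f(l' := c')))"
    by (rule sum_update_average)
  also have "(\<Sum>f\<in>UNIV. \<Sum>c'\<in>UNIV. F (f(l' := c'))) = of_nat CARD('d) * (\<Sum>f\<in>UNIV. F f)"
    by (rule sum_update_average)
  finally show ?thesis by (simp only: power2_eq_square of_nat_mult mult.assoc)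
qed

lemma pair_op_mult:
  assumes "l \<noteq> l'"
  shows "pair_op A l l' ** pair_op B l l' = pair_op (A ** B) l l'"
proof -
  have "(pair_op A l l' ** pair_op B l l') $ f $ g = pair_op (A ** B) l l' $ f $ g" for f g
  proof -
    have "(pair_op A l l' ** pair_op B l l') $ f $ g
        = (\<Sum>h\<in>UNIV. if \<forall>k. k \<noteq> l \<and> k \<noteq> l' \<longrightarrow> f k = h k
             then A $ (f l, f l') $ (h l, h l') * pair_op B l l' $ h $ g else 0)"
      by (simp add: matrix_matrix_mult_def pair_op_def if_distrib [of "\<lambda>x. x * _"] cong: if_cong)
    also have "\<dots> = (\<Sum>p\<in>UNIV. A $ (f l, f l') $ p * pair_op B l l' $ (f(l := fst p, l' := snd p)) $ g)"
      unfolding sum_agree_off_two [OF assms] using assms by simp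
    also have "\<dots> = pair_op (A ** B) l l' $ f $ g"
      using assms by (auto simp: pair_op_def matrix_matrix_mult_def intro!: sum.cong sum.neutral)
    finally show ?thesis .
  qed
  thus ?thesis by (simp add: vec_eq_iff)
qed

lemma site_op_eq_pair_op:
  assumes "l \<noteq> l'"
  shows "site_op X l = pair_op (kron X (mat 1)) l l'" and "site_op X l' = pair_op (kron (mat 1) X) l l'"
  unfolding pair_op_kron [OF assms] site_op_def using assms
  by (auto intro!: arg_cong [of _ _ tensor_op])

lemma pair_op_add: "pair_op (A + B) l l' = pair_op A l l' + pair_op B l l'"
  by (auto simp: pair_op_def vec_eq_iff)

lemma pair_op_diff: "pair_op (A - B) l l' = pair_op A l l' - pair_op B l l'"
  by (auto simp: pair_op_def vec_eq_iff)

lemma pair_op_mat: "pair_op (mat c ** A) l l' = mat c ** pair_op A l l'"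
  by (auto simp: pair_op_def vec_eq_iff)

lemma adj_pair_op: "adj (pair_op A l l') = pair_op (adj A) l l'"
  by (auto simp: pair_op_def vec_eq_iff)

text \<open>Acting as the identity on factor \<open>j\<close>, expressed through entries: there is
  no coupling between different values at \<open>j\<close>, and the remaining block does not depend
  on that value. This avoids a tensor power over the other sites, which would need an index type of
  its own.\<close>

definition trivial_at :: "'n \<Rightarrow> ('n::finite \<Rightarrow> 'd::finite) cmat \<Rightarrow> bool" where
  "trivial_at j R \<longleftrightarrow> (\<forall>f g. f j \<noteq> g j \<longrightarrow> R $ f $ g = 0) \<and>
     (\<forall>f g c. f j = g j \<longrightarrow> R $ (f(j := c)) $ (g(j := c)) = R $ f $ g)"

lemma trivial_at_pair_op: "j \<noteq> l \<Longrightarrow> j \<noteq> l' \<Longrightarrow> trivial_at j (pair_op A l l')"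
  by (auto simp: trivial_at_def pair_op_def)

lemma trivial_at_one: "trivial_at j (mat 1)"
  by (auto simp: trivial_at_def mat_def fun_eq_iff split: if_splits)

lemma trivial_at_upd_upd:
  assumes "trivial_at j R"
  shows "R $ (f(j := c)) $ (g(j := c)) = R $ (f(j := b)) $ (g(j := b))"
proof -
  have "\<forall>f g c. f j = g j \<longrightarrow> R $ (f(j := c)) $ (g(j := c)) = R $ f $ g"
    using assms by (simp add: trivial_at_def)
  from this [rule_format, of "f(j := b)" "g(j := b)" c] show ?thesis by simp
qed

lemma trivial_at_sum_upd:
  assumes "trivial_at j R"
  shows "(\<Sum>c\<in>UNIV. R $ (f(j := a)) $ (h(j := c)) * G c) = R $ (f(j := b)) $ (h(j := b)) * G a"
    and "(\<Sum>c\<in>UNIV. G c * R $ (h(j := c)) $ (f(j := a))) = G a * R $ (h(j := b)) $ (f(j := b))"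
proof -
  have z: "R $ f $ g = 0" if "f j \<noteq> g j" for f g using assms that by (simp add: trivial_at_def)
  have "(\<Sum>c\<in>UNIV. R $ (f(j := a)) $ (h(j := c)) * G c)
      = (\<Sum>c\<in>UNIV. if c = a then R $ (f(j := b)) $ (h(j := b)) * G a else 0)"
    by (intro sum.cong refl) (auto simp: z trivial_at_upd_upd [OF assms, of f a h b])
  thus "(\<Sum>c\<in>UNIV. R $ (f(j := a)) $ (h(j := c)) * G c) = R $ (f(j := b)) $ (h(j := b)) * G a" by simp
  have "(\<Sum>c\<in>UNIV. G c * R $ (h(j := c)) $ (f(j := a)))
      = (\<Sum>c\<in>UNIV. if c = a then G a * R $ (h(j := b)) $ (f(j := b)) else 0)"
    by (intro sum.cong refl) (auto simp: z trivial_at_upd_upd [OF assms, of h a f b])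
  thus "(\<Sum>c\<in>UNIV. G c * R $ (h(j := c)) $ (f(j := a))) = G a * R $ (h(j := b)) $ (f(j := b))" by simp
qed

lemma trivial_at_mult:
  assumes R: "trivial_at j R" and R': "trivial_at j R'"
  shows "trivial_at j (R ** R')"
  unfolding trivial_at_def
proof (intro conjI allI impI)
  fix f g :: "'a \<Rightarrow> 'b" assume ne: "f j \<noteq> g j"
  have "R $ f $ h * R' $ h $ g = 0" for h
    using R R' ne unfolding trivial_at_def by (cases "f j = h j") auto
  thus "(R ** R') $ f $ g = 0"
    unfolding matrix_matrix_mult_def vec_lambda_beta by (intro sum.neutral ballI)
next
  fix f g :: "'a \<Rightarrow> 'b" and c assume eq: "f j = g j"
  \<comment> \<open>Averaging the intermediate index over its coordinate \<open>j\<close> collapses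
    the sum over that coordinate, so the entry of \<open>R\<close> may be read off at an arbitrary
    value \<open>c0\<close>. Taking \<open>c0 = f j\<close> below makes the two sides
    coincide.\<close>
  have avg: "of_nat CARD('b) * (R ** R') $ (f(j := c)) $ (g(j := c))
      = (\<Sum>h\<in>UNIV. R $ (f(j := c0)) $ (h(j := c0)) * R' $ (h(j := c)) $ (g(j := c)))" for c c0
    unfolding matrix_matrix_mult_def vec_lambda_beta sum_update_average [symmetric, of _ j]
    by (simp only: trivial_at_sum_upd(1) [OF R, where b = c0])
  have "R' $ (h(j := c)) $ (g(j := c)) = R' $ (h(j := f j)) $ (g(j := f j))" for h
    using trivial_at_upd_upd [OF R'] .
  hence "of_nat CARD('b) * (R ** R') $ (f(j := c)) $ (g(j := c))
      = of_nat CARD('b) * (R ** R') $ (f(j := f j)) $ (g(j := f j))"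
    unfolding avg [of c "f j"] avg [of "f j" "f j"] by simp
  moreover have "g(j := f j) = g" using eq by simp
  ultimately show "(R ** R') $ (f(j := c)) $ (g(j := c)) = (R ** R') $ f $ g" by simp
qed

lemma site_op_commute_trivial:
  assumes R: "trivial_at j R"
  shows "site_op X j ** R = R ** site_op X j"
proof -
  have "(site_op X j ** R) $ f $ g = (R ** site_op X j) $ f $ g" for f g
  proof -
    have "(site_op X j ** R) $ f $ g
        = (\<Sum>h\<in>UNIV. if \<forall>k. k \<noteq> j \<longrightarrow> f k = h k then X $ f j $ h j * R $ h $ g else 0)"
      by (simp add: matrix_matrix_mult_def site_op_nth if_distrib [of "\<lambda>x. x * _"] cong: if_cong)
    also have "\<dots> = (\<Sum>c\<in>UNIV. X $ f j $ c * R $ (f(j := c)) $ (g(j := g j)))"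
      unfolding sum_agree_off_one by simp
    also have "\<dots> = X $ f j $ g j * R $ (f(j := f j)) $ (g(j := f j))"
      by (rule trivial_at_sum_upd(2) [OF R])
    finally have 1: "(site_op X j ** R) $ f $ g = X $ f j $ g j * R $ (f(j := f j)) $ (g(j := f j))" .
    have "(R ** site_op X j) $ f $ g
        = (\<Sum>h\<in>UNIV. if \<forall>k. k \<noteq> j \<longrightarrow> g k = h k then R $ f $ h * X $ h j $ g j else 0)"
      by (simp add: matrix_matrix_mult_def site_op_nth if_distrib [of "\<lambda>x. _ * x"] eq_commute cong: if_cong)
    also have "\<dots> = (\<Sum>c\<in>UNIV. R $ (f(j := f j)) $ (g(j := c)) * X $ c $ g j)"
      unfolding sum_agree_off_one by simp
    also have "\<dots> = R $ (f(j := f j)) $ (g(j := f j)) * X $ f j $ g j"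
      by (rule trivial_at_sum_upd(1) [OF R])
    finally show ?thesis unfolding 1 by (simp only: mult.commute)
  qed
  thus ?thesis by (simp add: vec_eq_iff)
qed

section \<open>The two-body observable that drives the entropy, and its centring\<close>

section \<open>The interaction observable\<close>

lemma commutator_sum_site_op_site_op:
  "commutator (\<Sum>k\<in>UNIV. site_op X k) (site_op Y l) = site_op (commutator X Y) l"
proof -
  have "commutator (\<Sum>k\<in>UNIV. site_op X k) (site_op Y l) = (\<Sum>k\<in>UNIV. if k = l then commutator (site_op X l) (site_op Y l) else 0)"
    unfolding commutator_sum_left
    by (intro sum.cong refl) (auto simp: commutator_def site_op_commute)
  thus ?thesis by (simp add: commutator_def site_op_mult site_op_diff)
qed

lemma commutator_sum_site_op_pair_op:
  assumes "l \<noteq> l'"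
  shows "commutator (\<Sum>k\<in>UNIV. site_op X k) (pair_op A l l')
    = pair_op (commutator (kron X (mat 1) + kron (mat 1) X) A) l l'"
proof -
  have "commutator (site_op X k) (pair_op A l l') = 0" if "k \<noteq> l" "k \<noteq> l'" for k
    using site_op_commute_trivial [OF trivial_at_pair_op [OF that]] by (simp add: commutator_def)
  hence "commutator (\<Sum>k\<in>UNIV. site_op X k) (pair_op A l l') = (\<Sum>k\<in>{l, l'}. commutator (site_op X k) (pair_op A l l'))"
    unfolding commutator_sum_left by (intro sum.mono_neutral_right) auto
  also have "\<dots> = commutator (site_op X l) (pair_op A l l') + commutator (site_op X l') (pair_op A l l')"
    using assms by simp
  also have "\<dots> = pair_op (commutator (kron X (mat 1) + kron (mat 1) X) A) l l'"
    using assms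
    by (simp add: commutator_def site_op_eq_pair_op [OF assms] pair_op_mult pair_op_add [symmetric]
        pair_op_diff [symmetric] matrix_distribs algebra_simps)
  finally show ?thesis .
qed

text \<open>Each site belongs to \<open>CARD('n) - 1\<close> pairs; the missing one is the origin of
  the one-body remainder in \<open>commutator_log_fluctuation\<close>.\<close>

lemma sum_pairs_endpoints:
  fixes s :: "'n::{finite,linorder} \<Rightarrow> 'b::real_vector"
  shows "(\<Sum>(l, l') \<in> {(l, l'). l < l'}. s l + s l') = (real CARD('n) - 1) *\<^sub>R (\<Sum>l\<in>UNIV. s l)"
proof -
  have "(\<Sum>(l, l') \<in> {(l, l'). l < l'}. s l') = (\<Sum>(l, l') \<in> {(l, l'). l' < l}. s l)"
    by (rule sum.reindex_bij_witness [of _ prod.swap prod.swap]) auto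
  hence "(\<Sum>(l, l') \<in> {(l, l'). l < l'}. s l + s l')
      = (\<Sum>(l, l') \<in> {(l, l'). l < l'}. s l) + (\<Sum>(l, l') \<in> {(l, l'). l' < l}. s l)"
    by (simp add: case_prod_unfold sum.distrib)
  also have "\<dots> = (\<Sum>(l, l') \<in> {(l, l'). l < l'} \<union> {(l, l'). l' < l}. s l)"
    by (subst sum.union_disjoint) auto
  also have "{(l, l'). l < l'} \<union> {(l, l'). l' < l} = (SIGMA l:UNIV. UNIV - {l :: 'n})"
    by (auto simp: neq_iff)
  also have "(\<Sum>(l, l') \<in> (SIGMA l:UNIV. UNIV - {l :: 'n}). s l) = (\<Sum>l\<in>UNIV. \<Sum>l'\<in>UNIV - {l}. s l)"
    by (rule sum.Sigma [symmetric]) auto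
  also have "\<dots> = (\<Sum>l\<in>UNIV. (real CARD('n) - 1) *\<^sub>R s l)"
    by (simp only: sum_constant_scaleR card_Diff_singleton [OF UNIV_I])
       (simp add: of_nat_diff Suc_leI)
  finally show ?thesis by (simp only: scaleR_sum_right)
qed

definition obs_site :: "complex ^ ('d \<times> 'd) ^ ('d::finite \<times> 'd) \<Rightarrow> 'd cmat \<Rightarrow> 'd cmat" where
  "obs_site A m = mat \<i> ** commutator (op_log m) (mean_field_potential A m)"

text \<open>The pair term minus its partial expectation at either site. No constant is added back,
  since \<open>obs_site A m\<close> itself has expectation 0 in the state \<open>m\<close>.\<close>

definition obs_pair :: "complex ^ ('d \<times> 'd) ^ ('d::finite \<times> 'd) \<Rightarrow> 'd cmat \<Rightarrow> complex ^ ('d \<times> 'd) ^ ('d \<times> 'd)" where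
  "obs_pair A m = mat \<i> ** commutator (kron (op_log m) (mat 1) + kron (mat 1) (op_log m)) A
     - (kron (obs_site A m) (mat 1) + kron (mat 1) (obs_site A m))"

text \<open>With N sites, centring the pairs releases (N - 1)/N copies of
  \<open>obs_site A m\<close> at every site, while the mean-field potentials remove one full copy.
  What is left is - 1/N per site, a term whose norm stays bounded in N.\<close>

lemma commutator_log_fluctuation:
  fixes m :: "'d::finite cmat"
  assumes m: "pos_def m"
  shows "mat \<i> ** commutator (op_log (tensor_power m)) (fluctuation A m :: ('n::{finite,linorder} \<Rightarrow> 'd) cmat)
    = (1 / real CARD('n)) *\<^sub>R (\<Sum>(l, l') \<in> {(l, l'). l < l'}. pair_op (obs_pair A m) l l')
      - (1 / real CARD('n)) *\<^sub>R (\<Sum>l\<in>UNIV. site_op (obs_site A m) l)"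
proof -
  let ?N = "real CARD('n)" and ?E = "{(l :: 'n, l'). l < l'}" and ?b = "obs_site A m"
  let ?B = "mat \<i> ** commutator (kron (op_log m) (mat 1) + kron (mat 1) (op_log m)) A"
  let ?L = "\<Sum>k\<in>UNIV. site_op (op_log m) (k :: 'n)"
  have "mat \<i> ** commutator ?L (fluctuation A m)
      = (1 / ?N) *\<^sub>R (\<Sum>(l, l') \<in> ?E. mat \<i> ** commutator ?L (pair_op A l l'))
        - (\<Sum>l\<in>UNIV. mat \<i> ** commutator ?L (site_op (mean_field_potential A m) l))"
    unfolding fluctuation_def commutator_diff_right commutator_scaleR_right commutator_sum_right
      matrix_distribs matrix_sum_right case_prod_unfold ..
  also have "(\<Sum>(l, l') \<in> ?E. mat \<i> ** commutator ?L (pair_op A l l')) = (\<Sum>(l, l') \<in> ?E. pair_op ?B l l')"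
    by (intro sum.cong refl) (auto simp: commutator_sum_site_op_pair_op pair_op_mat)
  also have "(\<Sum>l\<in>UNIV. mat \<i> ** commutator ?L (site_op (mean_field_potential A m) l)) = (\<Sum>l\<in>UNIV. site_op ?b l)"
    by (simp add: commutator_sum_site_op_site_op site_op_mat obs_site_def)
  also have "(\<Sum>(l, l') \<in> ?E. pair_op ?B l l')
      = (\<Sum>(l, l') \<in> ?E. pair_op (obs_pair A m) l l') + (\<Sum>(l, l') \<in> ?E. site_op ?b l + site_op ?b l')"
    unfolding case_prod_unfold sum.distrib [symmetric]
  proof (intro sum.cong refl)
    fix e :: "'n \<times> 'n" assume "e \<in> {e. fst e < snd e}"
    hence e: "fst e \<noteq> snd e" by auto
    show "pair_op ?B (fst e) (snd e) = pair_op (obs_pair A m) (fst e) (snd e)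
        + (site_op ?b (fst e) + site_op ?b (snd e))"
      unfolding obs_pair_def pair_op_diff pair_op_add site_op_eq_pair_op [OF e] by simp
  qed
  also have "(\<Sum>(l, l') \<in> ?E. site_op ?b l + site_op ?b l') = (?N - 1) *\<^sub>R (\<Sum>l\<in>UNIV. site_op ?b l)"
    by (rule sum_pairs_endpoints)
  finally have eq: "mat \<i> ** commutator ?L (fluctuation A m)
      = (1 / ?N) *\<^sub>R ((\<Sum>(l, l') \<in> ?E. pair_op (obs_pair A m) l l') + (?N - 1) *\<^sub>R (\<Sum>l\<in>UNIV. site_op ?b l))
        - (\<Sum>l\<in>UNIV. site_op ?b l)" .
  have half: "(1 / ?N) *\<^sub>R (X + (?N - 1) *\<^sub>R Y) - Y = (1 / ?N) *\<^sub>R X - (1 / ?N) *\<^sub>R Y" for X Y :: "('n \<Rightarrow> 'd) cmat"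
  proof -
    have N: "(1 / ?N) * (?N - 1) = 1 - 1 / ?N" by (simp add: field_simps)
    have "(1 / ?N) *\<^sub>R ((?N - 1) *\<^sub>R Y) = ((1 / ?N) * (?N - 1)) *\<^sub>R Y" by (rule scaleR_scaleR)
    also have "\<dots> = Y - (1 / ?N) *\<^sub>R Y" unfolding N scaleR_left_diff_distrib scaleR_one ..
    finally show ?thesis by (simp only: scaleR_right_distrib) simp
  qed
  show ?thesis unfolding op_log_tensor_power [OF m] eq half ..
qed

section \<open>Norms of local operators\<close>

lemma norm_vec_square: "(norm v)\<^sup>2 = (\<Sum>i\<in>UNIV. (norm (v $ i))\<^sup>2)"
  by (simp add: norm_vec_def L2_set_def sum_nonneg)

lemma op_norm_leI_square:
  assumes "\<And>v. (norm (X *v v))\<^sup>2 \<le> c\<^sup>2 * (norm v)\<^sup>2" "0 \<le> c"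
  shows "op_norm X \<le> c"
proof (rule op_norm_leI)
  fix v
  have "(norm (X *v v))\<^sup>2 \<le> (c * norm v)\<^sup>2" using assms(1) by (simp add: power_mult_distrib)
  thus "norm (X *v v) \<le> c * norm v" by (rule power2_le_imp_le) (simp add: assms(2))
qed

lemma norm_matrix_vector_square_le: "(norm (X *v v))\<^sup>2 \<le> (op_norm X)\<^sup>2 * (norm v)\<^sup>2"
  unfolding power_mult_distrib [symmetric] by (intro power_mono norm_matrix_vector_le) simp

text \<open>\<open>T f\<close> parametrizes the fibre through \<open>f\<close>; every fibre is counted \<open>D\<close> times.\<close>

lemma op_norm_fibrewise:
  fixes X :: "'i::finite cmat" and Y :: "'j::finite cmat" and T :: "'i \<Rightarrow> 'j \<Rightarrow> 'i"
  assumes act: "\<And>v f p. (X *v v) $ T f p = (\<Sum>r\<in>UNIV. Y $ p $ r * v $ T f r)"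
    and avg: "\<And>F :: 'i \<Rightarrow> real. (\<Sum>f\<in>UNIV. \<Sum>p\<in>UNIV. F (T f p)) = D * (\<Sum>f\<in>UNIV. F f)" and D: "0 < D"
  shows "op_norm X \<le> op_norm Y"
proof (rule op_norm_leI_square [OF _ op_norm_nonneg])
  fix v :: "complex ^ 'i"
  have "D * (norm (X *v v))\<^sup>2 = (\<Sum>f\<in>UNIV. (norm (Y *v (\<chi> p. v $ T f p)))\<^sup>2)"
    unfolding norm_vec_square avg [symmetric] act by (simp add: matrix_vector_mult_def)
  also have "\<dots> \<le> (\<Sum>f\<in>UNIV. (op_norm Y)\<^sup>2 * (norm (\<chi> p. v $ T f p))\<^sup>2)"
    by (intro sum_mono norm_matrix_vector_square_le)
  also have "\<dots> = D * ((op_norm Y)\<^sup>2 * (norm v)\<^sup>2)"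
    using avg [of "\<lambda>f. (norm (v $ f))\<^sup>2"]
    by (simp add: norm_vec_square sum_distrib_left [symmetric])
  finally show "(norm (X *v v))\<^sup>2 \<le> (op_norm Y)\<^sup>2 * (norm v)\<^sup>2" using D by simp
qed

lemma op_norm_pair_op:
  assumes ne: "l \<noteq> l'"
  shows "op_norm (pair_op A l l' :: ('n::finite \<Rightarrow> 'd::finite) cmat) \<le> op_norm A"
proof (rule op_norm_fibrewise [where T = "\<lambda>f p. f(l := fst p, l' := snd p)", OF _ sum_update_average_two])
  fix v :: "complex ^ ('n \<Rightarrow> 'd)" and f :: "'n \<Rightarrow> 'd" and p :: "'d \<times> 'd"
  let ?f = "f(l := fst p, l' := snd p)"
  have uu: "?f(l := fst r, l' := snd r) = f(l := fst r, l' := snd r)" for r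
    using ne by (auto simp: fun_eq_iff)
  have "(pair_op A l l' *v v) $ ?f
      = (\<Sum>h\<in>UNIV. if \<forall>k. k \<noteq> l \<and> k \<noteq> l' \<longrightarrow> ?f k = h k then A $ (?f l, ?f l') $ (h l, h l') * v $ h else 0)"
    by (simp add: matrix_vector_mult_def pair_op_def if_distrib [of "\<lambda>x. x * _"] cong: if_cong)
  also have "\<dots> = (\<Sum>r\<in>UNIV. A $ p $ r * v $ (f(l := fst r, l' := snd r)))"
    unfolding sum_agree_off_two [OF ne] uu using ne by simp
  finally show "(pair_op A l l' *v v) $ ?f = (\<Sum>r\<in>UNIV. A $ p $ r * v $ (f(l := fst r, l' := snd r)))" .
qed simp

lemma op_norm_site_op: "op_norm (site_op X l :: ('n::finite \<Rightarrow> 'd::finite) cmat) \<le> op_norm X"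
proof (rule op_norm_fibrewise [where T = "\<lambda>f c. f(l := c)", OF _ sum_update_average])
  fix v :: "complex ^ ('n \<Rightarrow> 'd)" and f c
  have "(site_op X l *v v) $ (f(l := c))
      = (\<Sum>h\<in>UNIV. if \<forall>k. k \<noteq> l \<longrightarrow> (f(l := c)) k = h k then X $ (f(l := c)) l $ h l * v $ h else 0)"
    unfolding matrix_vector_mult_def vec_lambda_beta site_op_nth
    by (simp add: if_distrib [of "\<lambda>x. x * _"] cong: if_cong)
  thus "(site_op X l *v v) $ (f(l := c)) = (\<Sum>r\<in>UNIV. X $ c $ r * v $ (f(l := r)))"
    unfolding sum_agree_off_one fun_upd_upd fun_upd_same .
qed simp

lemma sum_prod_UNIV: "(\<Sum>p\<in>(UNIV :: ('a::finite \<times> 'b::finite) set). F p) = (\<Sum>a\<in>UNIV. \<Sum>b\<in>UNIV. F (a, b))"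
  by (simp add: UNIV_Times_UNIV [symmetric] sum.cartesian_product del: UNIV_Times_UNIV)

lemma mat_nth: "mat c $ i $ j = (if i = j then c else 0)"
  by (simp add: mat_def)

lemma one_kron_mult_nth:
  "(kron (mat 1) X ** A) $ (a, c) $ p = (\<Sum>y\<in>UNIV. X $ c $ y * A $ (a, y) $ p)"
proof -
  have "(kron (mat 1) X ** A) $ (a, c) $ p
      = (\<Sum>x\<in>UNIV. if a = x then \<Sum>y\<in>UNIV. X $ c $ y * A $ (x, y) $ p else 0)"
    unfolding kron_def matrix_matrix_mult_def vec_lambda_beta sum_prod_UNIV
    by (intro sum.cong refl) (simp add: mat_def)
  thus ?thesis by simp
qed

lemma kron_mult_kron: "kron X Y ** kron X' Y' = kron (X ** X') (Y ** Y')"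
  by (simp add: kron_def matrix_matrix_mult_def vec_eq_iff sum_prod_UNIV sum_product mult_ac)

lemma adj_kron: "adj (kron X Y) = kron (adj X) (adj Y)"
  by (simp add: kron_def vec_eq_iff)

lemma spec_kron:
  assumes "spec X P p" "spec Y Q q"
  shows "spec (kron X Y) (kron P Q) (\<lambda>k. p (fst k) * q (snd k))"
proof -
  have "kron (mat 1) (mat 1) = mat 1" by (auto simp: kron_def mat_def vec_eq_iff prod_eq_iff)
  moreover have "diagm (\<lambda>k. p (fst k) * q (snd k)) = kron (diagm p) (diagm q)"
    by (auto simp: kron_def diagm_def vec_eq_iff prod_eq_iff)
  ultimately show ?thesis using assms by (simp add: spec_def unitary_def adj_kron kron_mult_kron)
qed

lemma abs_eigenvalue_le_op_norm:
  assumes X: "spec X P p"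
  shows "\<bar>p i\<bar> \<le> op_norm X"
proof -
  let ?v = "P *v axis i 1"
  have "norm ?v = 1" using X by (simp add: spec_def norm_unitary norm_eq_1 inner_axis_axis)
  thus ?thesis
    using Cauchy_Schwarz_ineq2 [of ?v "X *v ?v"] norm_matrix_vector_le [of X ?v]
    by (simp add: spec_eigenvalue_quadratic_form [OF X])
qed

lemma op_norm_kron_sum:
  assumes "self_adjoint X"
  shows "op_norm (kron X (mat 1) + kron (mat 1) X) \<le> 2 * op_norm X"
proof -
  obtain P p where P: "spec X P p" using spec_exists [OF assms] by blast
  have one: "spec (mat 1) P (\<lambda>_. 1)" using spec_mpow [OF P, of 0] by simp
  have "op_norm (kron X (mat 1)) \<le> op_norm X" "op_norm (kron (mat 1) X) \<le> op_norm X"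
    using abs_eigenvalue_le_op_norm [OF P]
    by (auto intro!: op_norm_spec_le [OF spec_kron [OF P one]] op_norm_spec_le [OF spec_kron [OF one P]])
  thus ?thesis using op_norm_add [of "kron X (mat 1)" "kron (mat 1) X"] by linarith
qed

section \<open>The mean-field potential\<close>

lemma mean_field_potential_nth:
  "mean_field_potential A m $ a $ b = (\<Sum>c\<in>UNIV. \<Sum>y\<in>UNIV. m $ c $ y * A $ (a, y) $ (b, c))"
  unfolding mean_field_potential_def ptrace2_def vec_lambda_beta one_kron_mult_nth ..

lemma mean_field_potential_diff:
  "mean_field_potential (A - B) m = mean_field_potential A m - mean_field_potential B m"
  by (simp add: vec_eq_iff mean_field_potential_nth right_diff_distrib sum_subtractf)

lemma mean_field_potential_add:
  "mean_field_potential (A + B) m = mean_field_potential A m + mean_field_potential B m"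
  by (simp add: vec_eq_iff mean_field_potential_nth distrib_left sum.distrib)

lemma mean_field_potential_mat:
  "mean_field_potential (mat c ** A) m = mat c ** mean_field_potential A m"
  by (simp add: vec_eq_iff mean_field_potential_nth sum_distrib_left mult_ac)

text \<open>The potential is determined by this duality, which turns its algebraic identities into
  identities for \<open>kron\<close> under the trace.\<close>

lemma trace_mult_mean_field_potential: "trace (Z ** mean_field_potential A m) = trace (kron Z m ** A)"
proof -
  have "trace (kron Z m ** A) = (\<Sum>a\<in>UNIV. \<Sum>c\<in>UNIV. \<Sum>b\<in>UNIV. \<Sum>y\<in>UNIV. Z $ a $ b * (m $ c $ y * A $ (b, y) $ (a, c)))"
    by (simp add: trace_def matrix_matrix_mult_def kron_def sum_prod_UNIV mult_ac)
  also have "\<dots> = (\<Sum>a\<in>UNIV. \<Sum>b\<in>UNIV. \<Sum>c\<in>UNIV. \<Sum>y\<in>UNIV. Z $ a $ b * (m $ c $ y * A $ (b, y) $ (a, c)))"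
    by (rule sum.cong [OF refl], rule sum.swap)
  finally show ?thesis
    by (simp add: trace_def matrix_matrix_mult_def [of Z] mean_field_potential_nth sum_distrib_left)
qed

lemma matrix_eqI_trace:
  assumes "\<And>Z. trace (Z ** X) = trace (Z ** Y)"
  shows "X = (Y :: complex ^ 'n ^ 'n)"
proof -
  have "trace ((\<chi> i j. if i = b \<and> j = a then 1 else 0) ** M) = M $ a $ b" for M :: "complex ^ 'n ^ 'n" and a b
  proof -
    have "trace ((\<chi> i j. if i = b \<and> j = a then 1 else 0) ** M)
        = (\<Sum>i\<in>UNIV. if i = b then \<Sum>j\<in>UNIV. if j = a then M $ j $ i else 0 else 0)"
      unfolding trace_def matrix_matrix_mult_def vec_lambda_beta
      by (rule sum.cong [OF refl], rename_tac i, case_tac "i = b")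
         (simp_all add: if_distrib [of "\<lambda>x. x * _"] cong: if_cong)
    thus ?thesis by simp
  qed
  thus ?thesis using assms by (metis vec_eq_iff)
qed

lemma mean_field_potential_kron_one_mult:
  "mean_field_potential (kron X (mat 1) ** A) m = X ** mean_field_potential A m"
  by (rule matrix_eqI_trace)
     (simp add: trace_mult_mean_field_potential matrix_mul_assoc kron_mult_kron)

lemma mean_field_potential_mult_kron_one:
  "mean_field_potential (A ** kron X (mat 1)) m = mean_field_potential A m ** X"
proof (rule matrix_eqI_trace)
  fix Z
  have "trace (kron Z m ** A ** kron X (mat 1)) = trace (kron X (mat 1) ** (kron Z m ** A))"
    by (rule trace_mul_sym)
  also have "\<dots> = trace (X ** (Z ** mean_field_potential A m))"
    by (simp add: matrix_mul_assoc kron_mult_kron trace_mult_mean_field_potential)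
  also have "\<dots> = trace (Z ** mean_field_potential A m ** X)" by (rule trace_mul_sym)
  finally show "trace (Z ** mean_field_potential (A ** kron X (mat 1)) m) = trace (Z ** (mean_field_potential A m ** X))"
    by (simp add: trace_mult_mean_field_potential matrix_mul_assoc)
qed

text \<open>The partial trace weighted by \<open>m\<close> is cyclic for second-factor operators
  that commute with \<open>m\<close>; it is applied to \<open>op_log m\<close>.\<close>

lemma mean_field_potential_one_kron_commute:
  assumes "m ** X = X ** m"
  shows "mean_field_potential (kron (mat 1) X ** A) m = mean_field_potential (A ** kron (mat 1) X) m"
proof (rule matrix_eqI_trace)
  fix Z
  have "trace (kron Z m ** A ** kron (mat 1) X) = trace (kron (mat 1) X ** (kron Z m ** A))"
    by (rule trace_mul_sym)
  thus "trace (Z ** mean_field_potential (kron (mat 1) X ** A) m) = trace (Z ** mean_field_potential (A ** kron (mat 1) X) m)"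
    by (simp add: trace_mult_mean_field_potential matrix_mul_assoc kron_mult_kron assms)
qed

lemma mean_field_potential_kron_one: "mean_field_potential (kron X (mat 1)) m = mat (trace m) ** X"
  by (simp add: vec_eq_iff mean_field_potential_nth kron_def mat_nth trace_def sum_distrib_right
      if_distrib [of "\<lambda>x. _ * x"] cong: if_cong)

lemma mean_field_potential_one_kron: "mean_field_potential (kron (mat 1) X) m = mat (trace (m ** X))"
  by (simp add: vec_eq_iff mean_field_potential_nth kron_def mat_def trace_def matrix_matrix_mult_def)

lemma self_adjoint_mean_field_potential:
  assumes "self_adjoint A" "self_adjoint m"
  shows "self_adjoint (mean_field_potential A m)"
proof -
  have A: "cnj (A $ p $ q) = A $ q $ p" for p q
    using arg_cong [OF self_adjointD [OF assms(1)], of "\<lambda>B. B $ q $ p"] by simp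
  have m: "cnj (m $ p $ q) = m $ q $ p" for p q
    using arg_cong [OF self_adjointD [OF assms(2)], of "\<lambda>B. B $ q $ p"] by simp
  have "adj (mean_field_potential A m) $ a $ b = mean_field_potential A m $ a $ b" for a b
    unfolding adj_nth mean_field_potential_nth cnj_sum complex_cnj_mult A m by (rule sum.swap)
  thus ?thesis by (simp add: self_adjoint_def vec_eq_iff)
qed

text \<open>Each eigenvalue of the potential is the expectation of \<open>A\<close> in a product
  state, namely the rank-one eigenprojection \<open>?Z\<close> tensored with
  \<open>m\<close>.\<close>

lemma op_norm_mean_field_potential:
  fixes m :: "'d::finite cmat"
  assumes m: "m \<in> density_ops" and A: "self_adjoint A"
  shows "op_norm (mean_field_potential A m) \<le> op_norm A"
proof -
  let ?M = "mean_field_potential A m"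
  obtain P p where P: "spec ?M P p"
    using spec_exists self_adjoint_mean_field_potential [OF A density_self_adjoint [OF m]] by blast
  obtain Q e where Q: "spec m Q e" and e: "\<And>k. 0 \<le> e k" using density_spec [OF m] by blast
  have "\<bar>p i\<bar> \<le> op_norm A" for i
  proof -
    let ?Z = "P ** diagm (\<lambda>k. if k = i then 1 else 0) ** adj P"
    have Z: "spec ?Z P (\<lambda>k. if k = i then 1 else 0)" using P by (simp add: spec_def)
    note ZQ = spec_kron [OF Z Q]
    have "trace ?Z = trace (adj P ** (P ** diagm (\<lambda>k. if k = i then 1 else 0)))" by (rule trace_mul_sym)
    also have "\<dots> = 1" using P by (simp add: spec_def unitary_cancel trace_def diagm_def
          if_distrib [of complex_of_real] cong: if_cong)
    moreover have "trace (kron ?Z m) = trace ?Z * trace m"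
      by (simp add: trace_def kron_def sum_prod_UNIV sum_product)
    ultimately have "trace (kron ?Z m) = 1" using m by (simp add: density_ops_def)
    hence "kron ?Z m \<in> density_ops"
      using spec_self_adjoint [OF ZQ] e
      by (auto simp: density_ops_def pos_semidef_def spec_quadratic_form [OF ZQ] intro!: sum_nonneg)
    hence "\<bar>rtr (kron ?Z m ** A)\<bar> \<le> op_norm A" by (rule rtr_state_le_op_norm)
    moreover have "rtr (kron ?Z m ** A) = rtr (?M ** ?Z)"
      unfolding rtr_commute [of ?M] by (simp add: rtr_def trace_mult_mean_field_potential)
    moreover have "rtr (?M ** ?Z) = p i"
      unfolding rtr_mult_spec [OF Z] spec_conj [OF P]
      by (simp add: diagm_def if_distrib [of "\<lambda>x. _ * x"] cong: if_cong)
    ultimately show ?thesis by simp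
  qed
  thus ?thesis by (rule op_norm_spec_le [OF P])
qed

section \<open>Properties of the centred interaction observable\<close>

lemma self_adjoint_i_commutator:
  assumes "self_adjoint X" "self_adjoint Y"
  shows "self_adjoint (mat \<i> ** commutator X Y)"
proof -
  have "adj (mat \<i> ** commutator X Y) = mat (- \<i>) ** (Y ** X - X ** Y)"
    by (simp add: adj_mult adj_diff commutator_def mat_commute self_adjointD assms)
  also have "\<dots> = mat \<i> ** commutator X Y"
    by (simp add: vec_eq_iff commutator_def algebra_simps)
  finally show ?thesis by (simp add: self_adjoint_def)
qed

lemma self_adjoint_op_log:
  assumes "self_adjoint m"
  shows "self_adjoint (op_log m)"
proof -
  obtain P p where "spec m P p" using spec_exists [OF assms] by blast
  from spec_self_adjoint [OF spec_op_log [OF this]] show ?thesis .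
qed

lemma commute_op_log:
  assumes "self_adjoint m"
  shows "m ** op_log m = op_log m ** m"
proof -
  obtain P p where P: "spec m P p" using spec_exists [OF assms] by blast
  note L = spec_op_log [OF P]
  have "m ** op_log m = P ** (diagm p ** diagm (\<lambda>i. ln (p i))) ** adj P"
    using P L by (simp add: spec_def matrix_mul_assoc [symmetric] unitary_cancel)
  moreover have "op_log m ** m = P ** (diagm (\<lambda>i. ln (p i)) ** diagm p) ** adj P"
    using P L by (simp add: spec_def matrix_mul_assoc [symmetric] unitary_cancel)
  ultimately show ?thesis by (simp add: diagm_mult_diagm mult.commute)
qed

lemma self_adjoint_obs_site:
  assumes "self_adjoint A" "self_adjoint m"
  shows "self_adjoint (obs_site A m)"
  unfolding obs_site_def
  by (intro self_adjoint_i_commutator self_adjoint_op_log self_adjoint_mean_field_potential assms)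

lemma self_adjoint_obs_pair:
  assumes "self_adjoint A" "self_adjoint m"
  shows "self_adjoint (obs_pair A m)"
proof -
  have k: "self_adjoint (kron X (mat 1) + kron (mat 1) X)" if "self_adjoint X" for X :: "'a cmat"
    using that by (simp add: self_adjoint_def adj_add adj_kron)
  have "self_adjoint (mat \<i> ** commutator (kron (op_log m) (mat 1) + kron (mat 1) (op_log m)) A)"
    by (intro self_adjoint_i_commutator k self_adjoint_op_log assms)
  thus ?thesis
    using k [OF self_adjoint_obs_site [OF assms]] by (simp add: obs_pair_def self_adjoint_def adj_diff)
qed

lemma op_norm_obs_site:
  assumes m: "m \<in> density_ops" and A: "self_adjoint A" and K: "op_norm (op_log m) \<le> K"
  shows "op_norm (obs_site A m) \<le> 2 * K * op_norm A"
proof -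
  have "op_norm (obs_site A m) \<le> 2 * op_norm (op_log m) * op_norm (mean_field_potential A m)"
    unfolding obs_site_def by (rule op_norm_commutator)
  also have "\<dots> \<le> 2 * K * op_norm A"
    using K op_norm_nonneg [of "op_log m"] op_norm_nonneg [of A]
    by (intro mult_mono op_norm_mean_field_potential m A op_norm_nonneg) auto
  finally show ?thesis .
qed

text \<open>The constant is 8 = 4 + 4: the commutator with the sum of two logarithms has norm at
  most 2 (2 K) |A|, and the two centring terms have norm at most 2 K |A| each.\<close>

lemma op_norm_obs_pair:
  assumes m: "m \<in> density_ops" and A: "self_adjoint A" and K: "op_norm (op_log m) \<le> K"
  shows "op_norm (obs_pair A m) \<le> 8 * K * op_norm A"
proof -
  note sm = density_self_adjoint [OF m]
  have "op_norm (obs_pair A m)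
      \<le> 2 * op_norm (kron (op_log m) (mat 1) + kron (mat 1) (op_log m)) * op_norm A
        + 2 * op_norm (obs_site A m)"
    unfolding obs_pair_def by (rule order_trans [OF op_norm_diff add_mono [OF op_norm_commutator
        op_norm_kron_sum [OF self_adjoint_obs_site [OF A sm]]]])
  also have "\<dots> \<le> 2 * (2 * K) * op_norm A + 2 * (2 * K * op_norm A)"
    using op_norm_kron_sum [OF self_adjoint_op_log [OF sm]] K op_norm_obs_site [OF m A K] op_norm_nonneg [of A]
    by (intro add_mono mult_left_mono mult_right_mono) auto
  finally show ?thesis by simp
qed

text \<open>The logarithm at the averaged site commutes with \<open>m\<close> and drops out, so the
  partial expectation of the pair commutator is \<open>obs_site A m\<close>. The subtracted terms
  average to \<open>obs_site A m\<close> plus its expectation, which is 0 by cyclicity of the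
  trace.\<close>

lemma mean_field_potential_obs_pair:
  assumes m: "m \<in> density_ops"
  shows "mean_field_potential (obs_pair A m) m = 0"
proof -
  let ?l = "op_log m" and ?M = "mean_field_potential A m" and ?b = "obs_site A m"
  have tr: "trace m = 1" using m by (simp add: density_ops_def)
  have c: "m ** ?l = ?l ** m" by (rule commute_op_log [OF density_self_adjoint [OF m]])
  have "mean_field_potential (mat \<i> ** commutator (kron ?l (mat 1) + kron (mat 1) ?l) A) m = ?b"
    unfolding obs_site_def
    by (simp add: mean_field_potential_mat commutator_def matrix_distribs mean_field_potential_diff
        mean_field_potential_add mean_field_potential_kron_one_mult mean_field_potential_mult_kron_one
        mean_field_potential_one_kron_commute [OF c])
  moreover have "trace (m ** ?b) = 0"
  proof -
    have "m ** ?b = mat \<i> ** (m ** ?l ** ?M) - mat \<i> ** (m ** ?M ** ?l)"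
      unfolding obs_site_def matrix_mul_assoc [of m "mat \<i>"] mat_commute
      by (simp add: commutator_def matrix_distribs matrix_mul_assoc [symmetric])
    moreover have "trace (mat \<i> ** (m ** ?l ** ?M)) = trace (mat \<i> ** (m ** ?M ** ?l))"
    proof -
      have "trace (mat \<i> ** (m ** ?M ** ?l)) = trace ((mat \<i> ** m ** ?M) ** ?l)"
        by (simp only: matrix_mul_assoc)
      also have "\<dots> = trace (?l ** (mat \<i> ** m ** ?M))" by (rule trace_mul_sym)
      also have "?l ** (mat \<i> ** m ** ?M) = mat \<i> ** (?l ** m ** ?M)"
        by (simp only: matrix_mul_assoc mat_commute)
      finally show ?thesis by (simp only: c)
    qed
    ultimately show ?thesis by (simp add: trace_sub)
  qed
  ultimately show ?thesis
    by (simp add: obs_pair_def mean_field_potential_diff mean_field_potential_add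
        mean_field_potential_kron_one mean_field_potential_one_kron tr)
qed

text \<open>\<open>mean_field_potential\<close> averages over the second factor only; this symmetry
  carries its vanishing over to the first factor.\<close>

definition flip_symmetric :: "complex ^ ('d \<times> 'd) ^ ('d::finite \<times> 'd) \<Rightarrow> bool" where
  "flip_symmetric A \<longleftrightarrow> (\<forall>p q. A $ prod.swap p $ prod.swap q = A $ p $ q)"

lemma flip_op_conj_nth:
  fixes A :: "complex ^ ('a \<times> 'a) ^ ('a::finite \<times> 'a)"
  shows "(flip_op ** A ** flip_op) $ p $ q = A $ prod.swap p $ prod.swap q"
proof -
  have sw: "(p = prod.swap r) = (r = prod.swap p)" for p r :: "'a \<times> 'a" by (cases p; cases r) auto
  have l: "(flip_op ** B) $ p $ r = B $ prod.swap p $ r" for B :: "complex ^ ('a \<times> 'a) ^ ('a \<times> 'a)" and p r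
    unfolding matrix_matrix_mult_def flip_op_def vec_lambda_beta sw [of p]
    by (simp add: if_distrib [of "\<lambda>x. x * _"] cong: if_cong)
  have r: "(B ** flip_op) $ r $ q = B $ r $ prod.swap q" for B :: "complex ^ ('a \<times> 'a) ^ ('a \<times> 'a)" and q r
    unfolding matrix_matrix_mult_def flip_op_def vec_lambda_beta
    by (simp add: if_distrib [of "\<lambda>x. _ * x"] cong: if_cong)
  show ?thesis unfolding r l ..
qed

lemma flip_symmetric_mult:
  assumes "flip_symmetric A" "flip_symmetric B"
  shows "flip_symmetric (A ** B)"
  unfolding flip_symmetric_def
proof (intro allI)
  fix p q :: "'a \<times> 'a"
  have AB: "A $ prod.swap p $ prod.swap q = A $ p $ q" "B $ prod.swap p $ prod.swap q = B $ p $ q" for p q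
    using assms unfolding flip_symmetric_def by blast+
  have "(A ** B) $ prod.swap p $ prod.swap q
      = (\<Sum>r\<in>UNIV. A $ prod.swap p $ prod.swap r * B $ prod.swap r $ prod.swap q)"
    unfolding matrix_matrix_mult_def vec_lambda_beta
    by (rule sum.reindex_bij_witness [of _ prod.swap prod.swap]) auto
  thus "(A ** B) $ prod.swap p $ prod.swap q = (A ** B) $ p $ q"
    by (simp only: AB) (simp add: matrix_matrix_mult_def)
qed

lemma flip_symmetric_kron_sum: "flip_symmetric (kron X (mat 1) + kron (mat 1) X)"
  by (simp add: flip_symmetric_def kron_def add.commute mult.commute)

lemma flip_symmetric_obs_pair:
  assumes "flip_symmetric A"
  shows "flip_symmetric (obs_pair A m)"
proof -
  let ?k = "kron (op_log m) (mat 1) + kron (mat 1) (op_log m)"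
  have "flip_symmetric (?k ** A)" "flip_symmetric (A ** ?k)"
    by (intro flip_symmetric_mult assms flip_symmetric_kron_sum)+
  hence "flip_symmetric (mat \<i> ** commutator ?k A)"
    by (simp add: flip_symmetric_def commutator_def)
  thus ?thesis
    using flip_symmetric_kron_sum [of "obs_site A m"]
    unfolding obs_pair_def by (simp add: flip_symmetric_def)
qed

section \<open>Integrating out one site\<close>

text \<open>Independence of the sites in a product state. Averaging row and column indices over the
  coordinate \<open>j\<close> multiplies both traces by \<open>CARD('d)\<^sup>2\<close>, after which
  each is a one-site trace times the same number.\<close>

lemma trace_site_op_trivial:
  fixes R :: "('n::finite \<Rightarrow> 'd::finite) cmat"
  assumes tr: "trace m = 1" and R: "trivial_at j R"
  shows "trace (tensor_power m ** site_op Y j ** R) = trace (m ** Y) * trace (tensor_power m ** R)"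
proof -
  let ?d = "of_nat CARD('d) :: complex"
  define \<tau> where "\<tau> f g = (\<Prod>k\<in>UNIV - {j}. m $ f k $ g k)" for f g :: "'n \<Rightarrow> 'd"
  have \<tau>: "\<tau> (f(j := a)) (g(j := b)) = \<tau> f g" for f g a b
    unfolding \<tau>_def by (intro prod.cong) auto
  \<comment> \<open>The contribution of the other sites. \<open>undefined\<close> is an arbitrary
    reference value at site \<open>j\<close>, on which the entries of \<open>R\<close> do not
    depend.\<close>
  define \<kappa> where "\<kappa> = (\<Sum>f\<in>UNIV. \<Sum>g\<in>UNIV. \<tau> f g * R $ (g(j := undefined)) $ (f(j := undefined)))"
  have Z: "?d * (?d * trace (tensor_op ((\<lambda>_. m)(j := Z)) ** R)) = trace Z * \<kappa>" for Z
  proof -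
    have "?d * (?d * trace (tensor_op ((\<lambda>_. m)(j := Z)) ** R))
        = ?d * (\<Sum>f\<in>UNIV. ?d * (\<Sum>g\<in>UNIV. Z $ f j $ g j * \<tau> f g * R $ g $ f))"
      by (simp add: trace_def matrix_matrix_mult_def tensor_op_upd_nth \<tau>_def sum_distrib_left)
    also have "\<dots> = (\<Sum>f\<in>UNIV. \<Sum>a\<in>UNIV. \<Sum>g\<in>UNIV. \<Sum>c\<in>UNIV. (Z $ a $ c * \<tau> f g) * R $ (g(j := c)) $ (f(j := a)))"
      unfolding sum_update_average [symmetric, of _ j] by (simp add: \<tau>)
    also have "\<dots> = (\<Sum>f\<in>UNIV. \<Sum>a\<in>UNIV. \<Sum>g\<in>UNIV. Z $ a $ a * \<tau> f g * R $ (g(j := undefined)) $ (f(j := undefined)))"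
      unfolding trivial_at_sum_upd(2) [OF R, where b = undefined] ..
    also have "\<dots> = trace Z * \<kappa>"
      by (subst sum.swap)
         (simp add: trace_def \<kappa>_def sum_product sum_distrib_left [of "Z $ _ $ _"] mult.assoc)
    finally show ?thesis .
  qed
  have "trace (tensor_power m ** R) * ?d\<^sup>2 = \<kappa>"
    using Z [of m, unfolded fun_upd_triv [of "\<lambda>_. m" j]] tr
    by (simp add: tensor_power_def power2_eq_square mult_ac)
  moreover have "trace (tensor_power m ** site_op Y j ** R) * ?d\<^sup>2 = trace (m ** Y) * \<kappa>"
    using Z [of "m ** Y"] by (simp add: site_op_mult_tensor_power power2_eq_square mult_ac)
  ultimately have "trace (tensor_power m ** site_op Y j ** R) * ?d\<^sup>2
      = trace (m ** Y) * trace (tensor_power m ** R) * ?d\<^sup>2" by (simp only: mult.assoc)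
  thus ?thesis by simp
qed

lemma trivial_at_site_op: "j \<noteq> l \<Longrightarrow> trivial_at j (site_op X l)"
  by (auto simp: trivial_at_def site_op_nth)

lemma pair_op_sum: "pair_op (\<Sum>i\<in>S. G i) l l' = (\<Sum>i\<in>S. pair_op (G i) l l')"
  by (induction S rule: infinite_finite_induct) (auto simp: pair_op_add, simp_all add: pair_op_def vec_eq_iff)

definition matrix_unit :: "'d \<Rightarrow> 'd \<Rightarrow> 'd::finite cmat" where
  "matrix_unit c c' = (\<chi> i j. if i = c \<and> j = c' then 1 else 0)"

lemma sum_matrix_unit_nth:
  "(\<Sum>q\<in>UNIV. matrix_unit (fst q) (snd q) $ a $ b * f q) = f (a, b)"
proof -
  have "(\<Sum>q\<in>UNIV. matrix_unit (fst q) (snd q) $ a $ b * f q) = (\<Sum>q\<in>UNIV. if q = (a, b) then f q else 0)"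
    by (intro sum.cong refl) (auto simp: matrix_unit_def prod_eq_iff)
  thus ?thesis by simp
qed

text \<open>Writing \<open>G\<close> as a sum of products isolates the factor at the site \<open>j\<close>.\<close>

lemma trace_pair_op_trivial:
  fixes m :: "'d::finite cmat" and R R' :: "('n::finite \<Rightarrow> 'd) cmat"
  assumes tr: "trace m = 1" and R: "trivial_at j R" "trivial_at j R'"
    and e: "l \<noteq> l'" "j = l \<or> j = l'"
    and z: "mean_field_potential G m = 0" and fl: "flip_symmetric G"
  shows "trace (tensor_power m ** (R ** pair_op G l l' ** R')) = 0"
proof -
  \<comment> \<open>The block of \<open>G\<close> with its first-factor indices fixed to
    \<open>q\<close>; its expectation in \<open>m\<close> is the entry of
    \<open>mean_field_potential G m\<close> at \<open>q\<close>, hence 0.\<close>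
  define B where "B q = (\<chi> a b. G $ (fst q, a) $ (snd q, b))" for q
  let ?E = "\<lambda>q. matrix_unit (fst q) (snd q)"
  have B0: "trace (m ** B q) = 0" for q
    using arg_cong [OF z, of "\<lambda>M. M $ fst q $ snd q"]
    by (simp add: mean_field_potential_nth trace_def matrix_matrix_mult_def B_def)
  have sw: "G $ (a, c) $ (b, c') = G $ (c, a) $ (c', b)" for a b c c'
    using fl [unfolded flip_symmetric_def, rule_format, of "(c, a)" "(c', b)"] by simp
  obtain k where k: "k \<noteq> j" and G: "pair_op G l l' = (\<Sum>q\<in>UNIV. site_op (B q) j ** site_op (?E q) k)"
  proof (cases "j = l")
    case True
    have "G = (\<Sum>q\<in>UNIV. kron (B q) (?E q))"
      by (simp add: vec_eq_iff kron_def B_def mult.commute [of "G $ _ $ _"] sum_matrix_unit_nth sw)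
    hence "pair_op G l l' = (\<Sum>q\<in>UNIV. pair_op (kron (B q) (?E q)) l l')" by (simp add: pair_op_sum [symmetric])
    also have "\<dots> = (\<Sum>q\<in>UNIV. site_op (B q) l ** site_op (?E q) l')"
      unfolding site_op_eq_pair_op [OF e(1)] pair_op_mult [OF e(1)] kron_mult_kron by simp
    finally show thesis using that [of l'] e(1) True by simp
  next
    case False
    have "G = (\<Sum>q\<in>UNIV. kron (?E q) (B q))"
      by (simp add: vec_eq_iff kron_def B_def sum_matrix_unit_nth)
    hence "pair_op G l l' = (\<Sum>q\<in>UNIV. pair_op (kron (?E q) (B q)) l l')" by (simp add: pair_op_sum [symmetric])
    also have "\<dots> = (\<Sum>q\<in>UNIV. site_op (B q) l' ** site_op (?E q) l)"
      unfolding site_op_eq_pair_op [OF e(1)] pair_op_mult [OF e(1)] kron_mult_kron by simp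
    finally show thesis using that [of l] e False by simp
  qed
  \<comment> \<open>The factor at \<open>j\<close> commutes with \<open>R\<close> and moves next to
    the product state; everything else is trivial at \<open>j\<close>.\<close>
  have "tensor_power m ** (R ** (site_op (B q) j ** site_op (?E q) k) ** R')
      = tensor_power m ** site_op (B q) j ** (R ** site_op (?E q) k ** R')" for q
    using site_op_commute_trivial [OF R(1), of "B q"] by (simp only: matrix_mul_assoc)
       (simp only: matrix_mul_assoc [symmetric])
  moreover have "trivial_at j (R ** site_op (?E q) k ** R')" for q
    using k by (intro trivial_at_mult R trivial_at_site_op) auto
  ultimately have "trace (tensor_power m ** (R ** (site_op (B q) j ** site_op (?E q) k) ** R')) = 0" for q
    by (simp add: trace_site_op_trivial [OF tr] B0)
  moreover have "trace (\<Sum>q\<in>S. X q) = (\<Sum>q\<in>S. trace (X q))" for S :: "('d \<times> 'd) set" and X :: "_ \<Rightarrow> ('n \<Rightarrow> 'd) cmat"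
    by (simp add: trace_def sum_component sum.swap [of _ S])
  ultimately show ?thesis
    unfolding G matrix_sum_left matrix_sum_right by simp
qed

section \<open>Exponential moments by counting edge lists\<close>

section \<open>Moments of the mean-field interaction in the product state\<close>

type_synonym 'n edge = "'n \<times> 'n"

definition ends :: "'n edge \<Rightarrow> 'n set" where "ends e = {fst e, snd e}"

definition pair_prod ::
  "complex ^ ('d \<times> 'd) ^ ('d \<times> 'd) \<Rightarrow> 'n edge list \<Rightarrow> ('n::finite \<Rightarrow> 'd::finite) cmat" where
  "pair_prod G es = foldr (\<lambda>e X. pair_op G (fst e) (snd e) ** X) es (mat 1)"

lemma pair_prod_simps [simp]:
  "pair_prod G [] = mat 1"
  "pair_prod G (e # es) = pair_op G (fst e) (snd e) ** pair_prod G es"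
  by (simp_all add: pair_prod_def)

lemma pair_prod_append: "pair_prod G (es @ es') = pair_prod G es ** pair_prod G es'"
  by (induction es) (simp_all add: matrix_mul_assoc)

lemma trivial_at_pair_prod: "j \<notin> (\<Union>e\<in>set es. ends e) \<Longrightarrow> trivial_at j (pair_prod G es)"
proof (induction es)
  case (Cons e es)
  thus ?case by (auto simp: ends_def intro!: trivial_at_mult trivial_at_pair_op)
qed (simp add: trivial_at_one)

text \<open>Pair operators sharing a site need not commute, so the expansion runs over ordered lists
  of edges.\<close>

lemma mpow_sum_pair_op:
  assumes "finite E"
  shows "mpow (\<Sum>e\<in>E. pair_op G (fst e) (snd e)) k
    = (\<Sum>es | set es \<subseteq> E \<and> length es = k. pair_prod G es)"
proof (induction k)
  case 0
  have "{es. set es \<subseteq> E \<and> length es = 0} = {[]}" by auto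
  thus ?case by simp
next
  case (Suc k)
  let ?L = "{es. set es \<subseteq> E \<and> length es = k}"
  have "(\<Sum>es | set es \<subseteq> E \<and> length es = Suc k. pair_prod G es)
      = (\<Sum>(es, e)\<in>?L \<times> E. pair_prod G (e # es))"
    unfolding lists_length_Suc_eq
    by (subst sum.reindex) (auto simp: inj_on_def case_prod_unfold)
  also have "\<dots> = (\<Sum>es\<in>?L. \<Sum>e\<in>E. pair_op G (fst e) (snd e) ** pair_prod G es)"
    by (simp add: sum.cartesian_product)
  also have "\<dots> = (\<Sum>e\<in>E. pair_op G (fst e) (snd e)) ** mpow (\<Sum>e\<in>E. pair_op G (fst e) (snd e)) k"
    unfolding Suc.IH matrix_sum_right matrix_sum_left ..
  finally show ?case by (simp add: mpow_Suc)
qed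

lemma op_norm_pair_prod:
  assumes "\<And>e. e \<in> set es \<Longrightarrow> fst e \<noteq> snd e"
  shows "op_norm (pair_prod G es) \<le> op_norm G ^ length es"
  using assms
proof (induction es)
  case Nil
  have "op_norm (mat 1 :: ('a \<Rightarrow> 'b) cmat) \<le> 1" by (rule op_norm_leI) simp
  thus ?case by simp
next
  case (Cons e es)
  have "op_norm (pair_prod G (e # es)) \<le> op_norm (pair_op G (fst e) (snd e)) * op_norm (pair_prod G es)"
    by (simp add: op_norm_mult)
  also have "\<dots> \<le> op_norm G * op_norm G ^ length es"
    using Cons by (intro mult_mono op_norm_pair_op op_norm_nonneg) auto
  finally show ?case by simp
qed

lemma sum_incidences_le: "(\<Sum>j\<in>(UNIV :: 'n::finite set). length (filter (\<lambda>e. j \<in> ends e) es)) \<le> 2 * length es"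
proof (induction es)
  case (Cons e es)
  have "(\<Sum>j\<in>(UNIV :: 'n set). length (filter (\<lambda>e. j \<in> ends e) (e # es)))
      = (\<Sum>j\<in>UNIV. (if j \<in> ends e then 1 else 0) + length (filter (\<lambda>e. j \<in> ends e) es))"
    by (intro sum.cong) auto
  also have "\<dots> = card (ends e) + (\<Sum>j\<in>UNIV. length (filter (\<lambda>e. j \<in> ends e) es))"
    by (simp add: sum.distrib sum.If_cases)
  also have "card (ends e) \<le> 2" by (simp add: ends_def card_insert_if)
  finally show ?case using Cons by simp
qed simp

text \<open>A site that lies on exactly one edge of the product can be integrated out, and the centred
  interaction has vanishing partial expectation at either end.\<close>

lemma trace_pair_prod_eq_0:
  fixes m :: "'d::finite cmat" and es :: "'n::finite edge list"
  assumes tr: "trace m = 1" and z: "mean_field_potential G m = 0" and fl: "flip_symmetric G"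
    and ne: "\<And>e. e \<in> set es \<Longrightarrow> fst e \<noteq> snd e"
    and card: "length es < card (\<Union>e\<in>set es. ends e)"
  shows "trace (tensor_power m ** pair_prod G es) = 0"
proof -
  let ?V = "\<Union>e\<in>set es. ends e" and ?n = "\<lambda>j. length (filter (\<lambda>e. j \<in> ends e) es)"
  \<comment> \<open>Double counting: if every touched site had two incidences, twice the number of
    sites would be at most twice the number of edges.\<close>
  have "\<exists>j\<in>?V. ?n j < 2"
  proof (rule ccontr)
    assume "\<not> (\<exists>j\<in>?V. ?n j < 2)"
    hence "(\<Sum>j\<in>?V. 2) \<le> (\<Sum>j\<in>?V. ?n j)" by (intro sum_mono) (meson not_less)
    also have "\<dots> \<le> (\<Sum>j\<in>UNIV. ?n j)" by (intro sum_mono2) auto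
    also have "\<dots> \<le> 2 * length es" by (rule sum_incidences_le)
    finally show False using card by simp
  qed
  then obtain j where j: "j \<in> ?V" "?n j < 2" by blast
  have "filter (\<lambda>e. j \<in> ends e) es \<noteq> []" using j(1) by (auto simp: filter_empty_conv)
  then obtain e where "filter (\<lambda>e. j \<in> ends e) es = [e]"
    using j(2) by (cases "filter (\<lambda>e. j \<in> ends e) es") auto
  then obtain us vs where split: "es = us @ e # vs" "\<forall>u\<in>set us. j \<notin> ends u" "j \<in> ends e"
      "filter (\<lambda>e. j \<in> ends e) vs = []"
    by (auto simp: filter_eq_Cons_iff)
  have t: "trivial_at j (pair_prod G us)" "trivial_at j (pair_prod G vs)"
    using split by (auto intro!: trivial_at_pair_prod simp: filter_empty_conv)
  have e: "fst e \<noteq> snd e" using ne split(1) by simp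
  have "pair_prod G es = pair_prod G us ** pair_op G (fst e) (snd e) ** pair_prod G vs"
    by (simp add: split(1) pair_prod_append matrix_mul_assoc)
  thus ?thesis
    using trace_pair_op_trivial [OF tr t e _ z fl] split(3) by (auto simp: ends_def)
qed

text \<open>For k up to N, edges with at most k ends all lie in U \<times> U for some set U of
  exactly k sites, which offers k^2 ordered pairs; overlaps between different U only overcount. For
  larger k no such U exists, and all N^2 pairs are allowed.\<close>

lemma card_few_vertices:
  fixes E :: "'n::finite edge set"
  shows "card {es. set es \<subseteq> E \<and> length es = k \<and> card (\<Union>e\<in>set es. ends e) \<le> k}
    \<le> (if k \<le> CARD('n) then (CARD('n) choose k) * (k\<^sup>2) ^ k else (CARD('n)\<^sup>2) ^ k)"
proof (cases "k \<le> CARD('n)")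
  case True
  let ?U = "{U :: 'n set. card U = k}" and ?L = "\<lambda>U :: 'n set. {es. set es \<subseteq> U \<times> U \<and> length es = k}"
  have sub: "{es. set es \<subseteq> E \<and> length es = k \<and> card (\<Union>e\<in>set es. ends e) \<le> k} \<subseteq> (\<Union>U\<in>?U. ?L U)"
  proof
    fix es assume "es \<in> {es. set es \<subseteq> E \<and> length es = k \<and> card (\<Union>e\<in>set es. ends e) \<le> k}"
    hence es: "length es = k" "card (\<Union>e\<in>set es. ends e) \<le> k" by auto
    obtain U :: "'n set" where U: "(\<Union>e\<in>set es. ends e) \<subseteq> U" "card U = k"
      using exists_subset_between [OF es(2), of UNIV] True by auto
    have "set es \<subseteq> U \<times> U" using U(1) by (auto simp: ends_def)
    thus "es \<in> (\<Union>U\<in>?U. ?L U)" using U(2) es(1) by blast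
  qed
  have fin: "finite (?L U)" for U by (intro finite_lists_length_eq) simp
  have "card {es. set es \<subseteq> E \<and> length es = k \<and> card (\<Union>e\<in>set es. ends e) \<le> k} \<le> card (\<Union>U\<in>?U. ?L U)"
    using sub fin by (intro card_mono) auto
  also have "\<dots> \<le> (\<Sum>U\<in>?U. card (?L U))" by (intro card_UN_le) simp
  also have "\<dots> = (\<Sum>U\<in>?U. (k\<^sup>2) ^ k)"
    by (intro sum.cong refl) (simp add: card_lists_length_eq card_cartesian_product power2_eq_square)
  also have "\<dots> = (CARD('n) choose k) * (k\<^sup>2) ^ k"
    using n_subsets [of "UNIV :: 'n set" k] by simp
  finally show ?thesis using True by simp
next
  case False
  have "card {es. set es \<subseteq> E \<and> length es = k \<and> card (\<Union>e\<in>set es. ends e) \<le> k}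
      \<le> card {es. set es \<subseteq> (UNIV :: 'n edge set) \<and> length es = k}"
    by (intro card_mono finite_lists_length_eq) auto
  also have "\<dots> = (CARD('n)\<^sup>2) ^ k"
    using card_lists_length_eq [of "UNIV :: 'n edge set" k] by (simp add: power2_eq_square card_cartesian_product UNIV_Times_UNIV [symmetric] del: UNIV_Times_UNIV)
  finally show ?thesis using False by simp
qed

text \<open>A single term of the exponential series at k is at most its sum.\<close>

lemma power_le_fact_exp: "real k ^ k \<le> fact k * exp (real k)"
proof -
  have "real k ^ k /\<^sub>R fact k \<le> (\<Sum>n. real k ^ n /\<^sub>R fact n)"
    using sum_le_suminf [OF sums_summable [OF exp_converges [of "real k"]], of "{k}"] by simp
  also have "\<dots> = exp (real k)" by (rule sums_unique [OF exp_converges, symmetric])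
  finally show ?thesis by (simp add: field_simps)
qed

text \<open>For k up to N, k^(2k) <= (k!)^2 e^(2k), and the binomial coefficient absorbs one
  factorial because its product with k! is at most N^k. For k > N, one factor N^k is bounded by k^k
  <= k! e^k.\<close>

lemma count_bound:
  assumes "0 < N"
  shows "real (if k \<le> N then (N choose k) * (k\<^sup>2) ^ k else (N\<^sup>2) ^ k)
    \<le> real N ^ k * fact k * exp 2 ^ k"
proof -
  have e: "exp (real k) * exp (real k) = exp 2 ^ k"
    by (simp add: exp_add [symmetric] exp_of_nat_mult [symmetric])
  show ?thesis
  proof (cases "k \<le> N")
    case True
    have "real (N choose k) * fact k \<le> real N ^ k"
      using binomial_fact_pow [of N k] by (metis of_nat_fact of_nat_le_iff of_nat_mult of_nat_power)
    hence "real (N choose k) * fact k * (real k ^ k * real k ^ k)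
        \<le> real N ^ k * ((fact k * exp (real k)) * (fact k * exp (real k)))"
      by (intro mult_mono power_le_fact_exp) auto
    hence "fact k * (real (N choose k) * (real k ^ k * real k ^ k))
        \<le> fact k * (real N ^ k * fact k * (exp (real k) * exp (real k)))"
      by (simp only: mult_ac)
    hence "real (N choose k) * (real k ^ k * real k ^ k)
        \<le> real N ^ k * fact k * (exp (real k) * exp (real k))"
      by (rule mult_left_le_imp_le) simp
    thus ?thesis using True e by (simp add: power2_eq_square power_mult_distrib)
  next
    case False
    have "real N ^ k * real N ^ k \<le> real N ^ k * (fact k * exp (real k))"
      using False by (intro mult_left_mono order_trans [OF power_mono power_le_fact_exp]) auto
    also have "\<dots> \<le> real N ^ k * (fact k * (exp (real k) * exp (real k)))"
      by (intro mult_left_mono) auto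
    finally show ?thesis using False e by (simp add: power2_eq_square power_mult_distrib mult.assoc)
  qed
qed

lemma mpow_scaleR: "mpow (r *\<^sub>R X) k = r ^ k *\<^sub>R mpow X k"
  by (induction k) (simp_all add: mpow_Suc matrix_scaleR_left matrix_scaleR_right)

text \<open>In the counting estimate, N^k cancels the normalisation of the interaction and k!
  cancels the factorial of the exponential series. The result is a geometric bound uniform in
  N.\<close>

lemma moment_bound:
  fixes m :: "'d::finite cmat" and E :: "'n::finite edge set"
  assumes m: "m \<in> density_ops" and z: "mean_field_potential G m = 0" and fl: "flip_symmetric G"
    and E: "\<And>e. e \<in> E \<Longrightarrow> fst e \<noteq> snd e" and q: "0 \<le> q" and G: "op_norm G \<le> \<gamma>"
  shows "\<bar>q ^ k / fact k * rtr (tensor_power m **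
      mpow ((1 / real CARD('n)) *\<^sub>R (\<Sum>e\<in>E. pair_op G (fst e) (snd e)) :: ('n \<Rightarrow> 'd) cmat) k)\<bar>
    \<le> (q * \<gamma> * exp 2) ^ k"
proof -
  let ?N = "real CARD('n)" and ?\<sigma> = "tensor_power m :: ('n \<Rightarrow> 'd) cmat"
  let ?L = "{es. set es \<subseteq> E \<and> length es = k}" and ?M = "{es. set es \<subseteq> E \<and> length es = k \<and> card (\<Union>e\<in>set es. ends e) \<le> k}"
  have tr: "trace m = 1" using m by (simp add: density_ops_def)
  have \<gamma>: "0 \<le> \<gamma>" using G op_norm_nonneg [of G] by linarith
  have fin: "finite ?L" by (intro finite_lists_length_eq) simp
  have "\<bar>rtr (?\<sigma> ** mpow (\<Sum>e\<in>E. pair_op G (fst e) (snd e)) k)\<bar> = \<bar>\<Sum>es\<in>?L. rtr (?\<sigma> ** pair_prod G es)\<bar>"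
    by (simp add: mpow_sum_pair_op matrix_sum_right rtr_sum)
  also have "(\<Sum>es\<in>?L. rtr (?\<sigma> ** pair_prod G es)) = (\<Sum>es\<in>?M. rtr (?\<sigma> ** pair_prod G es))"
  proof (rule sum.mono_neutral_right [OF fin])
    show "\<forall>es\<in>?L - ?M. rtr (?\<sigma> ** pair_prod G es) = 0"
    proof
      fix es assume es: "es \<in> ?L - ?M"
      have "trace (?\<sigma> ** pair_prod G es) = 0"
        using es E by (intro trace_pair_prod_eq_0 [OF tr z fl]) auto
      thus "rtr (?\<sigma> ** pair_prod G es) = 0" by (simp add: rtr_def)
    qed
  qed auto
  also have "\<bar>\<Sum>es\<in>?M. rtr (?\<sigma> ** pair_prod G es)\<bar> \<le> (\<Sum>es\<in>?M. \<gamma> ^ k)"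
  proof (rule order_trans [OF sum_abs sum_mono])
    fix es assume es: "es \<in> ?M"
    have "\<bar>rtr (?\<sigma> ** pair_prod G es)\<bar> \<le> op_norm (pair_prod G es :: ('n \<Rightarrow> 'd) cmat)"
      by (rule rtr_state_le_op_norm [OF tensor_power_density [OF m]])
    also have "\<dots> \<le> op_norm G ^ length es" using es E by (intro op_norm_pair_prod) auto
    also have "\<dots> \<le> \<gamma> ^ k" using es G by (auto intro!: power_mono op_norm_nonneg)
    finally show "\<bar>rtr (?\<sigma> ** pair_prod G es)\<bar> \<le> \<gamma> ^ k" .
  qed
  also have "\<dots> = real (card ?M) * \<gamma> ^ k" by simp
  also have "\<dots> \<le> (?N ^ k * fact k * exp 2 ^ k) * \<gamma> ^ k"
  proof (intro mult_right_mono)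
    have "real (card ?M) \<le> real (if k \<le> CARD('n) then (CARD('n) choose k) * (k\<^sup>2) ^ k else (CARD('n)\<^sup>2) ^ k)"
      using card_few_vertices [of E k] by (simp only: of_nat_le_iff)
    also have "\<dots> \<le> ?N ^ k * fact k * exp 2 ^ k" by (intro count_bound) simp
    finally show "real (card ?M) \<le> ?N ^ k * fact k * exp 2 ^ k" .
  qed (simp add: \<gamma>)
  finally have "\<bar>rtr (?\<sigma> ** mpow (\<Sum>e\<in>E. pair_op G (fst e) (snd e)) k)\<bar> \<le> (?N ^ k * fact k * exp 2 ^ k) * \<gamma> ^ k" .
  hence "(q ^ k / fact k * (1 / ?N) ^ k) * \<bar>rtr (?\<sigma> ** mpow (\<Sum>e\<in>E. pair_op G (fst e) (snd e)) k)\<bar>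
      \<le> (q ^ k / fact k * (1 / ?N) ^ k) * ((?N ^ k * fact k * exp 2 ^ k) * \<gamma> ^ k)"
    using q by (intro mult_left_mono) auto
  also have "\<dots> = (q * \<gamma> * exp 2) ^ k"
    by (simp add: power_mult_distrib power_one_over field_simps)
  finally show ?thesis
    using q by (simp add: mpow_scaleR matrix_scaleR_right rtr_scaleR abs_mult mult.assoc)
qed

section \<open>Differential inequality for the truncated entropy and conclusion\<close>

section \<open>The entropy estimate\<close>

lemma self_adjoint_nbody_hamiltonian:
  assumes "self_adjoint H" "self_adjoint A"
  shows "self_adjoint (nbody_hamiltonian H A)"
  using assms
  by (simp add: nbody_hamiltonian_def self_adjoint_def adj_add adj_sum adj_scaleR adj_site_op
      adj_pair_op case_prod_unfold)

lemma J_nbody_rhs_nonpos: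
  assumes "self_adjoint H" "self_adjoint A"
    and o: "pos_semidef \<rho>" "pos_semidef \<sigma>" "optimal s W \<rho> \<sigma>" "0 \<le> s"
  shows "J s W (nbody_rhs H A L \<rho>) (nbody_rhs H A L \<sigma>) \<le> 0"
  unfolding nbody_rhs_def J_add J_sum
  by (intro add_nonpos_nonpos sum_nonpos J_hamiltonian_nonpos J_dissipator_nonpos o
      self_adjoint_nbody_hamiltonian assms)

lemma trunc_deriv_nbody_rhs_nonpos:
  assumes H: "self_adjoint H" "self_adjoint A"
    and \<rho>: "pos_semidef \<rho>" "spec \<rho> P p" and \<sigma>: "pos_def \<sigma>" "spec \<sigma> Q e"
  shows "trunc_deriv S p e P Q (nbody_rhs H A L \<rho>) (nbody_rhs H A L \<sigma>) \<le> 0"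
proof -
  note pe = pos_semidef_spec [OF \<rho>] pos_def_spec [OF \<sigma>]
  have "trunc_deriv S p e P Q (nbody_rhs H A L \<rho>) (nbody_rhs H A L \<sigma>) \<le> integral {0..S} (\<lambda>_. 0)"
    unfolding trunc_deriv_def
  proof (intro integral_le integrable_J_opt_W pe)
    fix r assume "r \<in> {0..S}"
    hence r: "0 \<le> r" by simp
    show "J r (opt_W p e P Q r) (nbody_rhs H A L \<rho>) (nbody_rhs H A L \<sigma>) \<le> 0"
      using r by (intro J_nbody_rhs_nonpos H \<rho> pos_def_imp_pos_semidef \<sigma> optimal_opt_W pe)
  qed (rule integrable_0)
  thus ?thesis by simp
qed

lemma bounded_linear_trunc_deriv:
  assumes "\<And>i. 0 \<le> p i" "\<And>i. 0 < e i"
  shows "bounded_linear (\<lambda>XY. trunc_deriv S p e P Q (fst XY) (snd XY))"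
proof -
  have "linear (\<lambda>XY. trunc_deriv S p e P Q (fst XY) (snd XY))"
    by (intro linearI) (simp_all add: trunc_deriv_add [OF assms] trunc_deriv_scaleR)
  thus ?thesis by (simp add: linear_conv_bounded_linear)
qed

lemma continuous_on_fluctuation:
  fixes m :: "real \<Rightarrow> 'd::finite cmat"
  assumes "continuous_on S m"
  shows "continuous_on S (\<lambda>s. fluctuation A (m s) :: ('n::{finite,linorder} \<Rightarrow> 'd) cmat)"
proof -
  have "continuous_on S (\<lambda>s. mean_field_potential A (m s))"
    unfolding mean_field_potential_def ptrace2_def matrix_matrix_mult_def kron_def vec_lambda_beta
    by (intro continuous_intros continuous_on_component assms)
  moreover have "site_op X l = (\<chi> f g. X $ f l $ g l * (\<Prod>k\<in>UNIV - {l}. mat 1 $ f k $ g k))"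
    for X :: "'d cmat" and l :: 'n
    by (simp add: vec_eq_iff site_op_def tensor_op_upd_nth)
  ultimately have "continuous_on S (\<lambda>s. site_op (mean_field_potential A (m s)) l :: ('n \<Rightarrow> 'd) cmat)" for l
    by (simp only:) (intro continuous_intros continuous_on_component)
  thus ?thesis unfolding fluctuation_def by (intro continuous_intros)
qed

lemma density_eigenvalue_le_one:
  assumes "m \<in> density_ops" "spec m P p"
  shows "p i \<le> 1"
proof -
  have p: "0 \<le> p i" for i using pos_semidef_spec [OF density_pos_semidef [OF assms(1)] assms(2)] .
  have "p i \<le> sum p UNIV" by (intro member_le_sum) (auto simp: p)
  thus ?thesis using spec_rtr [OF assms(2)] density_rtr [OF assms(1)] by simp
qed

text \<open>The derivative is that of the truncated entropy, whereas the Gibbs inequality brings in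
  the full entropy \<open>d\<close>. This mismatch is paid for later, when \<open>d\<close> is
  bounded by the truncated value plus 1/S.\<close>

lemma trunc_deriv_rhs_le:
  fixes \<rho> :: "('n::{finite,linorder} \<Rightarrow> 'd::finite) cmat"
  assumes sa: "self_adjoint H" "self_adjoint A" and fl: "flip_symmetric A"
    and \<rho>: "\<rho> \<in> density_ops" "spec \<rho> P p"
    and m: "m \<in> density_ops" "pos_def m" and Q: "spec (tensor_power m) Q e"
    and K: "op_norm (op_log m) \<le> K" and q: "0 < q" and x: "q * (8 * K * op_norm A) * exp 2 < 1"
    and d: "rel_entropy \<rho> (tensor_power m) = ereal d" and S: "0 < S"
  shows "trunc_deriv S p e P Q (nbody_rhs H A L \<rho>)
      (nbody_rhs H A L (tensor_power m) + mat \<i> ** commutator (fluctuation A m) (tensor_power m))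
    \<le> (d - ln (1 - q * (8 * K * op_norm A) * exp 2)) / q + 2 * K * op_norm A
      + (real CARD('n \<Rightarrow> 'd))^5 * norm (fluctuation A m :: ('n \<Rightarrow> 'd) cmat) / S"
proof -
  let ?\<sigma> = "tensor_power m :: ('n \<Rightarrow> 'd) cmat" and ?V = "fluctuation A m :: ('n \<Rightarrow> 'd) cmat"
  let ?N = "real CARD('n)" and ?E = "{e :: 'n edge. fst e < snd e}"
  let ?X = "(1 / ?N) *\<^sub>R (\<Sum>e\<in>?E. pair_op (obs_pair A m) (fst e) (snd e)) :: ('n \<Rightarrow> 'd) cmat"
  let ?x = "q * (8 * K * op_norm A) * exp 2"
  note sm = density_self_adjoint [OF m(1)]
  have \<sigma>: "?\<sigma> \<in> density_ops" "pos_def ?\<sigma>" by (intro tensor_power_density tensor_power_pos_def m)+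
  note pe = pos_semidef_spec [OF density_pos_semidef [OF \<rho>(1)] \<rho>(2)] pos_def_spec [OF \<sigma>(2) Q]
  have K0: "0 \<le> K" using K op_norm_nonneg [of "op_log m"] by linarith
  have x0: "0 \<le> ?x" using q K0 op_norm_nonneg [of A] by simp
  have X: "self_adjoint ?X"
    using self_adjoint_obs_pair [OF sa(2) sm] by (simp add: self_adjoint_def adj_scaleR adj_sum adj_pair_op)
  have "rtr (\<rho> ** ?X) \<le> (d - ln (1 - ?x)) / q"
  proof -
    let ?c = "\<lambda>k. q ^ k / fact k * rtr (?\<sigma> ** mpow ?X k)"
    have c: "\<bar>?c k\<bar> \<le> ?x ^ k" for k
      by (intro moment_bound m(1) mean_field_potential_obs_pair flip_symmetric_obs_pair fl
          op_norm_obs_pair sa K less_imp_le [OF q]) auto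
    \<comment> \<open>Domination of the moment series by this one gives both its convergence and the
      bound 1/(1 - x) on its sum.\<close>
    have geo: "(\<lambda>k. ?x ^ k) sums (1 / (1 - ?x))" using x x0 by (intro geometric_sums) simp
    have "summable ?c" using c by (intro summable_comparison_test' [OF sums_summable [OF geo], of 0]) auto
    then obtain Z where Z: "?c sums Z" by (auto simp: summable_def)
    have "?c k \<le> ?x ^ k" for k using c [of k] by linarith
    from sums_le [OF this Z geo] have "Z \<le> 1 / (1 - ?x)" .
    moreover note gibbs = gibbs_variational [OF \<rho>(1) \<sigma> X Z d]
    ultimately have "ln Z \<le> ln (1 / (1 - ?x))" by (intro ln_mono) auto
    also have "\<dots> = - ln (1 - ?x)" using x by (simp add: ln_div)
    finally have "q * rtr (\<rho> ** ?X) \<le> d - ln (1 - ?x)" using gibbs(2) by linarith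
    thus ?thesis using q by (simp add: pos_le_divide_eq mult.commute)
  qed
  \<comment> \<open>N sites contribute at most 2 K |A| each, and the prefactor 1/N leaves a bound
    independent of N.\<close>
  moreover have "- rtr (\<rho> ** ((1 / ?N) *\<^sub>R (\<Sum>l\<in>UNIV. site_op (obs_site A m) l))) \<le> 2 * K * op_norm A"
  proof -
    have "\<bar>rtr (\<rho> ** site_op (obs_site A m) l)\<bar> \<le> 2 * K * op_norm A" for l
      using rtr_state_le_op_norm [OF \<rho>(1), of "site_op (obs_site A m) l"] op_norm_site_op [of "obs_site A m" l]
        op_norm_obs_site [OF m(1) sa(2) K] by (meson order_trans)
    hence "(\<Sum>l\<in>(UNIV :: 'n set). - rtr (\<rho> ** site_op (obs_site A m) l)) \<le> (\<Sum>l\<in>(UNIV :: 'n set). 2 * K * op_norm A)"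
      by (intro sum_mono) (simp add: abs_le_iff)
    hence "(1 / ?N) * (\<Sum>l\<in>(UNIV :: 'n set). - rtr (\<rho> ** site_op (obs_site A m) l)) \<le> (1 / ?N) * (?N * (2 * K * op_norm A))"
      by (intro mult_left_mono) auto
    thus ?thesis by (simp add: matrix_scaleR_right matrix_sum_right rtr_scaleR rtr_sum sum_negf)
  qed
  moreover have "mat \<i> ** commutator (op_log ?\<sigma>) ?V
      = ?X - (1 / ?N) *\<^sub>R (\<Sum>l\<in>UNIV. site_op (obs_site A m) l)"
    unfolding commutator_log_fluctuation [OF m(2)] by (simp add: case_prod_unfold)
  ultimately have 1: "rtr (\<rho> ** (mat \<i> ** commutator (op_log ?\<sigma>) ?V)) \<le> (d - ln (1 - ?x)) / q + 2 * K * op_norm A"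
    by (simp only: matrix_diff_ldistrib rtr_diff)
  have "trunc_deriv S p e P Q (nbody_rhs H A L \<rho>) (nbody_rhs H A L ?\<sigma> + mat \<i> ** commutator ?V ?\<sigma>)
      = trunc_deriv S p e P Q (nbody_rhs H A L \<rho>) (nbody_rhs H A L ?\<sigma>)
        + trunc_deriv S p e P Q 0 (mat \<i> ** commutator ?V ?\<sigma>)"
    using trunc_deriv_add [where p = p and e = e and X' = 0] pe by (metis add.right_neutral)
  also have "\<dots> \<le> 0 + (rtr (\<rho> ** (mat \<i> ** commutator (op_log ?\<sigma>) ?V)) + (real CARD('n \<Rightarrow> 'd))^5 * norm ?V / S)"
    by (intro add_mono trunc_deriv_nbody_rhs_nonpos sa density_pos_semidef \<rho> \<sigma> Q
        trunc_deriv_commutator_le pe density_eigenvalue_le_one [OF \<sigma>(1) Q] S)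
  finally show ?thesis using 1 by linarith
qed

text \<open>Eigenvalues of a state are at most 1, so the logarithm is nonpositive and its norm is
  governed by the lower spectral bound exp (- K). For the same reason \<open>lambda_min m0\<close>
  is at most 1, whence \<open>K\<close> is nonnegative.\<close>

lemma mean_field_op_log_bound:
  assumes m0: "m0 \<in> density_ops" "pos_def m0" and L: "0 \<le> T"
    and m: "solves_in_states T (mean_field_rhs H A L) m0 m" and t: "t \<in> {0..T}"
    and Q: "spec (m t) Q e"
  defines "K \<equiv> - ln (lambda_min m0) + (op_norm L)\<^sup>2 * T"
  shows "exp (- K) \<le> e i" and "pos_def (m t)" and "op_norm (op_log (m t)) \<le> K" and "0 \<le> K"
proof -
  obtain P p where P: "spec m0 P p" using spec_exists density_self_adjoint [OF m0(1)] by blast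
  have "Min (range p) \<in> range p" by (intro Min_in) auto
  then obtain j where "Min (range p) = p j" by (meson imageE)
  hence l: "0 < lambda_min m0" "lambda_min m0 \<le> 1"
    using pos_def_spec [OF m0(2) P, of j] density_eigenvalue_le_one [OF m0(1) P, of j]
    by (simp_all add: lambda_min_def spec_real_spectrum [OF P])
  have LT: "(op_norm L)\<^sup>2 * t \<le> (op_norm L)\<^sup>2 * T" using t by (intro mult_left_mono) auto
  have dm: "m t \<in> density_ops" using m t by (auto simp: solves_in_states_def)
  have lo: "exp (- K) \<le> e i" for i
  proof -
    have "exp (- K) = lambda_min m0 * exp (- ((op_norm L)\<^sup>2 * T))"
      using l by (simp add: K_def exp_diff exp_minus exp_ln divide_inverse)
    also have "\<dots> \<le> lambda_min m0 * exp (- ((op_norm L)\<^sup>2 * t))"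
      using l LT by (intro mult_left_mono) auto
    also have "\<dots> \<le> lambda_min (m t)" by (rule mean_field_lambda_min [OF m t])
    also have "\<dots> \<le> e i" by (rule lambda_min_spec_le [OF Q])
    finally show ?thesis .
  qed
  thus "exp (- K) \<le> e i" .
  have pos: "0 < e i" for i using lo [of i] exp_gt_zero [of "- K"] by linarith
  show "pos_def (m t)" using spec_pos_def [OF Q] pos by blast
  have "ln (lambda_min m0) \<le> 0" using l by (simp add: ln_le_zero_iff)
  moreover have "0 \<le> (op_norm L)\<^sup>2 * T" using L by simp
  ultimately show "0 \<le> K" unfolding K_def by linarith
  have "\<bar>ln (e i)\<bar> \<le> K" for i
  proof -
    have "ln (exp (- K)) \<le> ln (e i)" using lo [of i] pos by (intro ln_mono) auto
    moreover have "ln (e i) \<le> 0" using pos density_eigenvalue_le_one [OF dm Q, of i] by (simp add: ln_le_zero_iff)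
    ultimately show ?thesis by simp
  qed
  thus "op_norm (op_log (m t)) \<le> K" by (intro op_norm_spec_le [OF spec_op_log [OF Q]])
qed

text \<open>The estimate for the total entropy, before division by the number of particles. Gronwall
  is applied at a fixed truncation level S = 1/h, with all errors of order h, and h tends to 0 only
  at the end.\<close>

lemma entropy_growth:
  fixes \<rho> :: "real \<Rightarrow> ('n::{finite,linorder} \<Rightarrow> 'd::finite) cmat"
  assumes T: "0 < T" and sa: "self_adjoint H" "self_adjoint A" and fl: "flip_symmetric A"
    and sol\<rho>: "solves_in_states T (nbody_rhs H A L) \<rho>i \<rho>"
    and m0: "m0 \<in> density_ops" "pos_def m0"
    and solm: "solves_in_states T (mean_field_rhs H A L) m0 m"
    and K: "K = - ln (lambda_min m0) + (op_norm L)\<^sup>2 * T"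
    and q: "0 < q" and x: "q * (8 * K * op_norm A) * exp 2 < 1" and t: "t \<in> {0..T}"
    and D0: "rel_entropy (\<rho> 0) (tensor_power (m 0)) = ereal D0"
    and Dt: "rel_entropy (\<rho> t) (tensor_power (m t)) = ereal Dt"
  shows "Dt \<le> exp (t / q) * (D0 + (- ln (1 - q * (8 * K * op_norm A) * exp 2) + 2 * q * op_norm A * K))"
proof -
  let ?I = "{0..T}" and ?\<sigma> = "\<lambda>s. tensor_power (m s) :: ('n \<Rightarrow> 'd) cmat"
  let ?V = "\<lambda>s. fluctuation A (m s) :: ('n \<Rightarrow> 'd) cmat"
  let ?d\<sigma> = "\<lambda>s. nbody_rhs H A L (?\<sigma> s) + mat \<i> ** commutator (?V s) (?\<sigma> s)"
  let ?x = "q * (8 * K * op_norm A) * exp 2" and ?n = "real CARD('n \<Rightarrow> 'd)"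
  have \<rho>: "\<rho> s \<in> density_ops" "(\<rho> has_vector_derivative nbody_rhs H A L (\<rho> s)) (at s within ?I)"
    if "s \<in> ?I" for s using sol\<rho> that by (auto simp: solves_in_states_def)
  have m: "m s \<in> density_ops" "(m has_vector_derivative mean_field_rhs H A L (m s)) (at s within ?I)"
    if "s \<in> ?I" for s using solm that by (auto simp: solves_in_states_def)
  have "\<exists>Q e. spec (m s) Q e" if "s \<in> ?I" for s
    using spec_exists density_self_adjoint [OF m(1) [OF that]] by metis
  then obtain Q e where Q: "\<And>s. s \<in> ?I \<Longrightarrow> spec (m s) (Q s) (e s)" by metis
  have "\<exists>P p. spec (\<rho> s) P p" if "s \<in> ?I" for s
    using spec_exists density_self_adjoint [OF \<rho>(1) [OF that]] by metis
  then obtain P p where P: "\<And>s. s \<in> ?I \<Longrightarrow> spec (\<rho> s) (P s) (p s)" by metis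
  note mb = mean_field_op_log_bound [OF m0 less_imp_le [OF T] solm _ Q, folded K]
  note pm = mb(2) and lm = mb(3)
  let ?Q = "\<lambda>s. tensor_power (Q s) :: ('n \<Rightarrow> 'd) cmat" and ?e = "\<lambda>s f. \<Prod>l\<in>(UNIV :: 'n set). e s (f l)"
  have Q': "spec (?\<sigma> s) (?Q s) (?e s)" if "s \<in> ?I" for s by (rule spec_tensor_power [OF Q [OF that]])
  have \<sigma>: "?\<sigma> s \<in> density_ops" "pos_def (?\<sigma> s)" if "s \<in> ?I" for s
    by (intro tensor_power_density tensor_power_pos_def m pm that)+
  \<comment> \<open>A lower bound for all eigenvalues of the product states, uniform in time: each
    is a product of \<open>CARD('n)\<close> eigenvalues of \<open>m s\<close>.\<close>
  define \<mu> where "\<mu> = exp (- K) ^ CARD('n)"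
  have \<mu>: "0 < \<mu>" "\<mu> \<le> ?e s f" if "s \<in> ?I" for s f
  proof -
    show "0 < \<mu>" by (simp add: \<mu>_def)
    have "(\<Prod>l\<in>(UNIV :: 'n set). exp (- K)) \<le> ?e s f" using mb(1) that by (intro prod_mono) auto
    thus "\<mu> \<le> ?e s f" by (simp add: \<mu>_def)
  qed
  have pe: "0 \<le> p s i" "p s i \<le> 1" "0 < ?e s f" if "s \<in> ?I" for s i f
    using pos_semidef_spec [OF density_pos_semidef [OF \<rho>(1)] P] density_eigenvalue_le_one [OF \<rho>(1) P]
      pos_def_spec [OF \<sigma>(2) Q'] that by auto
  have d\<sigma>: "(?\<sigma> has_vector_derivative
      ?d\<sigma> s) (at s within ?I)"
    if "s \<in> ?I" for s
    using tensor_power_has_vector_derivative [OF m(2) [OF that], where 'n = 'n]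
    unfolding tensor_power_mean_field_rhs .
  have cont: "continuous_on ?I m" "continuous_on ?I \<rho>" "continuous_on ?I ?\<sigma>"
    unfolding continuous_on_eq_continuous_within
    using m(2) \<rho>(2) d\<sigma> has_vector_derivative_continuous by blast+
  obtain V where V: "\<And>s. s \<in> ?I \<Longrightarrow> norm (?V s) \<le> V"
  proof -
    have "compact ((\<lambda>s. ?V s) ` ?I)"
      by (intro compact_continuous_image continuous_on_fluctuation cont) simp
    from compact_imp_bounded [OF this] show thesis using that unfolding bounded_iff by blast
  qed
  \<comment> \<open>Adding this constant to the entropy turns the affine differential inequality
    into a linear one of rate 1/q.\<close>
  define \<kappa> where "\<kappa> = - ln (1 - ?x) + 2 * q * op_norm A * K"
  \<comment> \<open>Collects the errors of order h: 1 from replacing the full entropy by the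
    truncated one, the rest from the commutator term multiplied by \<open>q\<close>.\<close>
  define c where "c = 1 + q * (?n ^ 5 * V)"
  have main: "Dt \<le> exp (t / q) * (D0 + \<kappa> + c * h) - \<kappa> - c * h + h" if h: "0 < h" for h
  proof -
    define S where "S = 1 / h"
    have S: "0 < S" "1 / S = h" using h by (auto simp: S_def)
    define f where "f s = trunc_entropy S (\<rho> s) (?\<sigma> s)" for s
    define \<kappa>' where "\<kappa>' = \<kappa> + c * h"
    \<comment> \<open>One constant serves all base times, because \<open>\<mu>\<close> bounds the
      reference spectra uniformly; this makes \<open>f\<close> continuous.\<close>
    obtain C where C: "\<And>P Q p e X Y. unitary P \<Longrightarrow> unitary (Q :: ('n \<Rightarrow> 'd) cmat) \<Longrightarrow>
       (\<And>i. 0 \<le> p i \<and> p i \<le> 1) \<Longrightarrow> (\<And>i. \<mu> \<le> e i) \<Longrightarrow>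
       \<bar>trunc_deriv S p e P Q X Y\<bar> \<le> C * (norm X + norm Y)"
      using trunc_deriv_bound [of S \<mu>, where 'n = "'n \<Rightarrow> 'd"] S \<mu>(1) t by (metis less_imp_le)
    have diff: "f s - f r \<le> trunc_deriv S (p s) (?e s) (P s) (?Q s) (\<rho> s - \<rho> r) (?\<sigma> s - ?\<sigma> r)"
      if "s \<in> ?I" "r \<in> ?I" for s r
      unfolding f_def using that S
      by (intro trunc_entropy_diff_le density_pos_semidef \<rho> P \<sigma> Q') auto
    have diff': "f s - f r \<le> C * (norm (\<rho> s - \<rho> r) + norm (?\<sigma> s - ?\<sigma> r))" if s: "s \<in> ?I" and r: "r \<in> ?I" for s r
    proof -
      have "\<bar>trunc_deriv S (p s) (?e s) (P s) (?Q s) (\<rho> s - \<rho> r) (?\<sigma> s - ?\<sigma> r)\<bar>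
          \<le> C * (norm (\<rho> s - \<rho> r) + norm (?\<sigma> s - ?\<sigma> r))"
        using P [OF s] Q' [OF s] pe [OF s] \<mu> [OF s] by (intro C) (auto simp: spec_def)
      thus ?thesis using diff [OF s r] by linarith
    qed
    have "f t + \<kappa>' \<le> exp ((1 / q) * t) * (f 0 + \<kappa>')"
    proof (rule gronwall_lower_support [where f = "\<lambda>s. f s + \<kappa>'", OF _ _ t])
      have "continuous_on ?I f"
        unfolding continuous_on_def
      proof (intro ballI)
        fix s assume s: "s \<in> ?I"
        have "((\<lambda>r. C * (norm (\<rho> r - \<rho> s) + norm (?\<sigma> r - ?\<sigma> s)))
            \<longlongrightarrow> C * (norm (\<rho> s - \<rho> s) + norm (?\<sigma> s - ?\<sigma> s))) (at s within ?I)"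
          using cont(2,3) s by (intro tendsto_intros) (auto simp: continuous_on_def)
        hence "((\<lambda>r. C * (norm (\<rho> r - \<rho> s) + norm (?\<sigma> r - ?\<sigma> s))) \<longlongrightarrow> 0) (at s within ?I)" by simp
        moreover have "\<forall>\<^sub>F r in at s within ?I. norm (f r - f s) \<le> C * (norm (\<rho> r - \<rho> s) + norm (?\<sigma> r - ?\<sigma> s))"
          unfolding eventually_at
        proof (intro exI [of _ 1] conjI ballI impI)
          fix r assume r: "r \<in> ?I"
          show "norm (f r - f s) \<le> C * (norm (\<rho> r - \<rho> s) + norm (?\<sigma> r - ?\<sigma> s))"
            using diff' [OF r s] diff' [OF s r] by (simp add: norm_minus_commute abs_le_iff)
        qed simp
        ultimately have "((\<lambda>r. f r - f s) \<longlongrightarrow> 0) (at s within ?I)"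
          by (rule Lim_null_comparison [rotated])
        thus "(f \<longlongrightarrow> f s) (at s within ?I)" by (simp add: LIM_zero_iff)
      qed
      thus "continuous_on ?I (\<lambda>s. f s + \<kappa>')" by (intro continuous_intros)
      fix s assume "0 < s" "s \<le> T"
      hence s: "s \<in> ?I" by simp
      let ?TD = "trunc_deriv S (p s) (?e s) (P s) (?Q s)"
      let ?\<Psi> = "\<lambda>r. ?TD (\<rho> r) (?\<sigma> r)"
      let ?c = "?TD (nbody_rhs H A L (\<rho> s)) (?d\<sigma> s)"
      show "\<exists>\<Psi> c. (\<Psi> has_real_derivative c) (at s within ?I) \<and> c \<le> 1 / q * (f s + \<kappa>')
          \<and> (\<forall>r\<in>{0..s}. f s + \<kappa>' - (f r + \<kappa>') \<le> \<Psi> s - \<Psi> r)"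
      proof (intro exI [of _ ?\<Psi>] exI [of _ ?c] conjI ballI)
        have "((\<lambda>r. (\<lambda>XY. ?TD (fst XY) (snd XY)) (\<rho> r, ?\<sigma> r)) has_vector_derivative
            (\<lambda>XY. ?TD (fst XY) (snd XY)) (nbody_rhs H A L (\<rho> s),
              ?d\<sigma> s)) (at s within ?I)"
          by (intro bounded_linear.has_vector_derivative [OF bounded_linear_trunc_deriv]
              has_vector_derivative_Pair \<rho>(2) d\<sigma> pe s)
        thus "(?\<Psi> has_real_derivative ?c) (at s within ?I)"
          by (simp add: has_real_derivative_iff_has_vector_derivative)
        obtain d where d: "rel_entropy (\<rho> s) (?\<sigma> s) = ereal d" "d \<le> f s + 1 / S"
          using rel_entropy_trunc [OF \<rho>(1) [OF s] \<sigma> [OF s] S(1)] unfolding f_def by metis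
        have "?c \<le> (d - ln (1 - ?x)) / q + 2 * K * op_norm A
            + ?n ^ 5 * norm (?V s) / S"
          by (rule trunc_deriv_rhs_le [OF sa fl \<rho>(1) [OF s] P [OF s] m(1) [OF s] pm [OF s s] Q' [OF s] lm [OF s s] q x d(1) S(1)])
        also have "\<dots> \<le> (f s + h - ln (1 - ?x)) / q + 2 * K * op_norm A + ?n ^ 5 * V * h"
        proof (intro add_mono divide_right_mono)
          show "?n ^ 5 * norm (?V s) / S \<le> ?n ^ 5 * V * h"
            using V [OF s] S h by (simp add: S_def mult_right_mono mult_left_mono)
        qed (use d(2) S q in auto)
        also have "\<dots> = 1 / q * (f s + \<kappa>')"
          using q by (simp add: \<kappa>'_def \<kappa>_def c_def field_simps)
        finally show "?c \<le> 1 / q * (f s + \<kappa>')" .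
        fix r assume "r \<in> {0..s}"
        hence r: "r \<in> ?I" using s by simp
        have "?TD (\<rho> s - \<rho> r) (?\<sigma> s - ?\<sigma> r) = ?\<Psi> s - ?\<Psi> r"
          by (intro trunc_deriv_diff pe s)
        thus "f s + \<kappa>' - (f r + \<kappa>') \<le> ?\<Psi> s - ?\<Psi> r" using diff [OF s r] by simp
      qed
    qed
    \<comment> \<open>Truncation only lowers the entropy at the initial time; its cost h is paid at
      the final time.\<close>
    moreover have "f 0 \<le> D0"
      using rel_entropy_trunc [OF \<rho>(1) \<sigma> S(1), of 0 0] T D0 unfolding f_def by fastforce
    hence "exp ((1 / q) * t) * (f 0 + \<kappa>') \<le> exp ((1 / q) * t) * (D0 + \<kappa>')" by (intro mult_left_mono) auto
    moreover have "(1 / q) * t = t / q" by simp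
    moreover have "Dt \<le> f t + h"
      using rel_entropy_trunc [OF \<rho>(1) [OF t] \<sigma> [OF t] S(1)] Dt S(2) unfolding f_def by fastforce
    ultimately have "Dt \<le> exp (t / q) * (D0 + \<kappa>') - \<kappa>' + h" by (simp only:)
    thus ?thesis by (simp add: \<kappa>'_def add.assoc)
  qed
  have "((\<lambda>h. exp (t / q) * (D0 + \<kappa> + c * h) - \<kappa> - c * h + h)
      \<longlongrightarrow> exp (t / q) * (D0 + \<kappa> + c * 0) - \<kappa> - c * 0 + 0) (at_right 0)"
    by (intro tendsto_intros)
  hence "Dt \<le> exp (t / q) * (D0 + \<kappa> + c * 0) - \<kappa> - c * 0 + 0"
    by (rule tendsto_lowerbound)
       (use main in \<open>auto intro: eventually_mono [OF eventually_at_right_less]\<close>)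
  \<comment> \<open>This permits dropping the subtracted constant that Gronwall leaves
    behind.\<close>
  moreover have "0 \<le> \<kappa>"
  proof -
    have K0: "0 \<le> K" using mb(4) t by blast
    hence "0 \<le> ?x" using q op_norm_nonneg [of A] by simp
    hence "ln (1 - ?x) \<le> 0" using x by (simp add: ln_le_zero_iff)
    moreover have "0 \<le> 2 * q * op_norm A * K" using q K0 op_norm_nonneg [of A] by simp
    ultimately show ?thesis unfolding \<kappa>_def by linarith
  qed
  ultimately show ?thesis by (simp add: \<kappa>_def)
qed

lemma flip_op_invariant: "flip_op ** A ** flip_op = A \<Longrightarrow> flip_symmetric A"
  unfolding flip_symmetric_def using flip_op_conj_nth [of A] by metis

theorem theorem1:
  fixes T :: real
    and H L \<rho>0 m0 :: "complex ^ 'd ^ ('d::finite)"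
    and A :: "complex ^ ('d \<times> 'd) ^ ('d \<times> 'd)"
    and \<rho> :: "real \<Rightarrow> complex ^ ('n \<Rightarrow> 'd) ^ ('n::{finite,linorder} \<Rightarrow> 'd)"
    and m :: "real \<Rightarrow> complex ^ 'd ^ 'd"
    and q t :: real
  defines "K \<equiv> - ln (lambda_min m0) + (op_norm L)\<^sup>2 * T"
  defines "x \<equiv> 8 * exp 2 * q * op_norm A * K"
  defines "y \<equiv> 16 * exp 1 * q * op_norm A * K"
  defines "C \<equiv> 1 + x / (1 - x)\<^sup>2 + y / (1 - y)"
  defines "HN \<equiv> \<lambda>s. entropy_per_particle (\<rho> s) (m s)"
  assumes "T > 0"
    and "self_adjoint H"
    and "self_adjoint A"
    and "flip_op ** A ** flip_op = A"
    and "\<rho>0 \<in> density_ops"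
    and "solves_in_states T (nbody_rhs H A L) (tensor_power \<rho>0) \<rho>"
    and "m0 \<in> density_ops"
    and "pos_def m0"
    and "solves_in_states T (mean_field_rhs H A L) m0 m"
    and "0 < q"
    and "ereal q < ereal (exp (- 2)) / ereal (8 * op_norm A * K)"
    and "t \<in> {0..T}"
  shows "HN t \<le> ereal (exp (t / q)) *
           (HN 0 + ereal ((ln C + 2 * q * op_norm A * K) / real CARD('n)))"
proof -
  have T0: "0 \<in> {0..T}" using \<open>T > 0\<close> by simp
  have dm: "m s \<in> density_ops" "\<rho> s \<in> density_ops" if "s \<in> {0..T}" for s
    using assms that by (auto simp: solves_in_states_def)
  have pm: "pos_def (m s)" and K0: "0 \<le> K" if s: "s \<in> {0..T}" for s
  proof -
    obtain Q e where "spec (m s) Q e" using spec_exists density_self_adjoint [OF dm(1) [OF s]] by metis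
    from mean_field_op_log_bound [OF \<open>m0 \<in> density_ops\<close> \<open>pos_def m0\<close> less_imp_le [OF \<open>T > 0\<close>] assms(14) s this]
    show "pos_def (m s)" "0 \<le> K" by (simp_all add: K_def)
  qed
  have x0: "0 \<le> x" using K0 [OF T0] \<open>0 < q\<close> op_norm_nonneg [of A] by (simp add: x_def)
  have x1: "x < 1"
  \<comment> \<open>If this product is 0, the extended-real bound on \<open>q\<close> is infinite
    and says nothing, but then x = 0.\<close>
  proof (cases "8 * op_norm A * K = 0")
    case False
    hence pos: "0 < 8 * op_norm A * K" using K0 [OF T0] op_norm_nonneg [of A] by (auto simp: less_le)
    have "q < exp (- 2) / (8 * op_norm A * K)" using assms(16) False by simp
    hence "q * (8 * op_norm A * K) < exp (- 2)" using pos by (simp add: pos_less_divide_eq)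
    hence "exp 2 * (q * (8 * op_norm A * K)) < exp 2 * exp (- 2)" by (intro mult_strict_left_mono) auto
    thus ?thesis by (simp add: x_def exp_add [symmetric] mult_ac)
  qed (auto simp: x_def)
  have xq: "q * (8 * K * op_norm A) * exp 2 = x" by (simp add: x_def)
  have y: "0 \<le> y" "y < 1"
  proof -
    show "0 \<le> y" using K0 [OF T0] \<open>0 < q\<close> op_norm_nonneg [of A] by (simp add: y_def)
    \<comment> \<open>Thus y = 2 x / e, which is at most x because e is at least 2.\<close>
    have "exp 1 * y = 2 * x" by (simp add: x_def y_def exp_add [of 1 1, simplified])
    moreover have "2 \<le> exp (1::real)" using exp_ge_add_one_self [of 1] by simp
    hence "2 * y \<le> exp 1 * y" using \<open>0 \<le> y\<close> by (intro mult_right_mono) auto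
    ultimately show "y < 1" using x1 by linarith
  qed
  \<comment> \<open>The geometric sum 1/(1 - x) equals 1 + x/(1 - x), and dividing by 1 - x once
    more only enlarges the second term.\<close>
  have lnC: "- ln (1 - x) \<le> ln C"
  proof -
    have "1 / (1 - x) = 1 + x / (1 - x)" using x1 by (simp add: field_simps)
    also have "x / (1 - x) \<le> x / (1 - x)\<^sup>2"
      using x0 x1 by (intro divide_left_mono) (auto simp: power2_eq_square mult_le_one intro!: mult_left_le)
    also have "1 + x / (1 - x)\<^sup>2 \<le> C" using y by (simp add: C_def)
    finally have "ln (1 / (1 - x)) \<le> ln C" using x1 by (intro ln_mono) auto
    thus ?thesis using x1 by (simp add: ln_div)
  qed
  obtain D0 where D0: "rel_entropy (\<rho> 0) (tensor_power (m 0)) = ereal D0"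
    using rel_entropy_trunc [OF dm(2) [OF T0] tensor_power_density [OF dm(1) [OF T0]]
        tensor_power_pos_def [OF pm [OF T0]], of 1] by auto
  obtain Dt where Dt: "rel_entropy (\<rho> t) (tensor_power (m t)) = ereal Dt"
    using rel_entropy_trunc [OF dm(2) [OF assms(17)] tensor_power_density [OF dm(1) [OF assms(17)]]
        tensor_power_pos_def [OF pm [OF assms(17)]], of 1] by auto
  have "Dt \<le> exp (t / q) * (D0 + (- ln (1 - x) + 2 * q * op_norm A * K))"
    using entropy_growth [OF \<open>T > 0\<close> \<open>self_adjoint H\<close> \<open>self_adjoint A\<close> flip_op_invariant [OF assms(9)]
        assms(11,12,13,14) K_def [THEN meta_eq_to_obj_eq] \<open>0 < q\<close> _ \<open>t \<in> {0..T}\<close> D0 Dt] x1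
    unfolding xq by simp
  also have "\<dots> \<le> exp (t / q) * (D0 + (ln C + 2 * q * op_norm A * K))"
    using lnC by (intro mult_left_mono) auto
  finally have "1 / real CARD('n) * Dt
      \<le> 1 / real CARD('n) * (exp (t / q) * (D0 + (ln C + 2 * q * op_norm A * K)))"
    by (intro mult_left_mono) auto
  also have "\<dots> = exp (t / q) * (1 / real CARD('n) * D0 + (ln C + 2 * q * op_norm A * K) / real CARD('n))"
    by (simp add: field_simps)
  finally show ?thesis by (simp add: HN_def entropy_per_particle_def D0 Dt)
qed

end
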